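(* Let $\{X_{t,T}\}_{t=1}^{T}$, $T\ge 1$, be a locally stationary functional time series in $L^4_H$: for every $u\in[0,1]$ there is an associated process $\{X_t^{(u)}\}_{t\in\mathbb Z}$ in $L^4_H$ as in the definition of local stationarity with $p=4$ and some $\rho\ge 2$. Assume moreover that for every $u$ the process $\{X_t^{(u)}\}$ is $L^4$-$m$-approximable and $E[X_t^{(u)}]=0$ in $L^2$. Let $K_1:\mathbb R\to\mathbb R$ be symmetric around zero, bounded, Lipschitz continuous, with $K_1(v)=0$ for all $|v|>C_1$ for some $C_1<\infty$, and $\int K_1(z)\,dz=1$. Let $h=h_T>0$ with $h\to0$ as $T\to\infty$, and put $K_{1,h}(x)=K_1(x/h)$. Let $C_u=E[X_t^{(u)}\otimes X_t^{(u)}]$ and $$\hat C_u=\frac1{Th}\sum_{t=1}^{T}K_{1,h}\Big(u-\frac tT\Big)X_{t,T}\otimes X_{t,T}.$$ Then, as $T\to\infty$, for each $u\in[C_1h,1-C_1h]$, $$\|\hat C_u-C_u\|_{\mathcal L}=O_P\Big(h+\sqrt{\tfrac1{Th}}+\tfrac1{Th^2}\Big).$$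
   Context: $H=L^2=L^2([0,1]^d)$ is the real Hilbert space with $\langle x,y\rangle=\int_{[0,1]^d}x(t)y(t)\,dt$ and norm $\|\cdot\|$. $L^p_H$ is the space of $H$-valued random functions $X$ on a probability space with $v_p(X)=(E\|X\|^p)^{1/p}<\infty$. $\|\cdot\|_{\mathcal L}$ is the operator norm on bounded linear operators on $H$, and $(f\otimes g)(x)=\langle g,x\rangle f$. The statement is pointwise in $u$: $u\in(0,1)$ is fixed, and it lies in $[C_1h,1-C_1h]$ for all large $T$. Local stationarity. $\{X_{t,T}\}_{t=1}^T$ in $L^p_H$ is locally stationary if for each $u\in[0,1]$ there is an $H$-valued process $\{X_t^{(u)}\}_{t\in\mathbb Z}$ in $L^p_H$ such that (i) $\{X_t^{(u)}\}_t$ is strictly stationary; (ii) for all $1\le t\le T$, almost surely $$\|X_{t,T}-X_t^{(u)}\|\le\Big(\Big|\frac tT-u\Big|+\frac1T\Big)U_{t,T}^{(u)},$$ where $U_{t,T}^{(u)}$ are positive random variables with $E[(U_{t,T}^{(u)})^\rho]<C$ for some $\rho>0$ and $C<\infty$ independent of $u,t,T$. $L^p$-$m$-approximability. $\{X_t^{(u)}\}$ is $L^p$-$m$-approximable if $X_t^{(u)}\in L^p_H$ has the form $X_t^{(u)}=f_u(\varepsilon_t,\varepsilon_{t-1},\dots)$ with $\varepsilon_j$ i.i.d. elements of a measurable space $S$ and $f_u:S^\infty\to H$ measurable, and, with $\{\varepsilon_{t,k}^{(m)}\}_k$ (for each $t$ and $m$) independent copies of $\{\varepsilon_k\}_k$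 defined on the same probability space and $$X_{m,t}^{(u)}=f_u(\varepsilon_t,\dots,\varepsilon_{t-m+1},\varepsilon_{t,t-m}^{(m)},\varepsilon_{t,t-m-1}^{(m)},\dots),$$ one has $\sum_{m\ge1}v_p(X_t^{(u)}-X_{m,t}^{(u)})<\infty$. *)

theory Defs
  imports "HOL-Probability.Probability"
begin

abbreviation cube_measure :: "(real ^ 'd) measure"
  where "cube_measure \<equiv> lebesgue_on (cbox 0 1)"

definition square_integrable :: "(real ^ 'd \<Rightarrow> real) \<Rightarrow> bool"
  where "square_integrable f \<longleftrightarrow>
    f \<in> borel_measurable cube_measure \<and> integrable cube_measure (\<lambda>t. (f t)\<^sup>2)"

lemma square_integrableI:
  assumes "f \<in> borel_measurable cube_measure" "g \<in> borel_measurable cube_measure"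
    and "integrable cube_measure g" "\<And>t. (f t)\<^sup>2 \<le> g t"
  shows "square_integrable f"
  unfolding square_integrable_def
proof
  show "integrable cube_measure (\<lambda>t. (f t)\<^sup>2)"
    by (rule Bochner_Integration.integrable_bound[OF assms(3)])
       (use assms in \<open>auto intro!: AE_I2 order_trans[OF assms(4)]\<close>)
qed fact

lemma square_integrable_zero: "square_integrable (\<lambda>_. 0)"
  by (simp add: square_integrable_def)

lemma square_integrable_mult_integrable:
  assumes "square_integrable f" "square_integrable g"
  shows "integrable cube_measure (\<lambda>t. f t * g t)"
proof -
  have "integrable cube_measure (\<lambda>t. (f t)\<^sup>2 + (g t)\<^sup>2)"
    using assms by (auto simp: square_integrable_def)
  then show ?thesis
  proof (rule Bochner_Integration.integrable_bound)
    show "(\<lambda>t. f t * g t) \<in> borel_measurable cube_measure"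
      using assms by (auto simp: square_integrable_def)
    have "\<bar>x * y\<bar> \<le> x\<^sup>2 + y\<^sup>2" for x y :: real
    proof -
      have "0 \<le> (\<bar>x\<bar> - \<bar>y\<bar>)\<^sup>2" by simp
      then have "2 * (\<bar>x\<bar> * \<bar>y\<bar>) \<le> x\<^sup>2 + y\<^sup>2" by (simp add: power2_diff)
      moreover have "0 \<le> \<bar>x\<bar> * \<bar>y\<bar>" by simp
      ultimately show ?thesis unfolding abs_mult by linarith
    qed
    then show "AE t in cube_measure. norm (f t * g t) \<le> norm ((f t)\<^sup>2 + (g t)\<^sup>2)"
      by (auto intro!: AE_I2)
  qed
qed

lemma square_integrable_add:
  assumes "square_integrable f" "square_integrable g"
  shows "square_integrable (\<lambda>t. f t + g t)"
  using assms square_integrable_mult_integrable[OF assms]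
  by (auto simp: square_integrable_def power2_sum mult.assoc)

lemma square_integrable_scale:
  "square_integrable f \<Longrightarrow> square_integrable (\<lambda>t. c * f t)"
  by (auto simp: square_integrable_def power_mult_distrib)

lemma square_integrable_minus:
  "square_integrable f \<Longrightarrow> square_integrable (\<lambda>t. - f t)"
  by (auto simp: square_integrable_def)

lemma square_integrable_diff:
  assumes "square_integrable f" "square_integrable g"
  shows "square_integrable (\<lambda>t. f t - g t)"
  using square_integrable_add[OF assms(1) square_integrable_minus[OF assms(2)]] by simp

definition l2_eq :: "(real ^ 'd \<Rightarrow> real) \<Rightarrow> (real ^ 'd \<Rightarrow> real) \<Rightarrow> bool"
  where "l2_eq f g \<longleftrightarrow>
    square_integrable f \<and> square_integrable g \<and> (AE t in cube_measure. f t = g t)"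

text \<open>The real Hilbert space \<open>L\<^sup>2([0,1]\<^sup>d)\<close> with \<open>d = CARD('d)\<close>: square-integrable functions on the unit
  cube modulo equality almost everywhere. It is shown below to be a complete separable real
  inner product space, which is what the Bochner integral requires.\<close>

quotient_type 'd l2_cube = "real ^ 'd \<Rightarrow> real" / partial: l2_eq
proof (rule part_equivpI)
  show "\<exists>f. l2_eq f f" by (auto simp: l2_eq_def intro!: exI[of _ "\<lambda>_. 0"] square_integrable_zero)
  show "symp l2_eq" by (auto simp: symp_def l2_eq_def)
  show "transp l2_eq" by (auto simp: transp_def l2_eq_def)
qed

instantiation l2_cube :: (finite) real_vector
begin

lift_definition zero_l2_cube :: "'a l2_cube" is "\<lambda>_. 0"
  by (simp add: l2_eq_def square_integrable_zero)

lift_definition plus_l2_cube :: "'a l2_cube \<Rightarrow> 'a l2_cube \<Rightarrow> 'a l2_cube"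
  is "\<lambda>f g t. f t + g t"
  by (auto simp: l2_eq_def square_integrable_add)

lift_definition minus_l2_cube :: "'a l2_cube \<Rightarrow> 'a l2_cube \<Rightarrow> 'a l2_cube"
  is "\<lambda>f g t. f t - g t"
  by (auto simp: l2_eq_def square_integrable_diff)

lift_definition uminus_l2_cube :: "'a l2_cube \<Rightarrow> 'a l2_cube"
  is "\<lambda>f t. - f t"
  by (auto simp: l2_eq_def square_integrable_minus)

lift_definition scaleR_l2_cube :: "real \<Rightarrow> 'a l2_cube \<Rightarrow> 'a l2_cube"
  is "\<lambda>c f t. c * f t"
  by (auto simp: l2_eq_def square_integrable_scale)

instance
proof
  fix f g k :: "'a l2_cube" and a b :: real
  show "f + g + k = f + (g + k)"
    by transfer (auto simp: l2_eq_def algebra_simps intro!: square_integrable_add)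
  show "f + g = g + f"
    by transfer (auto simp: l2_eq_def algebra_simps intro!: square_integrable_add)
  show "0 + f = f"
    by transfer (auto simp: l2_eq_def)
  show "- f + f = 0"
    by transfer (auto simp: l2_eq_def square_integrable_zero)
  show "f - g = f + - g"
    by transfer (auto simp: l2_eq_def square_integrable_diff)
  show "a *\<^sub>R (f + g) = a *\<^sub>R f + a *\<^sub>R g"
    by transfer (auto simp: l2_eq_def algebra_simps
        intro!: square_integrable_add square_integrable_scale)
  show "(a + b) *\<^sub>R f = a *\<^sub>R f + b *\<^sub>R f"
    by transfer (auto simp: l2_eq_def algebra_simps
        intro!: square_integrable_add square_integrable_scale)
  show "a *\<^sub>R b *\<^sub>R f = (a * b) *\<^sub>R f"
    by transfer (auto simp: l2_eq_def mult.assoc intro!: square_integrable_scale)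
  show "1 *\<^sub>R f = f"
    by transfer (auto simp: l2_eq_def)
qed

end

instantiation l2_cube :: (finite) real_inner
begin

lift_definition inner_l2_cube :: "'a l2_cube \<Rightarrow> 'a l2_cube \<Rightarrow> real"
  is "\<lambda>f g. \<integral>t. f t * g t \<partial>cube_measure"
  by (rule integral_cong_AE) (auto simp: l2_eq_def square_integrable_def)

definition norm_l2_cube :: "'a l2_cube \<Rightarrow> real"
  where "norm_l2_cube f = sqrt (inner f f)"

definition sgn_l2_cube :: "'a l2_cube \<Rightarrow> 'a l2_cube"
  where "sgn_l2_cube f = f /\<^sub>R norm f"

definition dist_l2_cube :: "'a l2_cube \<Rightarrow> 'a l2_cube \<Rightarrow> real"
  where "dist_l2_cube f g = norm (f - g)"

definition uniformity_l2_cube :: "('a l2_cube \<times> 'a l2_cube) filter"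
  where "uniformity_l2_cube = (INF e\<in>{0 <..}. principal {(f, g). dist f g < e})"

definition open_l2_cube :: "'a l2_cube set \<Rightarrow> bool"
  where "open_l2_cube U \<longleftrightarrow> (\<forall>f\<in>U. eventually (\<lambda>(f', g). f' = f \<longrightarrow> g \<in> U) uniformity)"

instance
proof
  fix f g k :: "'a l2_cube" and a :: real and U :: "'a l2_cube set"
  show "dist f g = norm (f - g)" by (rule dist_l2_cube_def)
  show "sgn f = f /\<^sub>R norm f" by (rule sgn_l2_cube_def)
  show "(uniformity :: ('a l2_cube \<times> 'a l2_cube) filter)
      = (INF e\<in>{0 <..}. principal {(f, g). dist f g < e})"
    by (rule uniformity_l2_cube_def)
  show "open U = (\<forall>f\<in>U. \<forall>\<^sub>F (f', g) in uniformity. f' = f \<longrightarrow> g \<in> U)"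
    by (rule open_l2_cube_def)
  show "inner f g = inner g f"
    by transfer (simp add: mult.commute)
  show "inner (f + g) k = inner f k + inner g k"
    by transfer (simp add: l2_eq_def algebra_simps square_integrable_mult_integrable)
  show "inner (a *\<^sub>R f) g = a * inner f g"
    by transfer (simp add: mult.assoc)
  show "0 \<le> inner f f"
    by transfer simp
  show "(inner f f = 0) = (f = 0)"
  proof transfer
    fix f :: "real ^ 'a \<Rightarrow> real" assume "l2_eq f f"
    then have f: "square_integrable f" by (simp add: l2_eq_def)
    then have "(\<integral>t. f t * f t \<partial>cube_measure) = 0 \<longleftrightarrow> (AE t in cube_measure. f t * f t = 0)"
      by (intro integral_nonneg_eq_0_iff_AE)
         (auto simp: square_integrable_def power2_eq_square)
    then show "((\<integral>t. f t * f t \<partial>cube_measure) = 0) = l2_eq f (\<lambda>_. 0)"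
      using f by (simp add: l2_eq_def square_integrable_zero)
  qed
  show "norm f = sqrt (inner f f)" by (rule norm_l2_cube_def)
qed

end

lemma l2_cube_cases:
  obtains f where "square_integrable f" "x = abs_l2_cube f"
proof -
  have "\<exists>f. square_integrable f \<and> x = abs_l2_cube f"
    by (induction x rule: l2_cube.abs_induct) (auto simp: l2_eq_def)
  then show ?thesis using that by blast
qed

lemma l2_eq_refl: "square_integrable f \<Longrightarrow> l2_eq f f"
  by (simp add: l2_eq_def)

lemma abs_l2_cube_eqI:
  "square_integrable f \<Longrightarrow> square_integrable g \<Longrightarrow> AE t in cube_measure. f t = g t \<Longrightarrow>
    abs_l2_cube f = abs_l2_cube g"
  using Quotient_rel_abs[OF Quotient_l2_cube, of f g] by (simp add: l2_eq_def)

lemma abs_l2_cube_add: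
  "square_integrable f \<Longrightarrow> square_integrable g \<Longrightarrow>
    abs_l2_cube f + abs_l2_cube g = abs_l2_cube (\<lambda>t. f t + g t)"
  by (simp add: plus_l2_cube.abs_eq l2_eq_refl)

lemma abs_l2_cube_diff:
  "square_integrable f \<Longrightarrow> square_integrable g \<Longrightarrow>
    abs_l2_cube f - abs_l2_cube g = abs_l2_cube (\<lambda>t. f t - g t)"
  by (simp add: minus_l2_cube.abs_eq l2_eq_refl)

lemma abs_l2_cube_scaleR:
  "square_integrable f \<Longrightarrow> c *\<^sub>R abs_l2_cube f = abs_l2_cube (\<lambda>t. c * f t)"
  by (simp add: scaleR_l2_cube.abs_eq l2_eq_refl)

lemma abs_l2_cube_inner:
  "square_integrable f \<Longrightarrow> square_integrable g \<Longrightarrow>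
    inner (abs_l2_cube f) (abs_l2_cube g) = (\<integral>t. f t * g t \<partial>cube_measure)"
  by (simp add: inner_l2_cube.abs_eq l2_eq_refl)

lemma norm_abs_l2_cube:
  "square_integrable f \<Longrightarrow> (norm (abs_l2_cube f))\<^sup>2 = (\<integral>t. (f t)\<^sup>2 \<partial>cube_measure)"
  unfolding power2_norm_eq_inner by (simp add: abs_l2_cube_inner power2_eq_square)

lemma nn_integral_abs_l2_cube:
  assumes "square_integrable f"
  shows "(\<integral>\<^sup>+t. ennreal ((f t)\<^sup>2) \<partial>cube_measure) = ennreal ((norm (abs_l2_cube f))\<^sup>2)"
  unfolding norm_abs_l2_cube[OF assms]
  using assms by (intro nn_integral_eq_integral) (auto simp: square_integrable_def)

lemma finite_cube_measure: "finite_measure (cube_measure :: (real ^ 'd) measure)"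
  by (rule finite_measure_lebesgue_on) simp

lemma square_integrable_bounded:
  assumes "f \<in> borel_measurable cube_measure" "\<And>t. \<bar>f t\<bar> \<le> B"
  shows "square_integrable f"
proof (rule square_integrableI[OF assms(1)])
  interpret finite_measure "cube_measure :: (real ^ 'd) measure" by (rule finite_cube_measure)
  show "integrable (cube_measure :: (real ^ 'd) measure) (\<lambda>_. B\<^sup>2)" by simp
  show "(f t)\<^sup>2 \<le> B\<^sup>2" for t
    using power_mono[OF assms(2)[of t] abs_ge_zero, of 2] by simp
qed simp

lemma square_integrable_abs: "square_integrable f \<Longrightarrow> square_integrable (\<lambda>t. \<bar>f t\<bar>)"
  by (auto simp: square_integrable_def)

lemma l2_cube_complete:
  fixes X :: "nat \<Rightarrow> 'd::finite l2_cube"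
  assumes X: "Cauchy X"
  shows "convergent X"
proof -
  let ?N = "cube_measure :: (real ^ 'd) measure"
  have "\<exists>r::nat \<Rightarrow> nat. strict_mono r \<and> (\<forall>n. norm (X (r (Suc n)) - X (r n)) < (1/2) ^ n)"
  proof -
    have "\<exists>N. \<forall>m\<ge>N. \<forall>n\<ge>N. norm (X m - X n) < (1/2) ^ k" for k
      using X by (simp add: Cauchy_iff)
    then obtain N where N: "\<And>k m n. m \<ge> N k \<Longrightarrow> n \<ge> N k \<Longrightarrow> norm (X m - X n) < (1/2) ^ k"
      by metis
    define r where "r k = k + (\<Sum>i\<le>k. N i)" for k
    have "strict_mono r" by (auto simp: r_def strict_mono_Suc_iff)
    moreover have "N k \<le> r k" for k
      unfolding r_def by (rule trans_le_add2, rule member_le_sum) auto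
    ultimately show ?thesis
      using N by (intro exI[of _ r]) (meson le_trans lessI less_imp_le strict_mono_less_eq)
  qed
  then obtain r where r: "strict_mono r"
    and rd: "\<And>n. norm (X (r (Suc n)) - X (r n)) < (1/2) ^ n" by blast
  have "\<exists>f. square_integrable f \<and> X (r n) = abs_l2_cube f" for n
    using l2_cube_cases[of "X (r n)"] by metis
  then obtain f where f: "\<And>n. square_integrable (f n)" and Xf: "\<And>n. X (r n) = abs_l2_cube (f n)"
    by metis
  have fm[measurable]: "f n \<in> borel_measurable ?N" for n
    using f by (simp add: square_integrable_def)
  define u where "u n t = \<bar>f (Suc n) t - f n t\<bar>" for n t
  have u_nn: "0 \<le> u n t" for n t by (simp add: u_def)
  have u: "square_integrable (u n)" for n
    unfolding u_def by (intro square_integrable_abs square_integrable_diff f)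
  have um[measurable]: "u n \<in> borel_measurable ?N" for n
    using u by (simp add: square_integrable_def)
  have one: "square_integrable (\<lambda>_::real^'d. 1)"
    by (rule square_integrable_bounded[of _ 1]) auto
  have unorm: "norm (abs_l2_cube (u n)) = norm (X (r (Suc n)) - X (r n))" for n
  proof -
    have "(norm (abs_l2_cube (u n)))\<^sup>2 = (norm (X (r (Suc n)) - X (r n)))\<^sup>2"
      by (simp add: Xf abs_l2_cube_diff f norm_abs_l2_cube u square_integrable_diff)
         (simp add: u_def)
    then show ?thesis by simp
  qed
  have uint: "integrable ?N (u n)" for n
    using square_integrable_mult_integrable[OF u one] by simp
  define c where "c = norm (abs_l2_cube (\<lambda>_::real^'d. 1))"
  have ule: "(\<integral>t. u n t \<partial>?N) \<le> (1/2) ^ n * c" for n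
  proof -
    have "(\<integral>t. u n t \<partial>?N) = inner (abs_l2_cube (u n)) (abs_l2_cube (\<lambda>_. 1))"
      by (simp add: abs_l2_cube_inner u one)
    also have "\<dots> \<le> norm (abs_l2_cube (u n)) * c"
      unfolding c_def by (rule norm_cauchy_schwarz)
    also have "\<dots> \<le> (1/2) ^ n * c"
      using rd[of n] by (intro mult_right_mono) (auto simp: unorm c_def)
    finally show ?thesis .
  qed
  have "(\<integral>\<^sup>+t. (\<Sum>n. ennreal (u n t)) \<partial>?N) = (\<Sum>n. \<integral>\<^sup>+t. ennreal (u n t) \<partial>?N)"
    by (rule nn_integral_suminf) simp
  also have "\<dots> \<le> (\<Sum>n. ennreal ((1/2) ^ n * c))"
  proof (intro suminf_le)
    fix n
    show "(\<integral>\<^sup>+t. ennreal (u n t) \<partial>?N) \<le> ennreal ((1/2) ^ n * c)"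
      using ule[of n] uint[of n]
      by (subst nn_integral_eq_integral) (auto intro!: ennreal_leI AE_I2 simp: u_nn)
  qed auto
  also have "\<dots> = ennreal (\<Sum>n. (1/2) ^ n * c)"
    by (rule suminf_ennreal2) (auto simp: c_def intro!: summable_mult2 summable_geometric)
  also have "\<dots> < \<infinity>" by simp
  finally have "AE t in ?N. (\<Sum>n. ennreal (u n t)) \<noteq> \<infinity>"
    by (intro nn_integral_PInf_AE) auto
  then have conv: "AE t in ?N. convergent (\<lambda>n. f n t)"
  proof (rule AE_mp, intro AE_I2 impI)
    fix t assume "(\<Sum>n. ennreal (u n t)) \<noteq> \<infinity>"
    then have "summable (\<lambda>n. u n t)"
      by (intro summable_suminf_not_top) (auto simp: u_def)
    then have "summable (\<lambda>n. f (Suc n) t - f n t)"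
      unfolding u_def by (rule summable_rabs_cancel)
    then obtain l where "(\<lambda>n. \<Sum>i<n. f (Suc i) t - f i t) \<longlonglongrightarrow> l"
      by (auto simp: summable_def sums_def)
    then have "(\<lambda>n. f n t - f 0 t) \<longlonglongrightarrow> l" by (simp add: sum_lessThan_telescope[of "\<lambda>i. f i t"])
    from tendsto_add[OF this tendsto_const[of "f 0 t"]] show "convergent (\<lambda>n. f n t)"
      by (auto simp: convergent_def)
  qed
  define F where "F t = lim (\<lambda>n. f n t)" for t
  have Fm[measurable]: "F \<in> borel_measurable ?N"
    unfolding F_def by measurable
  have FAE: "AE t in ?N. (\<lambda>n. f n t) \<longlonglongrightarrow> F t"
    using conv by eventually_elim (simp add: F_def convergent_LIMSEQ_iff)
  have fatou: "(\<integral>\<^sup>+t. ennreal ((F t - f n t)\<^sup>2) \<partial>?N) \<le> ennreal (e\<^sup>2)"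
    if e: "\<And>j. j \<ge> n \<Longrightarrow> norm (X (r j) - X (r n)) \<le> e" for n and e :: real
  proof -
    have "(\<integral>\<^sup>+t. ennreal ((F t - f n t)\<^sup>2) \<partial>?N)
        = (\<integral>\<^sup>+t. liminf (\<lambda>j. ennreal ((f j t - f n t)\<^sup>2)) \<partial>?N)"
    proof (rule nn_integral_cong_AE)
      show "AE t in ?N. ennreal ((F t - f n t)\<^sup>2) = liminf (\<lambda>j. ennreal ((f j t - f n t)\<^sup>2))"
        using FAE
      proof eventually_elim
        fix t assume "(\<lambda>j. f j t) \<longlonglongrightarrow> F t"
        then have "(\<lambda>j. ennreal ((f j t - f n t)\<^sup>2)) \<longlonglongrightarrow> ennreal ((F t - f n t)\<^sup>2)"
          by (intro tendsto_intros) auto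
        then show "ennreal ((F t - f n t)\<^sup>2) = liminf (\<lambda>j. ennreal ((f j t - f n t)\<^sup>2))"
          by (rule lim_imp_Liminf[symmetric, rotated]) simp
      qed
    qed
    also have "\<dots> \<le> liminf (\<lambda>j. \<integral>\<^sup>+t. ennreal ((f j t - f n t)\<^sup>2) \<partial>?N)"
      by (rule nn_integral_liminf) simp
    also have "\<dots> \<le> liminf (\<lambda>j::nat. ennreal (e\<^sup>2))"
    proof (rule Liminf_mono, rule eventually_sequentiallyI[of n])
      fix j assume "n \<le> j"
      have "(\<integral>\<^sup>+t. ennreal ((f j t - f n t)\<^sup>2) \<partial>?N) = ennreal ((norm (X (r j) - X (r n)))\<^sup>2)"
        by (simp add: nn_integral_abs_l2_cube[OF square_integrable_diff[OF f f]]
              Xf abs_l2_cube_diff f)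
      also have "\<dots> \<le> ennreal (e\<^sup>2)"
        using e[OF \<open>n \<le> j\<close>] by (intro ennreal_leI power_mono) auto
      finally show "(\<integral>\<^sup>+t. ennreal ((f j t - f n t)\<^sup>2) \<partial>?N) \<le> ennreal (e\<^sup>2)" .
    qed
    also have "\<dots> = ennreal (e\<^sup>2)" by (simp add: Liminf_const)
    finally show ?thesis .
  qed
  have near: "square_integrable (\<lambda>t. F t - f n t) \<and> norm (abs_l2_cube (\<lambda>t. F t - f n t)) \<le> e"
    if e: "\<And>j. j \<ge> n \<Longrightarrow> norm (X (r j) - X (r n)) \<le> e" for n and e :: real
  proof -
    have "0 \<le> e" using e[of n] by simp
    have *: "(\<integral>\<^sup>+t. ennreal ((F t - f n t)\<^sup>2) \<partial>?N) \<le> ennreal (e\<^sup>2)" by (rule fatou) (rule e)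
    then have "integrable ?N (\<lambda>t. (F t - f n t)\<^sup>2)"
      by (intro integrableI_bounded) (auto intro: le_less_trans)
    then have sq: "square_integrable (\<lambda>t. F t - f n t)" by (simp add: square_integrable_def)
    have "(norm (abs_l2_cube (\<lambda>t. F t - f n t)))\<^sup>2 \<le> e\<^sup>2"
      using * unfolding nn_integral_abs_l2_cube[OF sq] by (simp add: ennreal_le_iff)
    with \<open>0 \<le> e\<close> sq show ?thesis by (metis power2_le_imp_le)
  qed
  have tail: "\<exists>n. \<forall>m\<ge>n. \<forall>j\<ge>m. norm (X (r j) - X (r m)) \<le> e" if e: "e > 0" for e
  proof -
    obtain N where N: "\<And>m n. m \<ge> N \<Longrightarrow> n \<ge> N \<Longrightarrow> norm (X m - X n) < e"
      using X e unfolding Cauchy_iff by meson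
    have "norm (X (r j) - X (r m)) \<le> e" if "m \<ge> N" "j \<ge> m" for m j
      using N[of "r j" "r m"] seq_suble[OF r, of m] seq_suble[OF r, of j] that by auto
    then show ?thesis by blast
  qed
  have F: "square_integrable F"
  proof -
    obtain n where "\<forall>j\<ge>n. norm (X (r j) - X (r n)) \<le> 1" using tail[of 1] by auto
    with near[of n 1] have "square_integrable (\<lambda>t. F t - f n t)" by auto
    from square_integrable_add[OF this f[of n]] show ?thesis by simp
  qed
  have "(\<lambda>n. X (r n)) \<longlonglongrightarrow> abs_l2_cube F"
  proof (rule LIMSEQ_I)
    fix e :: real assume "e > 0"
    then obtain n where n: "\<forall>m\<ge>n. \<forall>j\<ge>m. norm (X (r j) - X (r m)) \<le> e / 2"
      using tail[of "e/2"] by auto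
    have "norm (X (r m) - abs_l2_cube F) < e" if "m \<ge> n" for m
    proof -
      have "norm (abs_l2_cube F - X (r m)) \<le> e / 2"
        using near[of m "e/2"] n that by (auto simp: Xf abs_l2_cube_diff F f)
      with \<open>e > 0\<close> show ?thesis by (simp add: norm_minus_commute)
    qed
    then show "\<exists>n. \<forall>m\<ge>n. norm (X (r m) - abs_l2_cube F) < e" by blast
  qed
  then have "(X \<circ> r) \<longlonglongrightarrow> abs_l2_cube F" by (simp add: o_def)
  with X r have "X \<longlonglongrightarrow> abs_l2_cube F"
    by (rule Cauchy_converges_subseq)
  then show ?thesis by (rule convergentI)
qed

lemma abs_l2_cube_tendsto:
  fixes g :: "nat \<Rightarrow> real ^ 'd::finite \<Rightarrow> real"
  assumes g: "\<And>n. square_integrable (g n)" and f: "square_integrable f"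
    and le: "\<And>n t. \<bar>g n t\<bar> \<le> \<bar>f t\<bar>"
    and lim: "\<And>t. t \<in> cbox 0 1 \<Longrightarrow> (\<lambda>n. g n t) \<longlonglongrightarrow> f t"
  shows "(\<lambda>n. abs_l2_cube (g n)) \<longlonglongrightarrow> abs_l2_cube f"
proof -
  let ?N = "cube_measure :: (real ^ 'd) measure"
  have [measurable]: "g n \<in> borel_measurable ?N" "f \<in> borel_measurable ?N" for n
    using g f by (auto simp: square_integrable_def)
  have "(\<lambda>n. \<integral>t. (g n t - f t)\<^sup>2 \<partial>?N) \<longlonglongrightarrow> (\<integral>t. 0 \<partial>?N)"
  proof (rule integral_dominated_convergence[where w = "\<lambda>t. 4 * (f t)\<^sup>2"])
    show "integrable ?N (\<lambda>t. 4 * (f t)\<^sup>2)"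
      using f by (auto simp: square_integrable_def)
    show "AE t in ?N. (\<lambda>n. (g n t - f t)\<^sup>2) \<longlonglongrightarrow> 0"
    proof (rule AE_I2)
      fix t assume "t \<in> space ?N"
      then have "(\<lambda>n. (g n t - f t)\<^sup>2) \<longlonglongrightarrow> (f t - f t)\<^sup>2"
        by (intro tendsto_intros lim) simp
      then show "(\<lambda>n. (g n t - f t)\<^sup>2) \<longlonglongrightarrow> 0" by simp
    qed
    have "\<bar>g n t - f t\<bar>\<^sup>2 \<le> (2 * \<bar>f t\<bar>)\<^sup>2" for n t
      using le[of n t] by (intro power_mono) auto
    then show "AE t in ?N. norm ((g n t - f t)\<^sup>2) \<le> 4 * (f t)\<^sup>2" for n
      by (simp add: power_mult_distrib)
  qed auto
  then have "(\<lambda>n. (norm (abs_l2_cube (g n) - abs_l2_cube f))\<^sup>2) \<longlonglongrightarrow> 0"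
    by (simp add: abs_l2_cube_diff g f norm_abs_l2_cube square_integrable_diff)
  then have "(\<lambda>n. sqrt ((norm (abs_l2_cube (g n) - abs_l2_cube f))\<^sup>2)) \<longlonglongrightarrow> sqrt 0"
    by (intro tendsto_real_sqrt)
  then have "(\<lambda>n. norm (abs_l2_cube (g n) - abs_l2_cube f)) \<longlonglongrightarrow> 0" by simp
  then show ?thesis using LIM_zero_cancel tendsto_norm_zero_iff by blast
qed

lemma subspace_closure:
  fixes S :: "'a::real_normed_vector set"
  assumes "subspace S"
  shows "subspace (closure S)"
proof (rule subspaceI)
  show "0 \<in> closure S"
    using subspace_0[OF assms] closure_subset by blast
next
  fix x y assume "x \<in> closure S" "y \<in> closure S"
  then obtain X Y where XY: "\<And>n::nat. X n \<in> S" "X \<longlonglongrightarrow> x" "\<And>n::nat. Y n \<in> S" "Y \<longlonglongrightarrow> y"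
    unfolding closure_sequential by blast
  then show "x + y \<in> closure S"
    unfolding closure_sequential
    by (intro exI[of _ "\<lambda>n. X n + Y n"]) (auto intro!: tendsto_add subspace_add[OF assms])
next
  fix c x assume "x \<in> closure S"
  then obtain X where X: "\<And>n::nat. X n \<in> S" "X \<longlonglongrightarrow> x"
    unfolding closure_sequential by blast
  then show "c *\<^sub>R x \<in> closure S"
    unfolding closure_sequential
    by (intro exI[of _ "\<lambda>n. c *\<^sub>R X n"])
       (auto intro!: tendsto_scaleR subspace_scale[OF assms])
qed

lemma closure_span_indicators:
  fixes G :: "(real ^ 'd::finite) set set"
  assumes G: "Int_stable G" "UNIV \<in> G" and GB: "(borel :: (real ^ 'd) measure) = sigma UNIV G"
  shows "closure (span ((\<lambda>A. abs_l2_cube (indicator A)) ` G)) = UNIV" (is "?V = UNIV")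
proof -
  let ?N = "cube_measure :: (real ^ 'd) measure"
  have GU: "G \<subseteq> Pow UNIV" by simp
  have sb: "sets borel = sigma_sets UNIV G" by (simp add: GB)
  have borel_N: "f \<in> borel_measurable ?N" if "f \<in> borel_measurable borel"
    for f :: "real ^ 'd \<Rightarrow> real"
    using that by (intro measurable_restrict_space1 measurable_completion) simp
  have subV: "subspace ?V" by (intro subspace_closure subspace_span)
  have sq: "square_integrable (indicator A :: real ^ 'd \<Rightarrow> real)" if "A \<in> sets borel" for A
    using that
    by (intro square_integrable_bounded[of _ 1] borel_N) (auto simp: indicator_def)
  have ind0: "abs_l2_cube (indicator {} :: real ^ 'd \<Rightarrow> real) \<in> ?V"
  proof -
    have "abs_l2_cube (indicator {} :: real ^ 'd \<Rightarrow> real) = 0"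
      by (simp add: zero_l2_cube_def indicator_def[abs_def])
    then show ?thesis using subspace_0[OF subV] by metis
  qed
  have ind: "abs_l2_cube (indicator A :: real ^ 'd \<Rightarrow> real) \<in> ?V" if "A \<in> sets borel" for A
  proof -
    have "A \<in> sigma_sets UNIV G" using that by (simp add: sb)
    from G(1) GU this show ?thesis
    proof (induction A rule: sigma_sets_induct_disjoint)
      case (basic A)
      then show ?case by (intro subsetD[OF closure_subset] span_base) auto
    next
      case empty
      show ?case by (rule ind0)
    next
      case (compl A)
      then have A: "A \<in> sets borel" by (simp add: sb)
      have "abs_l2_cube (indicator UNIV :: real ^ 'd \<Rightarrow> real) \<in> ?V"
        using G(2) by (intro subsetD[OF closure_subset] span_base imageI)
      with compl have "abs_l2_cube (indicator UNIV) - abs_l2_cube (indicator A) \<in> ?V"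
        by (intro subspace_diff[OF subV])
      also have "abs_l2_cube (indicator UNIV) - abs_l2_cube (indicator A)
          = abs_l2_cube (indicator (UNIV - A) :: real ^ 'd \<Rightarrow> real)"
        by (subst abs_l2_cube_diff[OF sq sq[OF A]])
           (auto intro!: arg_cong[of _ _ abs_l2_cube] simp: indicator_def fun_eq_iff)
      finally show ?case .
    next
      case (union A)
      then have A: "A i \<in> sets borel" for i by (auto simp: sb)
      have "abs_l2_cube (indicator (\<Union>i<n. A i) :: real ^ 'd \<Rightarrow> real) \<in> ?V" for n
      proof (induction n)
        case 0
        have "(\<Union>i<0::nat. A i) = {}" by simp
        then show ?case using ind0 by metis
      next
        case (Suc n)
        have "A i \<inter> A n = {}" if "i < n" for i
          using union(1) that by (auto simp: disjoint_family_on_def)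
        then have disj: "(\<Union>i<n. A i) \<inter> A n = {}" by blast
        have "abs_l2_cube (indicator (\<Union>i<n. A i)) + abs_l2_cube (indicator (A n)) \<in> ?V"
          using Suc union by (intro subspace_add[OF subV]) auto
        also have "abs_l2_cube (indicator (\<Union>i<n. A i)) + abs_l2_cube (indicator (A n))
            = abs_l2_cube (indicator (\<Union>i<Suc n. A i) :: real ^ 'd \<Rightarrow> real)"
        proof (subst abs_l2_cube_add)
          show "abs_l2_cube (\<lambda>t. indicat_real (\<Union>i<n. A i) t + indicat_real (A n) t)
              = abs_l2_cube (indicat_real (\<Union>i<Suc n. A i))"
            using disj
            by (intro arg_cong[of _ _ abs_l2_cube])
               (auto simp: indicator_def fun_eq_iff lessThan_Suc)
        qed (use A in \<open>auto intro!: sq sets.finite_UN\<close>)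
        finally show ?case .
      qed
      moreover have "(\<lambda>n. abs_l2_cube (indicator (\<Union>i<n. A i) :: real ^ 'd \<Rightarrow> real))
          \<longlonglongrightarrow> abs_l2_cube (indicator (\<Union>i. A i))"
      proof (rule abs_l2_cube_tendsto)
        show "square_integrable (indicat_real (\<Union>i<n. A i))" for n
          using A by (intro sq sets.finite_UN) auto
        show "square_integrable (indicat_real (\<Union>i. A i))"
          using A by (intro sq sets.countable_UN) auto
        show "(\<lambda>n. indicat_real (\<Union>i<n. A i) t) \<longlonglongrightarrow> indicator (\<Union>i. A i) t" for t
          by (rule LIMSEQ_indicator_UN)
      qed (auto simp: indicator_def)
      ultimately show ?case
        by (meson closed_closure closed_sequentially)
    qed
  qed
  have nonneg: "square_integrable u \<longrightarrow> abs_l2_cube u \<in> ?V"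
    if "u \<in> borel_measurable borel" "\<And>x. 0 \<le> u x" for u :: "real ^ 'd \<Rightarrow> real"
    using that
  proof (induction rule: borel_measurable_induct_real)
    case (set A)
    then show ?case using ind by simp
  next
    case (mult u c)
    show ?case
    proof (cases "c = 0")
      case True
      then show ?thesis using subspace_0[OF subV] by (simp add: zero_l2_cube_def)
    next
      case False
      show ?thesis
      proof
        assume "square_integrable (\<lambda>x. c * u x)"
        from square_integrable_scale[OF this, of "1 / c"] False
        have "square_integrable u" by simp
        with mult subspace_scale[OF subV, of _ c]
        show "abs_l2_cube (\<lambda>x. c * u x) \<in> ?V" by (simp add: abs_l2_cube_scaleR[symmetric])
      qed
    qed
  next
    case (add u v)
    show ?case
    proof
      assume uv: "square_integrable (\<lambda>x. v x + u x)"
      have le: "square_integrable w"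
        if "w \<in> borel_measurable borel" "\<And>x. 0 \<le> w x" "\<And>x. w x \<le> v x + u x"
        for w :: "real ^ 'd \<Rightarrow> real"
        by (rule square_integrableI[OF borel_N[OF that(1)], of "\<lambda>x. (v x + u x)\<^sup>2"])
           (use uv that in \<open>auto simp: square_integrable_def intro!: power_mono\<close>)
      have "square_integrable u" "square_integrable v"
        using add by (auto intro!: le)
      with add subspace_add[OF subV]
      show "abs_l2_cube (\<lambda>x. v x + u x) \<in> ?V" by (simp add: abs_l2_cube_add[symmetric])
    qed
  next
    case (seq U)
    show ?case
    proof
      assume u: "square_integrable u"
      have Ule: "U i x \<le> u x" for i x
        using seq by (intro incseq_le) (auto simp: incseq_def le_fun_def)
      have U: "square_integrable (U i)" for i
        by (rule square_integrableI[OF borel_N[OF seq(1)], of "\<lambda>x. (u x)\<^sup>2"])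
           (use u seq Ule in \<open>auto simp: square_integrable_def intro!: power_mono\<close>)
      have "(\<lambda>n. abs_l2_cube (U n)) \<longlonglongrightarrow> abs_l2_cube u"
      proof (rule abs_l2_cube_tendsto[OF U u])
        show "\<bar>U n t\<bar> \<le> \<bar>u t\<bar>" for n t
          using seq(2)[of n t] Ule[of n t] by simp
        show "(\<lambda>n. U n t) \<longlonglongrightarrow> u t" for t using seq by simp
      qed
      moreover have "abs_l2_cube (U n) \<in> ?V" for n using seq U by simp
      ultimately show "abs_l2_cube u \<in> ?V"
        by (meson closed_closure closed_sequentially)
    qed
  qed
  have "x \<in> ?V" for x
  proof -
    obtain f where f: "square_integrable f" and x: "x = abs_l2_cube f" by (rule l2_cube_cases)
    have "(\<lambda>t. if t \<in> cbox 0 1 then f t else 0) \<in> borel_measurable lebesgue"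
      using f by (subst borel_measurable_if) (auto simp: square_integrable_def)
    then obtain g where g[measurable]: "g \<in> borel_measurable borel"
      and fg: "AE t in lborel. (if t \<in> cbox 0 1 then f t else 0) = g t"
      using completion_ex_borel_measurable_real[of _ lborel] by auto
    have AE: "AE t in ?N. f t = g t"
      using AE_completion[OF fg] by (subst AE_restrict_space_iff) auto
    have gsq: "square_integrable g"
      unfolding square_integrable_def
    proof
      show "integrable ?N (\<lambda>t. (g t)\<^sup>2)"
        by (rule integrable_cong_AE_imp[of _ "\<lambda>t. (f t)\<^sup>2"])
           (use f AE in \<open>auto simp: square_integrable_def intro!: borel_N\<close>)
    qed (rule borel_N[OF g])
    have parts: "square_integrable (\<lambda>t. max 0 (c * g t))" if "\<bar>c\<bar> = 1" for c :: real
    proof (rule square_integrableI[of _ "\<lambda>t. (g t)\<^sup>2"])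
      show "(max 0 (c * g t))\<^sup>2 \<le> (g t)\<^sup>2" for t
        using that by (auto simp: max_def power_mult_distrib power2_eq_1_iff abs_if split: if_splits)
    qed (use gsq in \<open>auto simp: square_integrable_def intro!: borel_N\<close>)
    have "abs_l2_cube (\<lambda>t. max 0 (1 * g t)) - abs_l2_cube (\<lambda>t. max 0 ((-1) * g t)) \<in> ?V"
      using nonneg[of "\<lambda>t. max 0 (1 * g t)"] nonneg[of "\<lambda>t. max 0 ((-1) * g t)"]
        parts[of 1] parts[of "-1"]
      by (intro subspace_diff[OF subV]) auto
    also have "abs_l2_cube (\<lambda>t. max 0 (1 * g t)) - abs_l2_cube (\<lambda>t. max 0 ((-1) * g t))
        = abs_l2_cube g"
      using parts[of 1] parts[of "-1"]
      by (subst abs_l2_cube_diff) (auto intro!: arg_cong[of _ _ abs_l2_cube] simp: fun_eq_iff)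
    also have "\<dots> = x"
      unfolding x using AE by (intro abs_l2_cube_eqI gsq f) auto
    finally show ?thesis .
  qed
  then show ?thesis by blast
qed

lemma ex_countable_Int_stable_generator:
  "\<exists>G :: 'a::second_countable_topology set set.
    countable G \<and> Int_stable G \<and> UNIV \<in> G \<and> borel = sigma UNIV G"
proof -
  obtain B :: "'a set set" where B: "countable B" "topological_basis B"
    using ex_countable_basis by blast
  define G where "G = (\<lambda>F. \<Inter>F) ` {F. finite F \<and> F \<subseteq> B}"
  have "countable G"
    unfolding G_def using B by (intro countable_image countable_Collect_finite_subset)
  moreover have "Int_stable G"
  proof (rule Int_stableI)
    fix a b assume "a \<in> G" "b \<in> G"
    then obtain F F' where "a = \<Inter>F" "b = \<Inter>F'" "finite F" "F \<subseteq> B" "finite F'" "F' \<subseteq> B"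
      by (auto simp: G_def)
    then have "a \<inter> b = \<Inter>(F \<union> F')" "finite (F \<union> F')" "F \<union> F' \<subseteq> B" by auto
    then show "a \<inter> b \<in> G" by (auto simp: G_def)
  qed
  moreover have "UNIV \<in> G"
    unfolding G_def by (intro image_eqI[of _ _ "{}"]) auto
  moreover have "borel = sigma UNIV G"
  proof -
    have "sigma_sets UNIV G = sigma_sets UNIV B"
    proof (rule sigma_sets_eqI)
      fix x assume "x \<in> G"
      then have "open x"
        using topological_basis_open[OF B(2)] by (auto simp: G_def intro!: open_Inter)
      then have "x \<in> sets (borel :: 'a measure)" by simp
      then show "x \<in> sigma_sets UNIV B"
        unfolding borel_eq_countable_basis[OF B] by simp
    next
      fix b assume "b \<in> B"
      then show "b \<in> sigma_sets UNIV G"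
        unfolding G_def by (intro sigma_sets.Basic image_eqI[of _ _ "{b}"]) auto
    qed
    then show ?thesis
      unfolding borel_eq_countable_basis[OF B] by (intro sigma_eqI) auto
  qed
  ultimately show ?thesis by blast
qed

lemma second_countable_of_countable_span:
  fixes D :: "'a::real_normed_vector set"
  assumes D: "countable D" and dense: "closure (span D) = UNIV"
  shows "\<exists>B::'a set set. countable B \<and> open = generate_topology B"
proof -
  define Q where "Q = (\<lambda>xs. \<Sum>(q, d)\<leftarrow>xs. of_rat q *\<^sub>R d) ` lists ((UNIV :: rat set) \<times> D)"
  have "countable Q" unfolding Q_def using D by (intro countable_image countable_lists) auto
  have spanQ: "x \<in> closure Q" if "x \<in> span D" for x
    using that
  proof (induction rule: span_induct_alt)
    case base
    have "0 \<in> Q" unfolding Q_def by (intro image_eqI[of _ _ "[]"]) auto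
    then show ?case using closure_subset by blast
  next
    case (step c d y)
    obtain Y where Y: "\<And>n::nat. Y n \<in> Q" "Y \<longlonglongrightarrow> y"
      using step(2) by (auto simp: closure_sequential)
    have "c \<in> closure \<rat>"
      unfolding closure_approachable
    proof (intro allI impI)
      fix e :: real assume "e > 0"
      then show "\<exists>q\<in>\<rat>. dist q c < e"
        using Rats_dense_in_real[of c "c + e"] by (force simp: dist_real_def)
    qed
    then obtain R where R: "\<And>n::nat. R n \<in> \<rat>" "R \<longlonglongrightarrow> c"
      unfolding closure_sequential by blast
    have "R n *\<^sub>R d + Y n \<in> Q" for n
    proof -
      obtain q where q: "R n = of_rat q" using R(1)[of n] by (auto elim: Rats_cases)
      obtain xs where xs: "xs \<in> lists (UNIV \<times> D)" "Y n = (\<Sum>(q, d)\<leftarrow>xs. of_rat q *\<^sub>R d)"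
        using Y(1)[of n] by (auto simp: Q_def)
      show ?thesis
        unfolding Q_def using xs q step(1) by (intro image_eqI[of _ _ "(q, d) # xs"]) auto
    qed
    moreover have "(\<lambda>n. R n *\<^sub>R d + Y n) \<longlonglongrightarrow> c *\<^sub>R d + y"
      by (intro tendsto_intros R Y)
    ultimately show ?case
      unfolding closure_sequential by (intro exI[of _ "\<lambda>n. R n *\<^sub>R d + Y n"]) auto
  qed
  then have "closure (span D) \<subseteq> closure Q" by (intro closure_minimal) auto
  then have Q: "closure Q = UNIV" using dense by auto
  define B where "B = (\<lambda>(q, n). ball q (inverse (Suc n))) ` (Q \<times> (UNIV :: nat set))"
  have "countable B" unfolding B_def using \<open>countable Q\<close> by (intro countable_image) auto
  moreover have "topological_basis B"
  proof (rule topological_basisI)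
    fix O' and x :: 'a assume "open O'" "x \<in> O'"
    then obtain e where e: "e > 0" "ball x e \<subseteq> O'" by (auto simp: open_contains_ball)
    obtain n where n: "inverse (real (Suc n)) < e / 2"
      using reals_Archimedean[of "e/2"] e by auto
    have "x \<in> closure Q" by (simp add: Q)
    then obtain q where q: "q \<in> Q" "dist q x < inverse (real (Suc n))"
      unfolding closure_approachable by (meson inverse_positive_iff_positive of_nat_0_less_iff zero_less_Suc)
    have "ball q (inverse (real (Suc n))) \<subseteq> ball x e"
    proof
      fix y assume "y \<in> ball q (inverse (real (Suc n)))"
      then show "y \<in> ball x e"
        using dist_triangle[of x y q] q n by (auto simp: dist_commute)
    qed
    then show "\<exists>B'\<in>B. x \<in> B' \<and> B' \<subseteq> O'"
      using q e by (intro bexI[of _ "ball q (inverse (real (Suc n)))"]) (auto simp: B_def)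
  qed (auto simp: B_def)
  ultimately show ?thesis using topological_basis_imp_subbasis by blast
qed

instance l2_cube :: (finite) banach
  by standard (rule l2_cube_complete)

instance l2_cube :: (finite) second_countable_topology
proof
  obtain G :: "(real ^ 'a) set set" where "countable G" "Int_stable G" "UNIV \<in> G" "borel = sigma UNIV G"
    using ex_countable_Int_stable_generator by blast
  then show "\<exists>B::'a l2_cube set set. countable B \<and> open = generate_topology B"
    by (intro second_countable_of_countable_span[OF _ closure_span_indicators]) auto
qed

lift_definition tensor :: "'h::real_inner \<Rightarrow> 'h \<Rightarrow> 'h \<Rightarrow>\<^sub>L 'h"
  is "\<lambda>f g x. inner g x *\<^sub>R f"
  by (intro bounded_linear_scaleR_const bounded_linear_inner_right)

definition in_Lp :: "'w measure \<Rightarrow> real \<Rightarrow> ('w \<Rightarrow> 'h::real_normed_vector) \<Rightarrow> bool"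
  where "in_Lp M p X \<longleftrightarrow>
    X \<in> borel_measurable M \<and> integrable M (\<lambda>\<omega>. norm (X \<omega>) powr p)"

definition v_norm :: "'w measure \<Rightarrow> real \<Rightarrow> ('w \<Rightarrow> 'h::real_normed_vector) \<Rightarrow> real"
  where "v_norm M p X = (\<integral>\<omega>. norm (X \<omega>) powr p \<partial>M) powr (1 / p)"

text \<open>The operator space \<open>'h \<Rightarrow>\<^sub>L 'h\<close> is not separable in the norm topology, so the
  Bochner integral is not available there; the expectation of a random operator is taken in the
  strong sense, \<open>(E A) x = E (A x)\<close>. The value is only meaningful if the right-hand side is bounded
  linear in \<open>x\<close>; see \<open>cov_op_apply\<close> for the case used here.\<close>

definition op_expectation ::
  "'w measure \<Rightarrow> ('w \<Rightarrow> 'h::{banach, second_countable_topology} \<Rightarrow>\<^sub>L 'h) \<Rightarrow> 'h \<Rightarrow>\<^sub>L 'h"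
  where "op_expectation M A = Blinfun (\<lambda>x. \<integral>\<omega>. blinfun_apply (A \<omega>) x \<partial>M)"

definition cov_op ::
  "'w measure \<Rightarrow> ('w \<Rightarrow> 'h::{real_inner, banach, second_countable_topology}) \<Rightarrow> 'h \<Rightarrow>\<^sub>L 'h"
  where "cov_op M X = op_expectation M (\<lambda>\<omega>. tensor (X \<omega>) (X \<omega>))"

lemma cov_op_apply:
  fixes X :: "'w \<Rightarrow> 'h::{real_inner, banach, second_countable_topology}"
  assumes X: "in_Lp M 2 X"
  shows "blinfun_apply (cov_op M X) x = (\<integral>\<omega>. inner (X \<omega>) x *\<^sub>R X \<omega> \<partial>M)"
proof -
  have [measurable]: "X \<in> borel_measurable M" and sq: "integrable M (\<lambda>\<omega>. (norm (X \<omega>))\<^sup>2)"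
    using X by (auto simp: in_Lp_def)
  have int: "integrable M (\<lambda>\<omega>. inner (X \<omega>) x *\<^sub>R X \<omega>)"
    and le: "norm (inner (X \<omega>) x *\<^sub>R X \<omega>) \<le> (norm (X \<omega>))\<^sup>2 * norm x" for x \<omega>
  proof -
    show le: "norm (inner (X \<omega>) x *\<^sub>R X \<omega>) \<le> (norm (X \<omega>))\<^sup>2 * norm x" for \<omega>
      using mult_right_mono[OF Cauchy_Schwarz_ineq2[of "X \<omega>" x], of "norm (X \<omega>)"]
      by (simp add: power2_eq_square mult_ac)
    have "integrable M (\<lambda>\<omega>. (norm (X \<omega>))\<^sup>2 * norm x)" using sq by simp
    then show "integrable M (\<lambda>\<omega>. inner (X \<omega>) x *\<^sub>R X \<omega>)"
    proof (rule Bochner_Integration.integrable_bound)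
      show "AE \<omega> in M. norm (inner (X \<omega>) x *\<^sub>R X \<omega>) \<le> norm ((norm (X \<omega>))\<^sup>2 * norm x)"
        using le by (intro AE_I2) simp
    qed measurable
  qed
  have "bounded_linear (\<lambda>x. \<integral>\<omega>. inner (X \<omega>) x *\<^sub>R X \<omega> \<partial>M)"
  proof (rule bounded_linear_intro[where K = "\<integral>\<omega>. (norm (X \<omega>))\<^sup>2 \<partial>M"])
    fix x y :: 'h and r :: real
    show "(\<integral>\<omega>. inner (X \<omega>) (x + y) *\<^sub>R X \<omega> \<partial>M)
        = (\<integral>\<omega>. inner (X \<omega>) x *\<^sub>R X \<omega> \<partial>M) + (\<integral>\<omega>. inner (X \<omega>) y *\<^sub>R X \<omega> \<partial>M)"
      by (simp add: inner_add_right scaleR_add_left int)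
    show "(\<integral>\<omega>. inner (X \<omega>) (r *\<^sub>R x) *\<^sub>R X \<omega> \<partial>M) = r *\<^sub>R (\<integral>\<omega>. inner (X \<omega>) x *\<^sub>R X \<omega> \<partial>M)"
      by (simp flip: scaleR_scaleR)
    have "norm (\<integral>\<omega>. inner (X \<omega>) x *\<^sub>R X \<omega> \<partial>M) \<le> (\<integral>\<omega>. (norm (X \<omega>))\<^sup>2 * norm x \<partial>M)"
      using sq le by (intro order_trans[OF integral_norm_bound] integral_mono integrable_norm int) auto
    then show "norm (\<integral>\<omega>. inner (X \<omega>) x *\<^sub>R X \<omega> \<partial>M) \<le> norm x * (\<integral>\<omega>. (norm (X \<omega>))\<^sup>2 \<partial>M)"
      by (simp add: mult.commute)
  qed
  then show ?thesis
    by (simp add: cov_op_def op_expectation_def tensor.rep_eq bounded_linear_Blinfun_apply)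
qed

definition strictly_stationary ::
  "'w measure \<Rightarrow> (int \<Rightarrow> 'w \<Rightarrow> 'h::topological_space) \<Rightarrow> bool"
  where "strictly_stationary M Y \<longleftrightarrow>
    (\<forall>I s. finite I \<longrightarrow>
      distr M (PiM I (\<lambda>_. borel)) (\<lambda>\<omega>. \<lambda>i\<in>I. Y (i + s) \<omega>) =
      distr M (PiM I (\<lambda>_. borel)) (\<lambda>\<omega>. \<lambda>i\<in>I. Y i \<omega>))"

text \<open>The triangular array is \<open>X t T\<close>, and \<open>Xs u t\<close> is the process associated with the point \<open>u\<close>.
  The moment bound \<open>C\<close> is uniform in \<open>u\<close>, \<open>t\<close> and \<open>T\<close>.\<close>

definition locally_stationary ::
  "'w measure \<Rightarrow> real \<Rightarrow> real \<Rightarrow> (nat \<Rightarrow> nat \<Rightarrow> 'w \<Rightarrow> 'h::real_normed_vector) \<Rightarrow>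
    (real \<Rightarrow> int \<Rightarrow> 'w \<Rightarrow> 'h) \<Rightarrow> bool"
  where "locally_stationary M p \<rho> X Xs \<longleftrightarrow>
    (\<forall>T\<ge>1. \<forall>t\<in>{1..T}. in_Lp M p (X t T)) \<and>
    (\<exists>C. \<forall>u\<in>{0..1}.
      (\<forall>t. in_Lp M p (Xs u t)) \<and>
      strictly_stationary M (Xs u) \<and>
      (\<exists>U. \<forall>T\<ge>1. \<forall>t\<in>{1..T}.
        U t T \<in> borel_measurable M \<and>
        (AE \<omega> in M. 0 < U t T \<omega>) \<and>
        integrable M (\<lambda>\<omega>. U t T \<omega> powr \<rho>) \<and>
        (\<integral>\<omega>. U t T \<omega> powr \<rho> \<partial>M) < C \<and>
        (AE \<omega> in M. norm (X t T \<omega> - Xs u (int t) \<omega>) \<le>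
          (\<bar>real t / real T - u\<bar> + 1 / real T) * U t T \<omega>)))"

definition iid_sequence :: "'w measure \<Rightarrow> 's measure \<Rightarrow> (int \<Rightarrow> 'w \<Rightarrow> 's) \<Rightarrow> bool"
  where "iid_sequence M S \<epsilon> \<longleftrightarrow>
    prob_space.indep_vars M (\<lambda>_. S) \<epsilon> UNIV \<and>
    (\<forall>j. distr M S (\<epsilon> j) = distr M S (\<epsilon> 0))"

text \<open>The sequences \<open>\<epsilon>' t m\<close> with \<open>m \<ge> 1\<close> are distributed as \<open>\<epsilon>\<close>, and they and \<open>\<epsilon>\<close> (index
  \<open>None\<close>) are mutually independent.\<close>

definition independent_copies ::
  "'w measure \<Rightarrow> 's measure \<Rightarrow> (int \<Rightarrow> 'w \<Rightarrow> 's) \<Rightarrow> (int \<Rightarrow> nat \<Rightarrow> int \<Rightarrow> 'w \<Rightarrow> 's) \<Rightarrow> bool"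
  where "independent_copies M S \<epsilon> \<epsilon>' \<longleftrightarrow>
    prob_space.indep_vars M (\<lambda>_. PiM UNIV (\<lambda>_. S))
      (\<lambda>i \<omega> k. case i of None \<Rightarrow> \<epsilon> k \<omega> | Some (t, m) \<Rightarrow> \<epsilon>' t m k \<omega>)
      (insert None (Some ` (UNIV \<times> {1..}))) \<and>
    (\<forall>t. \<forall>m\<ge>1.
      distr M (PiM UNIV (\<lambda>_. S)) (\<lambda>\<omega> k. \<epsilon>' t m k \<omega>) =
      distr M (PiM UNIV (\<lambda>_. S)) (\<lambda>\<omega> k. \<epsilon> k \<omega>))"

definition m_coupling ::
  "((nat \<Rightarrow> 's) \<Rightarrow> 'h) \<Rightarrow> (int \<Rightarrow> 'w \<Rightarrow> 's) \<Rightarrow> (int \<Rightarrow> nat \<Rightarrow> int \<Rightarrow> 'w \<Rightarrow> 's) \<Rightarrow>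
    nat \<Rightarrow> int \<Rightarrow> 'w \<Rightarrow> 'h"
  where "m_coupling f \<epsilon> \<epsilon>' m t \<omega> =
    f (\<lambda>j. if j < m then \<epsilon> (t - int j) \<omega> else \<epsilon>' t m (t - int j) \<omega>)"

text \<open>The argument of \<open>f\<close> in \<open>m_coupling\<close> has the same law as \<open>\<epsilon>\<^sub>t, \<epsilon>\<^sub>t\<^sub>-\<^sub>1, \<dots>\<close>, so the
  coupling is again in \<open>L\<^sup>p\<close> and the integrals in \<open>v_norm\<close> below are genuine, not default values.
  The sum runs over \<open>m \<ge> 1\<close>, hence \<open>Suc m\<close>.\<close>

definition Lp_m_approximable ::
  "'w measure \<Rightarrow> 's measure \<Rightarrow> real \<Rightarrow> (int \<Rightarrow> 'w \<Rightarrow> 'h::real_normed_vector) \<Rightarrow> bool"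
  where "Lp_m_approximable M S p Y \<longleftrightarrow>
    (\<forall>t. in_Lp M p (Y t)) \<and>
    (\<exists>f \<epsilon> \<epsilon>'.
      f \<in> borel_measurable (PiM UNIV (\<lambda>_. S)) \<and>
      iid_sequence M S \<epsilon> \<and>
      independent_copies M S \<epsilon> \<epsilon>' \<and>
      (\<forall>t. AE \<omega> in M. Y t \<omega> = f (\<lambda>j. \<epsilon> (t - int j) \<omega>)) \<and>
      (\<forall>t. summable (\<lambda>m. v_norm M p (\<lambda>\<omega>. Y t \<omega> - m_coupling f \<epsilon> \<epsilon>' (Suc m) t \<omega>))))"

definition cov_estimator ::
  "(real \<Rightarrow> real) \<Rightarrow> real \<Rightarrow> (nat \<Rightarrow> nat \<Rightarrow> 'w \<Rightarrow> 'h::real_inner) \<Rightarrow> nat \<Rightarrow> real \<Rightarrow> 'w \<Rightarrow>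
    'h \<Rightarrow>\<^sub>L 'h"
  where "cov_estimator K h X T u \<omega> =
    (1 / (real T * h)) *\<^sub>R
      (\<Sum>t = 1..T. K ((u - real t / real T) / h) *\<^sub>R tensor (X t T \<omega>) (X t T \<omega>))"

text \<open>\<open>Y\<^sub>T = O\<^sub>P(a\<^sub>T)\<close> as \<open>T \<rightarrow> \<infinity>\<close>. Measurability is part of the notion, since the
  measure of a non-measurable set is \<open>0\<close> by convention.\<close>

definition big_OP :: "'w measure \<Rightarrow> (nat \<Rightarrow> 'w \<Rightarrow> real) \<Rightarrow> (nat \<Rightarrow> real) \<Rightarrow> bool"
  where "big_OP M Y a \<longleftrightarrow>
    (\<forall>T. Y T \<in> borel_measurable M) \<and>
    (\<forall>e>0. \<exists>B>0. \<forall>\<^sub>F T in sequentially.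
      measure M {\<omega> \<in> space M. B * a T < \<bar>Y T \<omega>\<bar>} \<le> e)"

end

theory Submission
  imports Defs
begin

text \<open>The error splits into three parts: replacing \<open>X t T\<close> by the stationary \<open>Xs u t\<close>, the fluctuation
  of the weighted sum of \<open>Y\<^sub>t \<otimes> Y\<^sub>t - C\<close> with \<open>Y\<^sub>t = Xs u t\<close>, and the deviation of the total kernel
  weight from \<open>1\<close>. Local stationarity bounds the first moment of the first part by a multiple of
  \<open>h + 1 / T\<close>, and the last part is a Riemann sum error of order \<open>1 / (T h\<^sup>2)\<close>. For the fluctuation
  the operator norm of a finite sum \<open>\<Sum> c\<^sub>i a\<^sub>i \<otimes> a\<^sub>i\<close> is bounded by its Hilbert-Schmidt norm, whose
  square is \<open>\<Sum> c\<^sub>i c\<^sub>j \<langle>a\<^sub>i, a\<^sub>j\<rangle>\<^sup>2\<close>; after symmetrization only the quantities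
  \<open>E \<langle>Y\<^sub>s, Y\<^sub>t\<rangle>\<^sup>2 - E E' \<langle>Y\<^sub>s, Y'\<^sub>t\<rangle>\<^sup>2\<close> remain, where \<open>Y'\<close> is an independent copy of \<open>Y\<close>. The
  \<open>m\<close>-coupling of \<open>Y\<^sub>t\<close> at lag \<open>m = t - s\<close> is independent of \<open>Y\<^sub>s\<close> and distributed as \<open>Y\<^sub>t\<close>, so these
  quantities are at most a constant times \<open>v\<^sub>4 (Y\<^sub>t - Y\<^sub>m\<^sub>,\<^sub>t)\<close>, which is summable in \<open>m\<close>. Hence the
  fluctuation has second moment of order \<open>1 / (T h)\<close>, and Markov's inequality concludes.\<close>

section \<open>Operator norms of sums of rank-one operators\<close>

text \<open>Induction on the number of non-zero \<open>a i\<close>: splitting off the direction of one of them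
  leaves a sum of the same form and a square.\<close>

lemma gram_hadamard_nonneg:
  fixes a :: "'i \<Rightarrow> 'a::real_inner" and b :: "'i \<Rightarrow> 'b::real_inner"
  assumes "finite I"
  shows "0 \<le> (\<Sum>i\<in>I. \<Sum>j\<in>I. c i * c j * inner (a i) (a j) * inner (b i) (b j))"
  using assms
proof (induction "card {i\<in>I. a i \<noteq> 0}" arbitrary: a rule: less_induct)
  case less
  show ?case
  proof (cases "\<exists>k\<in>I. a k \<noteq> 0")
    case False
    then show ?thesis by (simp add: sum_nonneg)
  next
    case True
    then obtain k where k: "k \<in> I" "a k \<noteq> 0" by blast
    define e where "e = sgn (a k)"
    have ee: "inner e e = 1"
      using k by (simp add: e_def dot_square_norm norm_sgn)
    define r where "r i = inner (a i) e" for i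
    define a' where "a' i = a i - r i *\<^sub>R e" for i
    have "a k = norm (a k) *\<^sub>R e" using k by (simp add: e_def sgn_div_norm)
    then have "a k = r k *\<^sub>R e" using ee unfolding r_def by (metis inner_scaleR_left mult.right_neutral)
    then have ak': "a' k = 0" by (simp add: a'_def)
    have split: "inner (a i) (a j) = r i * r j + inner (a' i) (a' j)" for i j
      by (simp add: a'_def inner_diff_left inner_diff_right ee r_def inner_commute algebra_simps)
    \<comment> \<open>The projection sends zero vectors to zero, so no new index becomes non-zero,
      and \<open>k\<close> drops out because \<open>a k\<close> is a multiple of
      \<open>e\<close>.\<close>
    have "{i\<in>I. a' i \<noteq> 0} \<subset> {i\<in>I. a i \<noteq> 0}"
      using k ak' by (auto simp: a'_def r_def)
    then have "card {i\<in>I. a' i \<noteq> 0} < card {i\<in>I. a i \<noteq> 0}"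
      using less.prems by (intro psubset_card_mono) auto
    then have IH: "0 \<le> (\<Sum>i\<in>I. \<Sum>j\<in>I. c i * c j * inner (a' i) (a' j) * inner (b i) (b j))"
      using less by blast
    have "inner (\<Sum>i\<in>I. (c i * r i) *\<^sub>R b i) (\<Sum>i\<in>I. (c i * r i) *\<^sub>R b i)
        = (\<Sum>i\<in>I. \<Sum>j\<in>I. c i * c j * (r i * r j) * inner (b i) (b j))"
      by (simp add: inner_sum_left inner_sum_right sum_distrib_left mult_ac inner_commute)
    then have "(\<Sum>i\<in>I. \<Sum>j\<in>I. c i * c j * inner (a i) (a j) * inner (b i) (b j))
        = inner (\<Sum>i\<in>I. (c i * r i) *\<^sub>R b i) (\<Sum>i\<in>I. (c i * r i) *\<^sub>R b i)
          + (\<Sum>i\<in>I. \<Sum>j\<in>I. c i * c j * inner (a' i) (a' j) * inner (b i) (b j))"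
      by (simp add: split algebra_simps sum.distrib)
    with IH show ?thesis by simp
  qed
qed

text \<open>The right-hand side is the squared Hilbert-Schmidt norm, written through the Gram matrix
  and hence without choosing an orthonormal basis. For a unit vector \<open>x\<close> the gap
  between it and the squared length of the image of \<open>x\<close> is a quadratic form to which
  \<open>gram_hadamard_nonneg\<close> applies.\<close>

lemma sum_tensor_norm_le:
  fixes a :: "'i \<Rightarrow> 'a::real_inner"
  assumes "finite I"
  shows "(norm (\<Sum>i\<in>I. c i *\<^sub>R tensor (a i) (a i)))\<^sup>2
      \<le> (\<Sum>i\<in>I. \<Sum>j\<in>I. c i * c j * (inner (a i) (a j))\<^sup>2)" (is "(norm ?B)\<^sup>2 \<le> ?Q")
proof -
  have unit: "(norm (blinfun_apply ?B x))\<^sup>2 \<le> ?Q" if x: "norm x = 1" for x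
  proof -
    \<comment> \<open>Removing the component along \<open>x\<close> lowers the Gram matrix of the
      \<open>a i\<close> by the rank-one matrix \<open>inner (a i) x * inner (a j) x\<close>, which
      is exactly what evaluation at \<open>x\<close> produces.\<close>
    define b where "b i = a i - inner (a i) x *\<^sub>R x" for i
    have xx: "inner x x = 1" using x by (simp add: dot_square_norm)
    have b: "inner (b i) (b j) = inner (a i) (a j) - inner (a i) x * inner (a j) x" for i j
      by (simp add: b_def inner_diff_left inner_diff_right xx inner_commute algebra_simps)
    have "(norm (blinfun_apply ?B x))\<^sup>2
        = (\<Sum>i\<in>I. \<Sum>j\<in>I. c i * c j * inner (a i) (a j) * (inner (a i) x * inner (a j) x))"
      unfolding power2_norm_eq_inner
      by (simp add: blinfun.sum_left blinfun.scaleR_left tensor.rep_eq inner_sum_left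
          inner_sum_right sum_distrib_left mult_ac inner_commute)
    also have "\<dots> = ?Q - (\<Sum>i\<in>I. \<Sum>j\<in>I. c i * c j * inner (a i) (a j) * inner (b i) (b j))"
      by (simp add: b algebra_simps power2_eq_square flip: sum_subtractf)
    also have "\<dots> \<le> ?Q"
      using gram_hadamard_nonneg[OF assms, of c a b] by simp
    finally show ?thesis .
  qed
  have Q0: "0 \<le> ?Q"
    using gram_hadamard_nonneg[OF assms, of c a a] by (simp add: power2_eq_square mult.assoc)
  have "norm ?B \<le> sqrt ?Q"
  proof (rule norm_blinfun_bound)
    fix x
    show "norm (blinfun_apply ?B x) \<le> sqrt ?Q * norm x"
    proof (cases "x = 0")
      case False
      then have "blinfun_apply ?B x = norm x *\<^sub>R blinfun_apply ?B (sgn x)"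
        by (simp add: sgn_div_norm blinfun.scaleR_right)
      moreover have "norm (blinfun_apply ?B (sgn x)) \<le> sqrt ?Q"
        using unit[of "sgn x"] False by (intro real_le_rsqrt) (simp add: norm_sgn)
      ultimately show ?thesis
        by (simp add: mult.commute mult_left_mono)
    qed simp
  qed (use Q0 in simp)
  then have "(norm ?B)\<^sup>2 \<le> (sqrt ?Q)\<^sup>2" by (intro power_mono) auto
  then show ?thesis using Q0 by simp
qed

text \<open>The operator space need not be separable, so measurability is reduced to single vectors:
  a sublevel set of the operator norm is a countable intersection of conditions at the points of a
  dense set.\<close>

lemma borel_measurable_norm_blinfun:
  fixes A :: "'w \<Rightarrow> 'a::{real_normed_vector, second_countable_topology} \<Rightarrow>\<^sub>L 'b::real_normed_vector"
  assumes A: "\<And>x. (\<lambda>\<omega>. norm (blinfun_apply (A \<omega>) x)) \<in> borel_measurable M"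
  shows "(\<lambda>\<omega>. norm (A \<omega>)) \<in> borel_measurable M"
proof -
  obtain D :: "'a set" where D: "countable D"
    and dense: "\<And>X. open X \<Longrightarrow> X \<noteq> {} \<Longrightarrow> \<exists>d\<in>D. d \<in> X"
    using countable_dense_setE by blast
  have iff: "norm B \<le> c \<longleftrightarrow> 0 \<le> c \<and> (\<forall>x\<in>D. norm (blinfun_apply B x) \<le> c * norm x)"
    for B :: "'a \<Rightarrow>\<^sub>L 'b" and c
  proof safe
    assume "norm B \<le> c"
    then show "0 \<le> c" using norm_ge_zero order_trans by blast
    fix x show "norm (blinfun_apply B x) \<le> c * norm x"
      using \<open>norm B \<le> c\<close> norm_blinfun[of B x] mult_right_mono[of "norm B" c "norm x"] by simp
  next
    assume c: "0 \<le> c" and le: "\<forall>x\<in>D. norm (blinfun_apply B x) \<le> c * norm x"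
    show "norm B \<le> c"
    proof (rule norm_blinfun_bound[OF c], rule ccontr)
      \<comment> \<open>A strict violation is an open condition, so it would also occur at some
        point of \<open>D\<close>.\<close>
      fix x assume "\<not> norm (blinfun_apply B x) \<le> c * norm x"
      then have "{x. c * norm x < norm (blinfun_apply B x)} \<noteq> {}"
        unfolding not_le by blast
      moreover have "open {x. c * norm x < norm (blinfun_apply B x)}"
        by (intro open_Collect_less continuous_intros)
      ultimately show False using dense[of "{x. c * norm x < norm (blinfun_apply B x)}"] le by force
    qed
  qed
  show ?thesis
  proof (subst borel_measurable_iff_le, intro allI)
    fix c
    have "{\<omega> \<in> space M. norm (A \<omega>) \<le> c}
        = {\<omega> \<in> space M. 0 \<le> c \<and> (\<forall>x\<in>D. norm (blinfun_apply (A \<omega>) x) \<le> c * norm x)}"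
      by (simp add: iff)
    also have "\<dots> \<in> sets M"
    proof (cases "0 \<le> c")
      case True
      then show ?thesis
        using D A by (auto intro!: sets.sets_Collect_countable_All' borel_measurable_le)
    qed simp
    finally show "{\<omega> \<in> space M. norm (A \<omega>) \<le> c} \<in> sets M" .
  qed
qed

section \<open>Kernel weights\<close>

text \<open>All counted indices lie between the smallest and the largest one, which differ by at
  most \<open>2 * r * s\<close>. This bounds the number of observations inside the kernel
  window.\<close>

lemma card_lattice_interval_le:
  fixes x r s :: real
  assumes "0 \<le> r" "0 < s"
  shows "real (card {t\<in>{1..n::nat}. \<bar>x - real t / s\<bar> \<le> r}) \<le> 2 * r * s + 1"
proof (cases "{t\<in>{1..n}. \<bar>x - real t / s\<bar> \<le> r} = {}")
  case False
  let ?A = "{t\<in>{1..n}. \<bar>x - real t / s\<bar> \<le> r}"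
  have "?A \<subseteq> {Min ?A..Max ?A}" by auto
  then have "card ?A \<le> card {Min ?A..Max ?A}" by (intro card_mono) auto
  also have "\<dots> = Suc (Max ?A) - Min ?A" by simp
  also have "real \<dots> = real (Max ?A) - real (Min ?A) + 1"
    proof -
    have "Min ?A \<le> Max ?A" using False by (intro Min_le Max_in) auto
    then have "Min ?A \<le> Suc (Max ?A)" by (rule le_SucI)
    then show ?thesis by (subst of_nat_diff) simp_all
  qed
  also have "\<dots> \<le> 2 * r * s + 1"
  proof -
    have "\<bar>x - real (Max ?A) / s\<bar> \<le> r" "\<bar>x - real (Min ?A) / s\<bar> \<le> r"
      using False Max_in[of ?A] Min_in[of ?A] by auto
    then have "real (Max ?A) / s - real (Min ?A) / s \<le> 2 * r" by linarith
    then have "(real (Max ?A) - real (Min ?A)) / s \<le> 2 * r" by (simp add: diff_divide_distrib)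
    then show ?thesis using assms by (simp add: divide_le_eq)
  qed
  finally show ?thesis by simp
next
  case True
  show ?thesis unfolding True using assms by simp
qed

text \<open>On each cell \<open>g\<close> deviates from its value at the right endpoint by at most
  \<open>L * d\<close>, which costs \<open>L * d\<^sup>2\<close> per cell.\<close>

lemma riemann_sum_error:
  fixes g :: "real \<Rightarrow> real"
  assumes g: "L-lipschitz_on UNIV g" and d: "0 \<le> d"
  shows "\<bar>(\<Sum>t = 1..n. g (real t * d) * d) - integral {0..real n * d} g\<bar> \<le> real n * (L * d\<^sup>2)"
proof (induction n)
  case (Suc n)
  have cont: "continuous_on S g" for S
    using lipschitz_on_continuous_on[OF g] continuous_on_subset by blast
  let ?a = "real n * d" and ?b = "real (Suc n) * d"
  have ab: "0 \<le> ?a" "?a \<le> ?b" "?b - ?a = d"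
    using d by (auto simp: algebra_simps)
  have int: "g integrable_on {p..q}" for p q
    by (rule integrable_continuous_interval[OF cont])
  have "integral {0..?b} g = integral {0..?a} g + integral {?a..?b} g"
    using ab by (intro Henstock_Kurzweil_Integration.integral_combine[symmetric] int) auto
  moreover have "g ?b * d - integral {?a..?b} g = integral {?a..?b} (\<lambda>x. g ?b - g x)"
    using ab by (subst Henstock_Kurzweil_Integration.integral_diff)
      (auto intro!: int simp: mult.commute)
  moreover have "norm (integral {?a..?b} (\<lambda>x. g ?b - g x)) \<le> (L * d) * (?b - ?a)"
  proof (rule integral_bound[OF ab(2)])
    show "continuous_on {?a..?b} (\<lambda>x. g ?b - g x)" by (intro continuous_intros cont)
    fix x assume x: "x \<in> {?a..?b}"
    have "norm (g ?b - g x) \<le> L * norm (?b - x)"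
      using lipschitz_onD[OF g, of ?b x] by (simp add: dist_norm)
    also have "\<dots> \<le> L * d"
    proof (rule mult_left_mono)
      show "norm (?b - x) \<le> d" using x ab unfolding real_norm_def atLeastAtMost_iff by linarith
      show "0 \<le> L" using lipschitz_on_nonneg[OF g] .
    qed
    finally show "norm (g ?b - g x) \<le> L * d" .
  qed
  ultimately show ?case using Suc ab
    by (simp add: algebra_simps power2_eq_square)
qed simp

text \<open>Source of the term \<open>1 / (real T * h\<^sup>2)\<close> of the rate. The rescaled
  kernel \<open>g\<close> has Lipschitz constant \<open>L / h\<close> and integral \<open>h\<close>
  over the unit interval; its Riemann error \<open>L / (real T * h)\<close> is then divided by
  \<open>h\<close>.\<close>

lemma kernel_weights_sum:
  fixes K :: "real \<Rightarrow> real"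
  assumes K: "L-lipschitz_on UNIV K" and supp: "\<And>x. \<bar>x\<bar> > c \<Longrightarrow> K x = 0"
    and int1: "(\<integral>z. K z \<partial>lborel) = 1"
    and h: "0 < h" "c * h \<le> u" "c * h \<le> 1 - u" and T: "1 \<le> (T::nat)"
  shows "\<bar>(\<Sum>t = 1..T. K ((u - real t / real T) / h) / (real T * h)) - 1\<bar>
      \<le> L / (real T * h\<^sup>2)"
proof -
  define g where "g s = K ((u - s) / h)" for s
  have g: "(L / h)-lipschitz_on UNIV g"
  proof (rule lipschitz_onI)
    fix x y
    have "dist (g x) (g y) \<le> L * dist ((u - x) / h) ((u - y) / h)"
      unfolding g_def by (rule lipschitz_onD[OF K]) auto
    also have "dist ((u - x) / h) ((u - y) / h) = dist x y / h"
      using h by (simp add: dist_real_def abs_divide flip: diff_divide_distrib)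
    finally show "dist (g x) (g y) \<le> L / h * dist x y" by simp
  qed (use h lipschitz_on_nonneg[OF K] in simp)
  \<comment> \<open>Here the distance of at least \<open>c * h\<close> from \<open>u\<close> to both
    ends of the unit interval enters: no kernel mass is cut off.\<close>
  have gs: "g s = 0" if "s \<notin> {0..1}" for s
  proof -
    have "c * h < \<bar>u - s\<bar>" using that h unfolding atLeastAtMost_iff by linarith
    then have "c < \<bar>(u - s) / h\<bar>" using h by (simp add: less_divide_eq abs_divide)
    then show ?thesis unfolding g_def by (rule supp)
  qed
  have contg: "continuous_on {0..1} g"
    using lipschitz_on_continuous_on[OF g] continuous_on_subset by blast
  \<comment> \<open>Substitution \<open>z = (u - s) / h\<close> in the integral of
    \<open>K\<close>.\<close>
  have "1 = (1 / h) * (\<integral>s. K (u / h + (- 1 / h) * s) \<partial>lborel)"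
    using lborel_integral_real_affine[of "- 1 / h" K "u / h"] h int1 by simp
  also have "(\<lambda>s. K (u / h + (- 1 / h) * s)) = g"
    by (auto simp: g_def diff_divide_distrib)
  also have "(\<integral>s. g s \<partial>lborel) = (LBINT s:{0..1}. g s)"
    unfolding set_lebesgue_integral_def
    by (intro Bochner_Integration.integral_cong) (use gs in \<open>force simp: indicator_def\<close>)+
  also have "\<dots> = integral {0..1} g"
    by (intro set_borel_integral_eq_integral borel_integrable_atLeastAtMost'[OF contg])
  finally have I: "integral {0..1} g = h" using h by (simp add: field_simps)
  have "\<bar>(\<Sum>t = 1..T. g (real t * (1 / real T)) * (1 / real T))
      - integral {0..real T * (1 / real T)} g\<bar> \<le> real T * (L / h * (1 / real T)\<^sup>2)"
    by (rule riemann_sum_error[OF g]) simp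
  then have le: "\<bar>(\<Sum>t = 1..T. g (real t / real T) / real T) - h\<bar> \<le> L / (real T * h)"
    using T I by (simp add: power2_eq_square mult.commute)
  have "(\<Sum>t = 1..T. K ((u - real t / real T) / h) / (real T * h)) - 1
      = ((\<Sum>t = 1..T. g (real t / real T) / real T) - h) / h"
    using h by (simp add: g_def diff_divide_distrib sum_divide_distrib)
  then have "\<bar>(\<Sum>t = 1..T. K ((u - real t / real T) / h) / (real T * h)) - 1\<bar>
      = \<bar>(\<Sum>t = 1..T. g (real t / real T) / real T) - h\<bar> / h"
    using h by (simp add: abs_divide)
  also have "\<dots> \<le> L / (real T * h) / h" using le h by (intro divide_right_mono) auto
  finally show ?thesis by (simp add: power2_eq_square mult.assoc)
qed

section \<open>Couplings of causal functions of independent sequences\<close>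

text \<open>The argument of \<open>f\<close> in \<open>m_coupling\<close>. In contrast to
  \<open>comb_seq\<close>, the second sequence is not restarted at \<open>m\<close> but keeps its
  own indices.\<close>

definition splice_seq :: "nat \<Rightarrow> (nat \<Rightarrow> 's) \<Rightarrow> (nat \<Rightarrow> 's) \<Rightarrow> nat \<Rightarrow> 's"
  where "splice_seq m a b j = (if j < m then a j else b j)"

text \<open>Passes from the past of a time \<open>t\<close> to the past of
  \<open>t - m\<close>.\<close>

definition drop_seq :: "nat \<Rightarrow> (nat \<Rightarrow> 's) \<Rightarrow> nat \<Rightarrow> 's"
  where "drop_seq m a j = a (j + m)"

lemma splice_comb_seq: "splice_seq m a b = comb_seq m a (drop_seq m b)"
  by (auto simp: splice_seq_def comb_seq_def drop_seq_def)

lemma drop_comb_seq: "drop_seq m (comb_seq m a b) = b"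
  by (simp add: drop_seq_def comb_seq_add fun_eq_iff)

lemma splice_comb_seq_left: "splice_seq m (comb_seq m a a') b = comb_seq m a (drop_seq m b)"
  by (auto simp: splice_seq_def comb_seq_def drop_seq_def)

lemma measurable_drop_seq[measurable]: "drop_seq m \<in> PiM UNIV (\<lambda>_::nat. N) \<rightarrow>\<^sub>M PiM UNIV (\<lambda>_::nat. N)"
  unfolding drop_seq_def[abs_def]
  by (intro measurable_abs_UNIV measurable_component_singleton) simp

lemma measurable_splice[measurable (raw)]:
  assumes [measurable]: "g \<in> P \<rightarrow>\<^sub>M PiM UNIV (\<lambda>_::nat. N)" "g' \<in> P \<rightarrow>\<^sub>M PiM UNIV (\<lambda>_::nat. N)"
  shows "(\<lambda>x. splice_seq m (g x) (g' x)) \<in> P \<rightarrow>\<^sub>M PiM UNIV (\<lambda>_::nat. N)"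
  unfolding splice_comb_seq by measurable

context sequence_space
begin

lemma nn_integral_comb_seq:
  assumes [measurable]: "F \<in> borel_measurable S"
  shows "(\<integral>\<^sup>+a. \<integral>\<^sup>+b. F (comb_seq m a b) \<partial>S \<partial>S) = (\<integral>\<^sup>+a. F a \<partial>S)"
proof -
  have "(\<integral>\<^sup>+a. F a \<partial>S) = (\<integral>\<^sup>+a. F a \<partial>distr (S \<Otimes>\<^sub>M S) S (\<lambda>(a, b). comb_seq m a b))"
    by (simp only: PiM_comb_seq)
  also have "\<dots> = (\<integral>\<^sup>+x. F (case x of (a, b) \<Rightarrow> comb_seq m a b) \<partial>(S \<Otimes>\<^sub>M S))"
    by (rule nn_integral_distr[OF measurable_comb_seq]) (simp add: assms)
  also have "\<dots> = (\<integral>\<^sup>+a. \<integral>\<^sup>+b. F (case (a, b) of (a, b) \<Rightarrow> comb_seq m a b) \<partial>S \<partial>S)"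
    by (intro P.nn_integral_fst[symmetric] measurable_compose[OF measurable_comb_seq assms])
  finally show ?thesis by simp
qed

text \<open>Shift invariance of an i.i.d. law: the sequence is written as a concatenation whose tail
  is an independent sequence with the same law.\<close>

lemma nn_integral_drop_seq:
  assumes F: "F \<in> borel_measurable S"
  shows "(\<integral>\<^sup>+a. F (drop_seq m a) \<partial>S) = (\<integral>\<^sup>+a. F a \<partial>S)"
  using nn_integral_comb_seq[OF measurable_compose[OF measurable_drop_seq F], of m m, symmetric]
  by (simp add: drop_comb_seq P.emeasure_space_1)

lemma nn_integral_splice:
  assumes [measurable]: "F \<in> borel_measurable S"
  shows "(\<integral>\<^sup>+a. \<integral>\<^sup>+b. F (splice_seq m a b) \<partial>S \<partial>S) = (\<integral>\<^sup>+a. F a \<partial>S)"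
proof -
  have "(\<integral>\<^sup>+b. F (splice_seq m a b) \<partial>S) = (\<integral>\<^sup>+b. F (comb_seq m a b) \<partial>S)" if "a \<in> space S" for a
    unfolding splice_comb_seq using that
    by (intro nn_integral_drop_seq[of "\<lambda>b. F (comb_seq m a b)"]) measurable
  then have "(\<integral>\<^sup>+a. \<integral>\<^sup>+b. F (splice_seq m a b) \<partial>S \<partial>S) = (\<integral>\<^sup>+a. \<integral>\<^sup>+b. F (comb_seq m a b) \<partial>S \<partial>S)"
    by (rule nn_integral_cong)
  then show ?thesis
    by (simp only: nn_integral_comb_seq[OF assms])
qed

text \<open>\<open>drop_seq m a\<close> reads the entries of \<open>a\<close> from \<open>m\<close>
  on, while \<open>splice_seq m a b\<close> reads those before \<open>m\<close> and the tail of
  \<open>b\<close>. These blocks of coordinates are disjoint, so the pair is distributed like two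
  independent sequences.\<close>

lemma nn_integral_drop_splice:
  assumes G[measurable]: "case_prod G \<in> borel_measurable (S \<Otimes>\<^sub>M S)"
  shows "(\<integral>\<^sup>+a. \<integral>\<^sup>+b. G (drop_seq m a) (splice_seq m a b) \<partial>S \<partial>S) = (\<integral>\<^sup>+a. \<integral>\<^sup>+c. G a c \<partial>S \<partial>S)"
proof -
  define H where "H a = (\<integral>\<^sup>+b. G (drop_seq m a) (splice_seq m a b) \<partial>S)" for a
  have [measurable]: "H \<in> borel_measurable S"
    unfolding H_def by measurable
  have H: "H (comb_seq m a a') = (\<integral>\<^sup>+b. G a' (comb_seq m a b) \<partial>S)"
    if "a \<in> space S" "a' \<in> space S" for a a'
    using that unfolding H_def drop_comb_seq splice_comb_seq_left
    by (intro nn_integral_drop_seq[of "\<lambda>b. G a' (comb_seq m a b)"]) measurable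
  have "(\<integral>\<^sup>+a. \<integral>\<^sup>+b. G (drop_seq m a) (splice_seq m a b) \<partial>S \<partial>S) = (\<integral>\<^sup>+a. H a \<partial>S)"
    by (simp add: H_def)
  \<comment> \<open>The tail of \<open>a\<close> is resampled as \<open>a'\<close>, so that the two
    arguments of \<open>G\<close> depend on separate variables and the integrals can be
    swapped.\<close>
  also have "\<dots> = (\<integral>\<^sup>+a. \<integral>\<^sup>+a'. H (comb_seq m a a') \<partial>S \<partial>S)"
    by (rule nn_integral_comb_seq[symmetric]) fact
  also have "\<dots> = (\<integral>\<^sup>+a. \<integral>\<^sup>+a'. \<integral>\<^sup>+b. G a' (comb_seq m a b) \<partial>S \<partial>S \<partial>S)"
    by (intro nn_integral_cong H)
  also have "\<dots> = (\<integral>\<^sup>+a'. \<integral>\<^sup>+a. \<integral>\<^sup>+b. G a' (comb_seq m a b) \<partial>S \<partial>S \<partial>S)"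
  proof (rule pair_sigma_finite.Fubini')
    show "pair_sigma_finite S S" by unfold_locales
  qed measurable
  also have "\<dots> = (\<integral>\<^sup>+a'. \<integral>\<^sup>+c. G a' c \<partial>S \<partial>S)"
    by (intro nn_integral_cong nn_integral_comb_seq) measurable
  finally show ?thesis .
qed

end

text \<open>Reading backwards from \<open>t\<close> is an injective reindexing, and an i.i.d. family
  stays i.i.d. under injective reindexing.\<close>

lemma (in prob_space) iid_reindex_distr:
  assumes g: "g \<in> M \<rightarrow>\<^sub>M PiM UNIV (\<lambda>_::int. S)" and N: "prob_space N" "sets N = sets S"
    and law: "distr M (PiM UNIV (\<lambda>_. S)) g = PiM UNIV (\<lambda>_. N)"
  shows "distr M (PiM UNIV (\<lambda>_. S)) (\<lambda>\<omega> j. g \<omega> (t - int j)) = PiM UNIV (\<lambda>_. N)"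
proof -
  have sets: "sets (PiM UNIV (\<lambda>_::nat. S)) = sets (PiM UNIV (\<lambda>_. N))"
    using N by (intro sets_PiM_cong) auto
  have "distr M (PiM UNIV (\<lambda>_. S)) (\<lambda>\<omega> j. g \<omega> (t - int j))
      = distr (distr M (PiM UNIV (\<lambda>_. S)) g) (PiM UNIV (\<lambda>_. S)) (\<lambda>x j. x (t - int j))"
    using g by (subst distr_distr) (auto simp: comp_def intro!: measurable_abs_UNIV)
  also have "\<dots> = distr (PiM UNIV (\<lambda>_. N)) (PiM UNIV (\<lambda>_. N)) (\<lambda>x. \<lambda>j\<in>UNIV. x (t - int j))"
    by (intro distr_cong) (auto simp: law sets)
  also have "\<dots> = PiM UNIV (\<lambda>_. N)"
    using N(1) by (intro distr_PiM_reindex) (auto simp: inj_on_def)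
  finally show ?thesis .
qed

section \<open>The coupling of a causal process at a given lag\<close>

locale causal_coupling = prob_space M for M :: "'w measure" +
  fixes S :: "'s measure" and f :: "(nat \<Rightarrow> 's) \<Rightarrow> 'h::{real_inner, banach, second_countable_topology}"
    and \<epsilon> :: "int \<Rightarrow> 'w \<Rightarrow> 's" and \<epsilon>' :: "int \<Rightarrow> nat \<Rightarrow> int \<Rightarrow> 'w \<Rightarrow> 's"
  assumes f_measurable[measurable]: "f \<in> borel_measurable (PiM UNIV (\<lambda>_. S))"
    and iid: "iid_sequence M S \<epsilon>"
    and copies: "independent_copies M S \<epsilon> \<epsilon>'"
begin

definition marginal :: "'s measure" where "marginal = distr M S (\<epsilon> 0)"

definition path_law :: "(nat \<Rightarrow> 's) measure" where "path_law = PiM UNIV (\<lambda>_. marginal)"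

definition past :: "int \<Rightarrow> 'w \<Rightarrow> nat \<Rightarrow> 's" where "past t \<omega> j = \<epsilon> (t - int j) \<omega>"

definition past' :: "int \<Rightarrow> nat \<Rightarrow> 'w \<Rightarrow> nat \<Rightarrow> 's" where "past' t m \<omega> j = \<epsilon>' t m (t - int j) \<omega>"

lemma m_coupling_splice: "m_coupling f \<epsilon> \<epsilon>' m t \<omega> = f (splice_seq m (past t \<omega>) (past' t m \<omega>))"
  unfolding m_coupling_def splice_seq_def past_def past'_def by simp

lemma past_diff: "past (t - int m) \<omega> = drop_seq m (past t \<omega>)"
  by (auto simp: past_def drop_seq_def algebra_simps)

lemma sets_marginal: "sets marginal = sets S"
  by (simp add: marginal_def)

lemma sets_path_law[measurable_cong]: "sets path_law = sets (PiM UNIV (\<lambda>_. S))"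
  unfolding path_law_def by (intro sets_PiM_cong) (simp_all add: sets_marginal)

lemma \<epsilon>_measurable[measurable]: "\<epsilon> j \<in> M \<rightarrow>\<^sub>M S"
  using iid by (auto simp: iid_sequence_def indep_vars_def)

lemma prob_space_marginal: "prob_space marginal"
  unfolding marginal_def by (intro prob_space_distr \<epsilon>_measurable)

lemma sequence_space_marginal: "sequence_space marginal"
proof -
  interpret N: prob_space marginal by (rule prob_space_marginal)
  show ?thesis by unfold_locales
qed

lemma prob_space_path_law: "prob_space path_law"
  unfolding path_law_def by (intro prob_space_PiM prob_space_marginal)

lemma past_measurable[measurable]: "past t \<in> M \<rightarrow>\<^sub>M PiM UNIV (\<lambda>_. S)"
  unfolding past_def[abs_def] by (intro measurable_abs_UNIV \<epsilon>_measurable)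

lemma distr_\<epsilon>: "distr M (PiM UNIV (\<lambda>_. S)) (\<lambda>\<omega> k. \<epsilon> k \<omega>) = PiM UNIV (\<lambda>_. marginal)"
proof -
  have "indep_vars (\<lambda>_. S) \<epsilon> UNIV" and eq: "distr M S (\<epsilon> j) = marginal" for j
    using iid unfolding iid_sequence_def marginal_def by blast+
  from this(1) show ?thesis
    by (subst (asm) indep_vars_iff_distr_eq_PiM) (auto simp: eq restrict_UNIV)
qed

lemma distr_past: "distr M (PiM UNIV (\<lambda>_. S)) (past t) = path_law"
  unfolding past_def[abs_def] path_law_def
  by (rule iid_reindex_distr[OF _ prob_space_marginal sets_marginal distr_\<epsilon>])
    (auto intro!: measurable_abs_UNIV)

context
  fixes t :: int and m :: nat
  assumes m: "1 \<le> m"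
begin

text \<open>\<open>1 \<le> m\<close> puts \<open>Some (t, m)\<close> into the index set of
  \<open>independent_copies\<close>; at \<open>m = 0\<close> nothing is known about
  \<open>\<epsilon>'\<close>.\<close>

lemma \<epsilon>'_measurable: "(\<lambda>\<omega> k. \<epsilon>' t m k \<omega>) \<in> M \<rightarrow>\<^sub>M PiM UNIV (\<lambda>_. S)"
proof -
  have "random_variable (PiM UNIV (\<lambda>_. S))
      (\<lambda>\<omega> k. case Some (t, m) of None \<Rightarrow> \<epsilon> k \<omega> | Some (t, m) \<Rightarrow> \<epsilon>' t m k \<omega>)"
    using copies m unfolding independent_copies_def indep_vars_def by blast
  then show ?thesis by simp
qed

lemma \<epsilon>'_component_measurable[measurable]: "\<epsilon>' t m k \<in> M \<rightarrow>\<^sub>M S"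
  using measurable_compose[OF \<epsilon>'_measurable measurable_component_singleton[of k]] by simp

lemma past'_measurable[measurable]: "past' t m \<in> M \<rightarrow>\<^sub>M PiM UNIV (\<lambda>_. S)"
  unfolding past'_def[abs_def] by (intro measurable_abs_UNIV \<epsilon>'_component_measurable)

lemma m_coupling_measurable[measurable]: "m_coupling f \<epsilon> \<epsilon>' m t \<in> borel_measurable M"
  unfolding m_coupling_splice[abs_def] by measurable

lemma distr_past': "distr M (PiM UNIV (\<lambda>_. S)) (past' t m) = path_law"
proof -
  have "\<forall>t. \<forall>m\<ge>1. distr M (PiM UNIV (\<lambda>_. S)) (\<lambda>\<omega> k. \<epsilon>' t m k \<omega>)
      = distr M (PiM UNIV (\<lambda>_. S)) (\<lambda>\<omega> k. \<epsilon> k \<omega>)"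
    using copies unfolding independent_copies_def by (rule conjunct2)
  then have "distr M (PiM UNIV (\<lambda>_. S)) (\<lambda>\<omega> k. \<epsilon>' t m k \<omega>) = PiM UNIV (\<lambda>_. marginal)"
    using m distr_\<epsilon> by simp
  from iid_reindex_distr[OF \<epsilon>'_measurable prob_space_marginal sets_marginal this, of t]
  show ?thesis
    unfolding past'_def[abs_def] path_law_def .
qed

text \<open>Joint independence restricts to the disjoint index sets \<open>{None}\<close> and
  \<open>{Some (t, m)}\<close>, and each reversed sequence is a measurable function of its
  block.\<close>

lemma indep_past: "indep_var (PiM UNIV (\<lambda>_. S)) (past t) (PiM UNIV (\<lambda>_. S)) (past' t m)"
proof -
  let ?P = "PiM UNIV (\<lambda>_. S)"
  let ?Z = "\<lambda>i \<omega> k. case i of None \<Rightarrow> \<epsilon> k \<omega> | Some (t, m) \<Rightarrow> \<epsilon>' t m k \<omega>"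
  have ind: "indep_var (PiM {None} (\<lambda>_. ?P)) (\<lambda>\<omega>. restrict (\<lambda>i. ?Z i \<omega>) {None})
      (PiM {Some (t, m)} (\<lambda>_. ?P)) (\<lambda>\<omega>. restrict (\<lambda>i. ?Z i \<omega>) {Some (t, m)})"
    by (rule indep_var_restrict[where I = "insert None (Some ` (UNIV \<times> {1..}))"])
      (use copies m in \<open>auto simp: independent_copies_def\<close>)
  have proj: "(\<lambda>x j. x i (t - int j)) \<in> PiM {i} (\<lambda>_. ?P) \<rightarrow>\<^sub>M PiM UNIV (\<lambda>_. S)" for i
  proof (rule measurable_abs_UNIV)
    fix j
    have "(\<lambda>x. x i) \<in> PiM {i} (\<lambda>_. ?P) \<rightarrow>\<^sub>M ?P" by (rule measurable_component_singleton) simp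
    then show "(\<lambda>x. x i (t - int j)) \<in> PiM {i} (\<lambda>_. ?P) \<rightarrow>\<^sub>M S"
      by (rule measurable_compose) (simp add: measurable_component_singleton)
  qed
  from ind have "indep_var (PiM UNIV (\<lambda>_. S))
      ((\<lambda>x j. x None (t - int j)) \<circ> (\<lambda>\<omega>. restrict (\<lambda>i. ?Z i \<omega>) {None}))
      (PiM UNIV (\<lambda>_. S))
      ((\<lambda>x j. x (Some (t, m)) (t - int j)) \<circ> (\<lambda>\<omega>. restrict (\<lambda>i. ?Z i \<omega>) {Some (t, m)}))"
    by (rule indep_var_compose) (rule proj)+
  then show ?thesis
    by (simp add: comp_def past_def[abs_def] past'_def[abs_def])
qed

lemma nn_integral_past_past':
  assumes [measurable]: "case_prod G \<in> borel_measurable (path_law \<Otimes>\<^sub>M path_law)"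
  shows "(\<integral>\<^sup>+\<omega>. G (past t \<omega>) (past' t m \<omega>) \<partial>M) = (\<integral>\<^sup>+a. \<integral>\<^sup>+b. G a b \<partial>path_law \<partial>path_law)"
proof -
  interpret N: prob_space path_law by (rule prob_space_path_law)
  let ?P = "PiM UNIV (\<lambda>_. S)"
  have "path_law \<Otimes>\<^sub>M path_law = distr M (?P \<Otimes>\<^sub>M ?P) (\<lambda>\<omega>. (past t \<omega>, past' t m \<omega>))"
    using indep_past by (simp add: indep_var_distribution_eq distr_past distr_past')
  moreover have "(\<integral>\<^sup>+\<omega>. G (past t \<omega>) (past' t m \<omega>) \<partial>M)
      = (\<integral>\<^sup>+x. case_prod G x \<partial>distr M (?P \<Otimes>\<^sub>M ?P) (\<lambda>\<omega>. (past t \<omega>, past' t m \<omega>)))"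
    by (subst nn_integral_distr) auto
  moreover have "(\<integral>\<^sup>+x. case_prod G x \<partial>(path_law \<Otimes>\<^sub>M path_law)) = (\<integral>\<^sup>+a. \<integral>\<^sup>+b. G a b \<partial>path_law \<partial>path_law)"
    by (subst N.nn_integral_fst[symmetric]) auto
  ultimately show ?thesis by simp
qed

text \<open>Splicing two independent sequences with law \<open>path_law\<close> gives that law
  again, so the coupling is distributed like \<open>f (past t)\<close>.\<close>

lemma nn_integral_m_coupling:
  assumes [measurable]: "F \<in> borel_measurable borel"
  shows "(\<integral>\<^sup>+\<omega>. F (m_coupling f \<epsilon> \<epsilon>' m t \<omega>) \<partial>M) = (\<integral>\<^sup>+a. F (f a) \<partial>path_law)"
proof -
  interpret N: sequence_space marginal by (rule sequence_space_marginal)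
  have "(\<integral>\<^sup>+\<omega>. F (m_coupling f \<epsilon> \<epsilon>' m t \<omega>) \<partial>M) = (\<integral>\<^sup>+a. \<integral>\<^sup>+b. F (f (splice_seq m a b)) \<partial>path_law \<partial>path_law)"
    unfolding m_coupling_splice by (subst nn_integral_past_past') auto
  also have "\<dots> = (\<integral>\<^sup>+a. F (f a) \<partial>path_law)"
    unfolding path_law_def
    by (intro N.nn_integral_splice) (simp flip: path_law_def)
  finally show ?thesis .
qed

text \<open>The coupling uses \<open>\<epsilon>\<close> only after time \<open>t - int m\<close>,
  together with a fresh copy, and is therefore independent of the process \<open>m\<close> steps
  earlier.\<close>

lemma nn_integral_past_m_coupling:
  assumes [measurable]: "case_prod G \<in> borel_measurable (borel \<Otimes>\<^sub>M borel)"
  shows "(\<integral>\<^sup>+\<omega>. G (f (past (t - int m) \<omega>)) (m_coupling f \<epsilon> \<epsilon>' m t \<omega>) \<partial>M)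
      = (\<integral>\<^sup>+a. \<integral>\<^sup>+c. G (f a) (f c) \<partial>path_law \<partial>path_law)"
proof -
  interpret N: sequence_space marginal by (rule sequence_space_marginal)
  have "(\<integral>\<^sup>+\<omega>. G (f (past (t - int m) \<omega>)) (m_coupling f \<epsilon> \<epsilon>' m t \<omega>) \<partial>M)
      = (\<integral>\<^sup>+a. \<integral>\<^sup>+b. G (f (drop_seq m a)) (f (splice_seq m a b)) \<partial>path_law \<partial>path_law)"
    unfolding m_coupling_splice past_diff by (subst nn_integral_past_past') auto
  also have "\<dots> = (\<integral>\<^sup>+a. \<integral>\<^sup>+c. G (f a) (f c) \<partial>path_law \<partial>path_law)"
    unfolding path_law_def
    by (intro N.nn_integral_drop_splice[of "\<lambda>a b. G (f a) (f b)"]) (simp flip: path_law_def)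
  finally show ?thesis .
qed

end

end

section \<open>Decay of covariances\<close>

lemma in_Lp_4_iff: "in_Lp M 4 X \<longleftrightarrow> X \<in> borel_measurable M \<and> integrable M (\<lambda>\<omega>. norm (X \<omega>) ^ 4)"
  by (simp add: in_Lp_def)

lemma v_norm_4_power4: "v_norm M 4 X ^ 4 = (\<integral>\<omega>. norm (X \<omega>) ^ 4 \<partial>M)"
proof -
  have "0 \<le> (\<integral>\<omega>. norm (X \<omega>) ^ 4 \<partial>M)" by simp
  then show ?thesis by (simp add: v_norm_def powr_powr flip: powr_numeral)
qed

lemma power4_add_le: "(a + b) ^ 4 \<le> 8 * (a ^ 4 + b ^ 4)" for a b :: real
proof -
  have sq: "(x + y)\<^sup>2 \<le> 2 * (x\<^sup>2 + y\<^sup>2)" for x y :: real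
    using zero_le_power2[of "x - y"] by (simp add: power2_sum power2_diff)
  have "(a + b) ^ 4 = ((a + b)\<^sup>2)\<^sup>2" by (simp flip: power_mult)
  also have "\<dots> \<le> (2 * (a\<^sup>2 + b\<^sup>2))\<^sup>2" by (intro power_mono sq) simp
  also have "\<dots> \<le> 4 * (2 * ((a\<^sup>2)\<^sup>2 + (b\<^sup>2)\<^sup>2))"
    unfolding power_mult_distrib using sq[of "a\<^sup>2" "b\<^sup>2"] by simp
  finally show ?thesis by (simp flip: power_mult)
qed

lemma inner_square_le: "(inner x y)\<^sup>2 \<le> (norm x ^ 4 + norm y ^ 4) / 2" for x y :: "'a::real_inner"
proof -
  have "(inner x y)\<^sup>2 \<le> (norm x)\<^sup>2 * (norm y)\<^sup>2"
    using Cauchy_Schwarz_ineq[of x y] by (simp add: power2_norm_eq_inner)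
  also have "\<dots> \<le> (((norm x)\<^sup>2)\<^sup>2 + ((norm y)\<^sup>2)\<^sup>2) / 2"
    using sum_squares_bound[of "(norm x)\<^sup>2" "(norm y)\<^sup>2"] by simp
  finally show ?thesis by (simp flip: power_mult)
qed

text \<open>The difference of squares factors into inner products of \<open>x\<close> with
  \<open>y - y'\<close> and \<open>y + y'\<close>, so the coupling error enters linearly.\<close>

lemma inner_square_diff_le:
  fixes x y y' :: "'a::real_inner"
  shows "\<bar>(inner x y)\<^sup>2 - (inner x y')\<^sup>2\<bar> \<le> (norm x)\<^sup>2 * norm (y - y') * (norm y + norm y')"
proof -
  have "\<bar>(inner x y)\<^sup>2 - (inner x y')\<^sup>2\<bar> = \<bar>inner x (y - y')\<bar> * \<bar>inner x (y + y')\<bar>"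
    by (simp add: power2_eq_square inner_diff_right inner_add_right algebra_simps flip: abs_mult)
  also have "\<dots> \<le> (norm x * norm (y - y')) * (norm x * norm (y + y'))"
    by (intro mult_mono Cauchy_Schwarz_ineq2) auto
  also have "\<dots> \<le> (norm x * norm (y - y')) * (norm x * (norm y + norm y'))"
    by (intro mult_left_mono norm_triangle_ineq) auto
  finally show ?thesis by (simp add: power2_eq_square mult_ac)
qed

text \<open>Pointwise substitute for Hoelder's inequality with exponents 2, 4, 4. The weight
  \<open>l\<close> is free; choosing it as the \<open>L\<^sup>4\<close> size of \<open>b\<close>
  makes the integrated bound linear in that size.\<close>

lemma weighted_young:
  fixes a b c l :: real
  assumes l: "0 < l"
  shows "a\<^sup>2 * b * c \<le> l * (a ^ 4 / 2 + c ^ 4 / 4) + b ^ 4 / (4 * l ^ 3)"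
proof -
  have 1: "2 * l * (a\<^sup>2 * b * c) \<le> l\<^sup>2 * a ^ 4 + b\<^sup>2 * c\<^sup>2"
    using zero_le_power2[of "l * a\<^sup>2 - b * c"]
    by (simp add: power2_diff power_mult_distrib mult_ac flip: power_mult)
  have 2: "2 * l\<^sup>2 * (b\<^sup>2 * c\<^sup>2) \<le> l ^ 4 * c ^ 4 + b ^ 4"
    using zero_le_power2[of "l\<^sup>2 * c\<^sup>2 - b\<^sup>2"]
    by (simp add: power2_diff power_mult_distrib mult_ac flip: power_mult)
  have "4 * l ^ 3 * (a\<^sup>2 * b * c) = 2 * l\<^sup>2 * (2 * l * (a\<^sup>2 * b * c))"
    by (simp add: power2_eq_square power3_eq_cube)
  also have "\<dots> \<le> 2 * l\<^sup>2 * (l\<^sup>2 * a ^ 4 + b\<^sup>2 * c\<^sup>2)"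
    using 1 by (intro mult_left_mono) auto
  also have "\<dots> \<le> 2 * l ^ 4 * a ^ 4 + (l ^ 4 * c ^ 4 + b ^ 4)"
    using 2 by (simp add: algebra_simps flip: power_add)
  also have "\<dots> = 4 * l ^ 3 * (l * (a ^ 4 / 2 + c ^ 4 / 4) + b ^ 4 / (4 * l ^ 3))"
    using l by (simp add: field_simps power3_eq_cube power4_eq_xxxx)
  finally show ?thesis using l by (subst (asm) mult_le_cancel_left_pos) auto
qed

lemma integrable_inner_square:
  fixes X Z :: "'w \<Rightarrow> 'h::{real_inner, banach, second_countable_topology}"
  assumes "in_Lp M 4 X" "in_Lp M 4 Z"
  shows "integrable M (\<lambda>\<omega>. (inner (X \<omega>) (Z \<omega>))\<^sup>2)"
proof (rule Bochner_Integration.integrable_bound)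
  show "integrable M (\<lambda>\<omega>. (norm (X \<omega>) ^ 4 + norm (Z \<omega>) ^ 4) / 2)"
    using assms by (simp add: in_Lp_4_iff)
  show "AE \<omega> in M. norm ((inner (X \<omega>) (Z \<omega>))\<^sup>2) \<le> norm ((norm (X \<omega>) ^ 4 + norm (Z \<omega>) ^ 4) / 2)"
    by (intro AE_I2) (use inner_square_le in simp)
qed (use assms in \<open>auto simp: in_Lp_4_iff\<close>)

context prob_space
begin

lemma in_Lp_const: "in_Lp M p (\<lambda>_. x)"
  by (simp add: in_Lp_def)

context
  fixes X Z :: "'a \<Rightarrow> 'h::{real_inner, banach, second_countable_topology}"
  assumes X: "in_Lp M 4 X" and Z: "in_Lp M 4 Z"
begin

lemma integral_inner_square_le: "(\<integral>\<omega>'. (inner x (Z \<omega>'))\<^sup>2 \<partial>M) \<le> (norm x ^ 4 + (\<integral>\<omega>'. norm (Z \<omega>') ^ 4 \<partial>M)) / 2"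
proof -
  have "(\<integral>\<omega>'. (inner x (Z \<omega>'))\<^sup>2 \<partial>M) \<le> (\<integral>\<omega>'. (norm x ^ 4 + norm (Z \<omega>') ^ 4) / 2 \<partial>M)"
    using Z by (intro integral_mono integrable_inner_square in_Lp_const inner_square_le)
      (auto simp: in_Lp_4_iff)
  also have "\<dots> = (norm x ^ 4 + (\<integral>\<omega>'. norm (Z \<omega>') ^ 4 \<partial>M)) / 2"
    using Z by (simp add: in_Lp_4_iff prob_space)
  finally show ?thesis .
qed

text \<open>Two separate integrations over \<open>M\<close> model an independent copy of
  \<open>Z\<close> without enlarging the probability space.\<close>

lemma integrable_integral_inner_square: "integrable M (\<lambda>\<omega>. \<integral>\<omega>'. (inner (X \<omega>) (Z \<omega>'))\<^sup>2 \<partial>M)"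
proof (rule Bochner_Integration.integrable_bound)
  have [measurable]: "X \<in> borel_measurable M" "Z \<in> borel_measurable M"
    using X Z by (auto simp: in_Lp_def)
  show "integrable M (\<lambda>\<omega>. (norm (X \<omega>) ^ 4 + (\<integral>\<omega>'. norm (Z \<omega>') ^ 4 \<partial>M)) / 2)"
    using X by (simp add: in_Lp_4_iff)
  show "(\<lambda>\<omega>. \<integral>\<omega>'. (inner (X \<omega>) (Z \<omega>'))\<^sup>2 \<partial>M) \<in> borel_measurable M"
    by measurable
  show "AE \<omega> in M. norm (\<integral>\<omega>'. (inner (X \<omega>) (Z \<omega>'))\<^sup>2 \<partial>M)
      \<le> norm ((norm (X \<omega>) ^ 4 + (\<integral>\<omega>'. norm (Z \<omega>') ^ 4 \<partial>M)) / 2)"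
    using integral_inner_square_le by (intro AE_I2) simp
qed

lemma double_integral_inner_square_le: "(\<integral>\<omega>. \<integral>\<omega>'. (inner (X \<omega>) (Z \<omega>'))\<^sup>2 \<partial>M \<partial>M)
    \<le> ((\<integral>\<omega>. norm (X \<omega>) ^ 4 \<partial>M) + (\<integral>\<omega>. norm (Z \<omega>) ^ 4 \<partial>M)) / 2"
proof -
  have "(\<integral>\<omega>. \<integral>\<omega>'. (inner (X \<omega>) (Z \<omega>'))\<^sup>2 \<partial>M \<partial>M)
      \<le> (\<integral>\<omega>. (norm (X \<omega>) ^ 4 + (\<integral>\<omega>'. norm (Z \<omega>') ^ 4 \<partial>M)) / 2 \<partial>M)"
    using X by (intro integral_mono integrable_integral_inner_square integral_inner_square_le)
      (auto simp: in_Lp_4_iff)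
  also have "\<dots> = ((\<integral>\<omega>. norm (X \<omega>) ^ 4 \<partial>M) + (\<integral>\<omega>. norm (Z \<omega>) ^ 4 \<partial>M)) / 2"
    using X by (simp add: in_Lp_4_iff prob_space)
  finally show ?thesis .
qed

lemma nn_double_integral_inner_square:
  "(\<integral>\<^sup>+\<omega>. \<integral>\<^sup>+\<omega>'. ennreal ((inner (X \<omega>) (Z \<omega>'))\<^sup>2) \<partial>M \<partial>M)
    = ennreal (\<integral>\<omega>. \<integral>\<omega>'. (inner (X \<omega>) (Z \<omega>'))\<^sup>2 \<partial>M \<partial>M)"
proof -
  have "(\<integral>\<^sup>+\<omega>'. ennreal ((inner x (Z \<omega>'))\<^sup>2) \<partial>M) = ennreal (\<integral>\<omega>'. (inner x (Z \<omega>'))\<^sup>2 \<partial>M)" for x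
    by (intro nn_integral_eq_integral integrable_inner_square in_Lp_const Z) simp
  then show ?thesis
    by (simp add: nn_integral_eq_integral[OF integrable_integral_inner_square])
qed

end

end

section \<open>Comparison of a causal process with its couplings\<close>

context causal_coupling
begin

context
  fixes Y :: "int \<Rightarrow> 'w \<Rightarrow> 'h"
  assumes Y: "\<And>t. in_Lp M 4 (Y t)" and Yf: "\<And>t. AE \<omega> in M. Y t \<omega> = f (past t \<omega>)"
begin

lemma Y_measurable[measurable]: "Y t \<in> borel_measurable M"
  using Y by (simp add: in_Lp_def)

lemma distr_Y: "distr M borel (Y t) = distr path_law borel f"
proof -
  have "distr M borel (Y t) = distr M borel (\<lambda>\<omega>. f (past t \<omega>))"
    by (rule distr_cong_AE) (use Yf in auto)
  also have "\<dots> = distr (distr M (PiM UNIV (\<lambda>_. S)) (past t)) borel f"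
    by (subst distr_distr) (auto simp: comp_def)
  finally show ?thesis by (simp add: distr_past)
qed

lemma nn_integral_Y: "F \<in> borel_measurable borel \<Longrightarrow> (\<integral>\<^sup>+\<omega>. F (Y t \<omega>) \<partial>M) = (\<integral>\<^sup>+a. F (f a) \<partial>path_law)"
  using arg_cong[OF distr_Y[of t], of "\<lambda>N. integral\<^sup>N N F"]
  by (simp add: nn_integral_distr)

lemma integral_Y:
  fixes F :: "'h \<Rightarrow> real"
  shows "F \<in> borel_measurable borel \<Longrightarrow> (\<integral>\<omega>. F (Y t \<omega>) \<partial>M) = (\<integral>a. F (f a) \<partial>path_law)"
  using arg_cong[OF distr_Y[of t], of "\<lambda>N. integral\<^sup>L N F"]
  by (simp add: integral_distr)

text \<open>Expressed on \<open>path_law\<close>, so that it serves every \<open>Y t\<close> and all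
  couplings at once.\<close>

definition moment4 :: real where "moment4 = (\<integral>a. norm (f a) ^ 4 \<partial>path_law)"

lemma moment4: "(\<integral>\<omega>. norm (Y t \<omega>) ^ 4 \<partial>M) = moment4"
  unfolding moment4_def by (rule integral_Y) simp

lemma moment4_nonneg: "0 \<le> moment4"
  by (simp add: moment4_def)

lemma distr_m_coupling:
  assumes m: "1 \<le> m"
  shows "distr M borel (m_coupling f \<epsilon> \<epsilon>' m t) = distr M borel (Y t)"
proof (rule measure_eqI)
  note [measurable] = m_coupling_measurable[OF m]
  fix A assume "A \<in> sets (distr M borel (m_coupling f \<epsilon> \<epsilon>' m t))"
  then have A[measurable]: "A \<in> sets borel" by simp
  have "emeasure (distr M borel (m_coupling f \<epsilon> \<epsilon>' m t)) A
      = (\<integral>\<^sup>+\<omega>. indicator A (m_coupling f \<epsilon> \<epsilon>' m t \<omega>) \<partial>M)"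
    by (subst nn_integral_distr[of _ M borel, symmetric]) auto
  also have "\<dots> = (\<integral>\<^sup>+\<omega>. indicator A (Y t \<omega>) \<partial>M)"
    by (simp add: nn_integral_m_coupling[OF m] nn_integral_Y)
  also have "\<dots> = emeasure (distr M borel (Y t)) A"
    by (subst nn_integral_distr[of _ M borel, symmetric]) auto
  finally show "emeasure (distr M borel (m_coupling f \<epsilon> \<epsilon>' m t)) A = emeasure (distr M borel (Y t)) A" .
qed simp

lemma m_coupling_Lp:
  assumes m: "1 \<le> m"
  shows "in_Lp M 4 (m_coupling f \<epsilon> \<epsilon>' m t)" "(\<integral>\<omega>. norm (m_coupling f \<epsilon> \<epsilon>' m t \<omega>) ^ 4 \<partial>M) = moment4"
proof -
  note [measurable] = m_coupling_measurable[OF m]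
  have "integrable (distr M borel (Y t)) (\<lambda>x. norm x ^ 4)"
    using Y by (subst integrable_distr_eq) (auto simp: in_Lp_4_iff)
  then show "in_Lp M 4 (m_coupling f \<epsilon> \<epsilon>' m t)"
    by (simp add: in_Lp_4_iff integrable_distr_eq flip: distr_m_coupling[OF m])
  have "(\<integral>\<omega>. norm (m_coupling f \<epsilon> \<epsilon>' m t \<omega>) ^ 4 \<partial>M) = (\<integral>\<omega>. norm (Y t \<omega>) ^ 4 \<partial>M)"
    using arg_cong[OF distr_m_coupling[OF m, of t], of "\<lambda>N. integral\<^sup>L N (\<lambda>x. norm x ^ 4)"]
    by (simp add: integral_distr)
  then show "(\<integral>\<omega>. norm (m_coupling f \<epsilon> \<epsilon>' m t \<omega>) ^ 4 \<partial>M) = moment4" by (simp add: moment4)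
qed

text \<open>At every time the coupling error is the same function of \<open>past t\<close> and
  \<open>past' t m\<close>, whose joint law is the product of two copies of
  \<open>path_law\<close>.\<close>

lemma v_norm_shift:
  assumes m: "1 \<le> m"
  shows "v_norm M 4 (\<lambda>\<omega>. Y t \<omega> - m_coupling f \<epsilon> \<epsilon>' m t \<omega>)
    = v_norm M 4 (\<lambda>\<omega>. Y s \<omega> - m_coupling f \<epsilon> \<epsilon>' m s \<omega>)"
proof -
  have "(\<integral>\<omega>. norm (Y t \<omega> - m_coupling f \<epsilon> \<epsilon>' m t \<omega>) powr 4 \<partial>M)
      = enn2real (\<integral>\<^sup>+a. \<integral>\<^sup>+b. ennreal (norm (f a - f (splice_seq m a b)) powr 4) \<partial>path_law \<partial>path_law)" for t
  proof -
    note [measurable] = m_coupling_measurable[OF m] past'_measurable[OF m]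
    have "(\<integral>\<^sup>+\<omega>. ennreal (norm (Y t \<omega> - m_coupling f \<epsilon> \<epsilon>' m t \<omega>) powr 4) \<partial>M)
        = (\<integral>\<^sup>+\<omega>. ennreal (norm (f (past t \<omega>) - f (splice_seq m (past t \<omega>) (past' t m \<omega>))) powr 4) \<partial>M)"
      by (rule nn_integral_cong_AE) (use Yf[of t] in \<open>auto simp: m_coupling_splice\<close>)
    also have "\<dots> = (\<integral>\<^sup>+a. \<integral>\<^sup>+b. ennreal (norm (f a - f (splice_seq m a b)) powr 4) \<partial>path_law \<partial>path_law)"
      by (intro nn_integral_past_past'[OF m, of "\<lambda>a b. ennreal (norm (f a - f (splice_seq m a b)) powr 4)"]) measurable
    finally show ?thesis
      by (subst integral_eq_nn_integral) auto
  qed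
  then show ?thesis by (simp add: v_norm_def)
qed

text \<open>The right-hand side mentions neither \<open>s\<close> nor \<open>t\<close>; this gives
  the symmetry used in \<open>covariance_decay\<close>.\<close>

lemma double_integral_inner_square:
  "ennreal (\<integral>\<omega>. \<integral>\<omega>'. (inner (Y s \<omega>) (Y t \<omega>'))\<^sup>2 \<partial>M \<partial>M)
    = (\<integral>\<^sup>+a. \<integral>\<^sup>+c. ennreal ((inner (f a) (f c))\<^sup>2) \<partial>path_law \<partial>path_law)"
proof -
  interpret N: prob_space path_law by (rule prob_space_path_law)
  have "ennreal (\<integral>\<omega>. \<integral>\<omega>'. (inner (Y s \<omega>) (Y t \<omega>'))\<^sup>2 \<partial>M \<partial>M)
      = (\<integral>\<^sup>+\<omega>. \<integral>\<^sup>+c. ennreal ((inner (Y s \<omega>) (f c))\<^sup>2) \<partial>path_law \<partial>M)"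
    unfolding nn_double_integral_inner_square[OF Y Y, symmetric]
    by (intro nn_integral_cong nn_integral_Y[of "\<lambda>y. ennreal ((inner _ y)\<^sup>2)"]) simp
  also have "\<dots> = (\<integral>\<^sup>+a. \<integral>\<^sup>+c. ennreal ((inner (f a) (f c))\<^sup>2) \<partial>path_law \<partial>path_law)"
    by (intro nn_integral_Y[of "\<lambda>x. \<integral>\<^sup>+c. ennreal ((inner x (f c))\<^sup>2) \<partial>path_law"]) measurable
  finally show ?thesis .
qed

text \<open>The coupling acts as an independent copy of \<open>Y t\<close> for the earlier variable.
  A covariance thus becomes a single expectation of a difference of two squares.\<close>

lemma integral_inner_square_m_coupling:
  assumes m: "1 \<le> m"
  shows "(\<integral>\<omega>. (inner (Y (t - int m) \<omega>) (m_coupling f \<epsilon> \<epsilon>' m t \<omega>))\<^sup>2 \<partial>M)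
      = (\<integral>\<omega>. \<integral>\<omega>'. (inner (Y (t - int m) \<omega>) (Y t \<omega>'))\<^sup>2 \<partial>M \<partial>M)"
proof -
  note [measurable] = m_coupling_measurable[OF m]
  have "ennreal (\<integral>\<omega>. (inner (Y (t - int m) \<omega>) (m_coupling f \<epsilon> \<epsilon>' m t \<omega>))\<^sup>2 \<partial>M)
      = (\<integral>\<^sup>+\<omega>. ennreal ((inner (Y (t - int m) \<omega>) (m_coupling f \<epsilon> \<epsilon>' m t \<omega>))\<^sup>2) \<partial>M)"
    by (intro nn_integral_eq_integral[symmetric] integrable_inner_square Y m_coupling_Lp m) simp
  also have "\<dots> = (\<integral>\<^sup>+\<omega>. ennreal ((inner (f (past (t - int m) \<omega>)) (m_coupling f \<epsilon> \<epsilon>' m t \<omega>))\<^sup>2) \<partial>M)"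
    by (rule nn_integral_cong_AE) (use Yf[of "t - int m"] in auto)
  also have "\<dots> = (\<integral>\<^sup>+a. \<integral>\<^sup>+c. ennreal ((inner (f a) (f c))\<^sup>2) \<partial>path_law \<partial>path_law)"
    by (intro nn_integral_past_m_coupling[OF m, of "\<lambda>x y. ennreal ((inner x y)\<^sup>2)"]) measurable
  finally show ?thesis
    by (simp flip: double_integral_inner_square[of "t - int m" t])
qed

text \<open>Replacing \<open>Y t\<close> by its coupling turns the first integral into the second,
  and the cost of the replacement is estimated by \<open>inner_square_diff_le\<close> and
  \<open>weighted_young\<close>.\<close>

lemma lag_covariance_le:
  assumes m: "1 \<le> m"
  shows "\<bar>(\<integral>\<omega>. (inner (Y (t - int m) \<omega>) (Y t \<omega>))\<^sup>2 \<partial>M)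
        - (\<integral>\<omega>. \<integral>\<omega>'. (inner (Y (t - int m) \<omega>) (Y t \<omega>'))\<^sup>2 \<partial>M \<partial>M)\<bar>
      \<le> v_norm M 4 (\<lambda>\<omega>. Y t \<omega> - m_coupling f \<epsilon> \<epsilon>' m t \<omega>) * (9 / 2 * moment4 + 1 / 4)"
    (is "\<bar>?D\<bar> \<le> ?v * _")
proof -
  note [measurable] = m_coupling_measurable[OF m]
  let ?X = "Y (t - int m)" and ?Z = "m_coupling f \<epsilon> \<epsilon>' m t"
  have iY: "integrable M (\<lambda>\<omega>. norm (Y t \<omega>) ^ 4)" for t
    using Y by (simp add: in_Lp_4_iff)
  have iZ: "integrable M (\<lambda>\<omega>. norm (?Z \<omega>) ^ 4)"
    using m_coupling_Lp(1)[OF m] by (simp add: in_Lp_4_iff)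
  have ib: "integrable M (\<lambda>\<omega>. norm (Y t \<omega> - ?Z \<omega>) ^ 4)"
  proof (rule Bochner_Integration.integrable_bound)
    show "integrable M (\<lambda>\<omega>. 8 * (norm (Y t \<omega>) ^ 4 + norm (?Z \<omega>) ^ 4))"
      using iY iZ by simp
    have "norm (x - z) ^ 4 \<le> 8 * (norm x ^ 4 + norm z ^ 4)" for x z :: 'h
      by (rule order_trans[OF power_mono[OF norm_triangle_ineq4] power4_add_le]) simp
    then show "AE \<omega> in M. norm (norm (Y t \<omega> - ?Z \<omega>) ^ 4) \<le> norm (8 * (norm (Y t \<omega>) ^ 4 + norm (?Z \<omega>) ^ 4))"
      by (intro AE_I2) simp
  qed measurable
  have v0: "0 \<le> ?v" by (simp add: v_norm_def)
  \<comment> \<open>\<open>9 / 2\<close> collects \<open>1 / 2\<close> from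
    \<open>Y (t - int m)\<close> and \<open>8 / 4\<close> from each of \<open>Y t\<close> and its
    coupling, all with fourth moment \<open>moment4\<close>.\<close>
  have bound: "\<bar>?D\<bar> \<le> l * (9 / 2 * moment4) + ?v ^ 4 / (4 * l ^ 3)" if l: "0 < l" for l
  proof -
    let ?R = "\<lambda>\<omega>. l * (norm (?X \<omega>) ^ 4 / 2 + 8 * (norm (Y t \<omega>) ^ 4 + norm (?Z \<omega>) ^ 4) / 4)
        + norm (Y t \<omega> - ?Z \<omega>) ^ 4 / (4 * l ^ 3)"
    have pw: "\<bar>(inner (?X \<omega>) (Y t \<omega>))\<^sup>2 - (inner (?X \<omega>) (?Z \<omega>))\<^sup>2\<bar> \<le> ?R \<omega>" for \<omega>
    proof -
      have "\<bar>(inner (?X \<omega>) (Y t \<omega>))\<^sup>2 - (inner (?X \<omega>) (?Z \<omega>))\<^sup>2\<bar>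
          \<le> l * (norm (?X \<omega>) ^ 4 / 2 + (norm (Y t \<omega>) + norm (?Z \<omega>)) ^ 4 / 4)
            + norm (Y t \<omega> - ?Z \<omega>) ^ 4 / (4 * l ^ 3)"
        by (rule order_trans[OF inner_square_diff_le weighted_young[OF l]])
      also have "\<dots> \<le> ?R \<omega>"
        using l by (intro add_mono mult_left_mono divide_right_mono power4_add_le) auto
      finally show ?thesis .
    qed
    have iR: "integrable M ?R" using iY iZ ib by simp
    have "?D = (\<integral>\<omega>. (inner (?X \<omega>) (Y t \<omega>))\<^sup>2 - (inner (?X \<omega>) (?Z \<omega>))\<^sup>2 \<partial>M)"
      by (simp add: integral_inner_square_m_coupling[OF m] integrable_inner_square Y m_coupling_Lp(1)[OF m])
    also have "\<bar>\<dots>\<bar> \<le> (\<integral>\<omega>. \<bar>(inner (?X \<omega>) (Y t \<omega>))\<^sup>2 - (inner (?X \<omega>) (?Z \<omega>))\<^sup>2\<bar> \<partial>M)"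
      by (rule integral_abs_bound)
    also have "\<dots> \<le> (\<integral>\<omega>. ?R \<omega> \<partial>M)"
      by (rule integral_mono[OF _ iR pw], rule integrable_abs, rule Bochner_Integration.integrable_diff)
        (intro integrable_inner_square Y m_coupling_Lp(1)[OF m])+
    also have "\<dots> = l * (9 / 2 * moment4) + ?v ^ 4 / (4 * l ^ 3)"
      using iY iZ ib by (simp add: moment4 m_coupling_Lp(2)[OF m] v_norm_4_power4)
    finally show ?thesis .
  qed
  show ?thesis
  proof (cases "?v = 0")
    case False
    \<comment> \<open>With \<open>l = ?v\<close> both terms of \<open>bound\<close> are linear in
      \<open>?v\<close>.\<close>
    then have "0 < ?v" using v0 by simp
    from bound[OF this] have "\<bar>?D\<bar> \<le> ?v * (9 / 2 * moment4) + ?v / 4"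
      using False by (simp add: power3_eq_cube power4_eq_xxxx)
    then show ?thesis by (simp add: algebra_simps)
  next
    case True
    \<comment> \<open>If the coupling error vanishes, \<open>l\<close> is sent to zero instead; the
      \<open>+ 1\<close> keeps the denominator positive.\<close>
    have "\<bar>?D\<bar> \<le> 0 + e" if "0 < e" for e
    proof -
      have "\<bar>?D\<bar> \<le> e / (9 / 2 * moment4 + 1) * (9 / 2 * moment4)"
        using bound[of "e / (9 / 2 * moment4 + 1)"] True moment4_nonneg that by simp
      also have "\<dots> \<le> e"
        using that moment4_nonneg by (simp add: divide_le_eq)
      finally show ?thesis by simp
    qed
    then have "\<bar>?D\<bar> \<le> 0" by (rule field_le_epsilon)
    then show ?thesis using True by simp
  qed
qed

lemma covariance_decay:
  assumes sm: "\<And>t. summable (\<lambda>m. v_norm M 4 (\<lambda>\<omega>. Y t \<omega> - m_coupling f \<epsilon> \<epsilon>' (Suc m) t \<omega>))"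
  shows "\<exists>\<delta>. summable \<delta> \<and> (\<forall>n. 0 \<le> \<delta> n) \<and> (\<forall>s t.
      \<bar>(\<integral>\<omega>. (inner (Y s \<omega>) (Y t \<omega>))\<^sup>2 \<partial>M)
        - (\<integral>\<omega>. \<integral>\<omega>'. (inner (Y s \<omega>) (Y t \<omega>'))\<^sup>2 \<partial>M \<partial>M)\<bar> \<le> \<delta> (nat \<bar>s - t\<bar>))"
proof -
  let ?D = "\<lambda>s t. \<bar>(\<integral>\<omega>. (inner (Y s \<omega>) (Y t \<omega>))\<^sup>2 \<partial>M)
        - (\<integral>\<omega>. \<integral>\<omega>'. (inner (Y s \<omega>) (Y t \<omega>'))\<^sup>2 \<partial>M \<partial>M)\<bar>"
  \<comment> \<open>By \<open>v_norm_shift\<close> the errors at time 0 serve every time. Lag zero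
    has no coupling and gets the trivial bound \<open>moment4\<close>.\<close>
  define \<delta> where "\<delta> n = (if n = 0 then moment4 else
      v_norm M 4 (\<lambda>\<omega>. Y 0 \<omega> - m_coupling f \<epsilon> \<epsilon>' n 0 \<omega>) * (9 / 2 * moment4 + 1 / 4))" for n
  have "summable (\<lambda>n. \<delta> (Suc n))"
    unfolding \<delta>_def using summable_mult2[OF sm] by simp
  then have "summable \<delta>" by (simp add: summable_Suc_iff)
  moreover have "0 \<le> \<delta> n" for n
    using moment4_nonneg by (simp add: \<delta>_def v_norm_def)
  \<comment> \<open>The coupling only looks backwards, so \<open>s > t\<close> is reduced to
    \<open>s < t\<close>.\<close>
  moreover have sym: "?D s t = ?D t s" for s t
  proof -
    have "(\<integral>\<omega>. \<integral>\<omega>'. (inner (Y s \<omega>) (Y t \<omega>'))\<^sup>2 \<partial>M \<partial>M) = (\<integral>\<omega>. \<integral>\<omega>'. (inner (Y t \<omega>) (Y s \<omega>'))\<^sup>2 \<partial>M \<partial>M)"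
      (is "?l = ?r")
    proof -
      have "ennreal ?l = ennreal ?r"
        by (simp only: double_integral_inner_square)
      then show ?thesis by (subst (asm) ennreal_inj) simp_all
    qed
    then show ?thesis by (simp add: inner_commute)
  qed
  have le: "?D s t \<le> \<delta> (nat (t - s))" if "s \<le> t" for s t
  proof (cases "s = t")
    case False
    define m where "m = nat (t - s)"
    have m: "1 \<le> m" "s = t - int m" using that False by (auto simp: m_def)
    then show ?thesis
      using lag_covariance_le[OF m(1), of t] by (simp add: \<delta>_def v_norm_shift[OF m(1), of 0 t])
  next
    case True
    \<comment> \<open>On the diagonal the first integral equals \<open>moment4\<close> and the
      second lies between 0 and \<open>moment4\<close>.\<close>
    have "(inner y y)\<^sup>2 = norm y ^ 4" for y :: 'h
      by (simp flip: power2_norm_eq_inner power_mult)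
    then have "(\<integral>\<omega>. (inner (Y t \<omega>) (Y t \<omega>))\<^sup>2 \<partial>M) = moment4" by (simp add: moment4)
    moreover have "(\<integral>\<omega>. \<integral>\<omega>'. (inner (Y t \<omega>) (Y t \<omega>'))\<^sup>2 \<partial>M \<partial>M) \<le> moment4"
      using double_integral_inner_square_le[OF Y Y, of t t] by (simp add: moment4)
    moreover have "0 \<le> (\<integral>\<omega>. \<integral>\<omega>'. (inner (Y t \<omega>) (Y t \<omega>'))\<^sup>2 \<partial>M \<partial>M)" by simp
    ultimately show ?thesis unfolding True \<delta>_def by simp
  qed
  have "?D s t \<le> \<delta> (nat \<bar>s - t\<bar>)" for s t
  proof (cases "s \<le> t")
    case True
    then have "nat \<bar>s - t\<bar> = nat (t - s)" by simp
    then show ?thesis using le[OF True] by simp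
  next
    case False
    then have "nat \<bar>s - t\<bar> = nat (s - t)" by simp
    then show ?thesis using le[of t s] sym[of s t] False by simp
  qed
  ultimately show ?thesis by blast
qed

end

end

lemma (in prob_space) Lp_m_approximable_covariance_decay:
  fixes Y :: "int \<Rightarrow> 'a \<Rightarrow> 'h::{real_inner, banach, second_countable_topology}"
  assumes "Lp_m_approximable M S 4 Y"
  obtains \<delta> where "summable \<delta>" "\<And>n. 0 \<le> \<delta> n"
    "\<And>s t. \<bar>(\<integral>\<omega>. (inner (Y s \<omega>) (Y t \<omega>))\<^sup>2 \<partial>M)
        - (\<integral>\<omega>. \<integral>\<omega>'. (inner (Y s \<omega>) (Y t \<omega>'))\<^sup>2 \<partial>M \<partial>M)\<bar> \<le> \<delta> (nat \<bar>s - t\<bar>)"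
proof -
  obtain f \<epsilon> \<epsilon>' where f: "f \<in> borel_measurable (PiM UNIV (\<lambda>_. S))"
    and e: "iid_sequence M S \<epsilon>" "independent_copies M S \<epsilon> \<epsilon>'"
    and Y: "\<And>t. in_Lp M 4 (Y t)" "\<And>t. AE \<omega> in M. Y t \<omega> = f (\<lambda>j. \<epsilon> (t - int j) \<omega>)"
    and sm: "\<And>t. summable (\<lambda>m. v_norm M 4 (\<lambda>\<omega>. Y t \<omega> - m_coupling f \<epsilon> \<epsilon>' (Suc m) t \<omega>))"
    using assms unfolding Lp_m_approximable_def by blast
  interpret causal_coupling M S f \<epsilon> \<epsilon>' by unfold_locales fact+
  have "AE \<omega> in M. Y t \<omega> = f (past t \<omega>)" for t
    using Y(2)[of t] by (simp add: past_def[abs_def])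
  from covariance_decay[OF Y(1) this sm] that show ?thesis by blast
qed

section \<open>First-moment bounds\<close>

text \<open>The difference splits as \<open>tensor x (x - y) + tensor (x - y) y\<close>.\<close>

lemma norm_tensor_diff_le: "norm (tensor x x - tensor y y) \<le> norm (x - y) * (norm x + norm y)"
proof (rule norm_blinfun_bound)
  fix z
  have "blinfun_apply (tensor x x - tensor y y) z = inner (x - y) z *\<^sub>R x + inner y z *\<^sub>R (x - y)"
    by (simp add: tensor.rep_eq blinfun.diff_left inner_diff_left algebra_simps)
  also have "norm \<dots> \<le> \<bar>inner (x - y) z\<bar> * norm x + \<bar>inner y z\<bar> * norm (x - y)"
    by (rule norm_triangle_le) simp
  also have "\<dots> \<le> (norm (x - y) * norm z) * norm x + (norm y * norm z) * norm (x - y)"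
    by (intro add_mono mult_right_mono Cauchy_Schwarz_ineq2) auto
  finally show "norm (blinfun_apply (tensor x x - tensor y y) z)
      \<le> norm (x - y) * (norm x + norm y) * norm z"
    by (simp add: algebra_simps)
qed simp

text \<open>\<open>sum_tensor_norm_le\<close> is applied to a signed family on the disjoint sum
  \<open>I <+> I\<close>, with weights \<open>c\<close> on \<open>a\<close> and \<open>- c\<close>
  on \<open>b\<close>; its four blocks give the four terms.\<close>

lemma sum_tensor_diff_norm_le:
  fixes a b :: "'i \<Rightarrow> 'a::real_inner"
  assumes "finite I"
  shows "(norm (\<Sum>t\<in>I. c t *\<^sub>R (tensor (a t) (a t) - tensor (b t) (b t))))\<^sup>2
      \<le> (\<Sum>s\<in>I. \<Sum>t\<in>I. c s * c t *
          ((inner (a s) (a t))\<^sup>2 - (inner (a s) (b t))\<^sup>2 - (inner (a t) (b s))\<^sup>2 + (inner (b s) (b t))\<^sup>2))"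
proof -
  let ?a = "case_sum a b" and ?c = "case_sum c (\<lambda>t. - c t)"
  have "(norm (\<Sum>i\<in>I <+> I. ?c i *\<^sub>R tensor (?a i) (?a i)))\<^sup>2
      \<le> (\<Sum>i\<in>I <+> I. \<Sum>j\<in>I <+> I. ?c i * ?c j * (inner (?a i) (?a j))\<^sup>2)"
    using assms by (intro sum_tensor_norm_le) auto
  moreover have "(\<Sum>i\<in>I <+> I. ?c i *\<^sub>R tensor (?a i) (?a i))
      = (\<Sum>t\<in>I. c t *\<^sub>R (tensor (a t) (a t) - tensor (b t) (b t)))"
    using assms by (simp add: sum.Plus scaleR_diff_right sum_subtractf sum_negf)
  moreover have "(\<Sum>i\<in>I <+> I. \<Sum>j\<in>I <+> I. ?c i * ?c j * (inner (?a i) (?a j))\<^sup>2)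
      = (\<Sum>s\<in>I. \<Sum>t\<in>I. c s * c t *
          ((inner (a s) (a t))\<^sup>2 - (inner (a s) (b t))\<^sup>2 - (inner (a t) (b s))\<^sup>2 + (inner (b s) (b t))\<^sup>2))"
    using assms
    by (simp add: sum.Plus sum_negf sum.distrib sum_subtractf inner_commute[of "b _" "a _"] algebra_simps)
  ultimately show ?thesis by simp
qed

context prob_space
begin

lemma in_Lp_4_imp_2:
  assumes "in_Lp M 4 X"
  shows "in_Lp M 2 X"
  unfolding in_Lp_def
proof
  show [measurable]: "X \<in> borel_measurable M" using assms by (simp add: in_Lp_def)
  show "integrable M (\<lambda>\<omega>. norm (X \<omega>) powr 2)"
  proof (rule Bochner_Integration.integrable_bound)
    show "integrable M (\<lambda>\<omega>. 1 + norm (X \<omega>) ^ 4)"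
      using assms by (simp add: in_Lp_4_iff)
    have "x\<^sup>2 \<le> 1 + x ^ 4" for x :: real
    proof -
      have "2 * x\<^sup>2 \<le> 1 + x ^ 4"
        using sum_squares_bound[of "x\<^sup>2" 1] by (simp flip: power_mult)
      then show ?thesis using zero_le_power2[of x] by linarith
    qed
    then show "AE \<omega> in M. norm (norm (X \<omega>) powr 2) \<le> norm (1 + norm (X \<omega>) ^ 4)"
      by (intro AE_I2) simp
  qed measurable
qed

lemma integrable_inner_scaleR:
  fixes X :: "'a \<Rightarrow> 'h::{real_inner, banach, second_countable_topology}"
  assumes X: "in_Lp M 2 X"
  shows "integrable M (\<lambda>\<omega>. inner (X \<omega>) x *\<^sub>R X \<omega>)"
proof (rule Bochner_Integration.integrable_bound)
  have [measurable]: "X \<in> borel_measurable M" using X by (simp add: in_Lp_def)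
  show "integrable M (\<lambda>\<omega>. (norm (X \<omega>))\<^sup>2 * norm x)"
    using X by (simp add: in_Lp_def)
  show "(\<lambda>\<omega>. inner (X \<omega>) x *\<^sub>R X \<omega>) \<in> borel_measurable M" by measurable
  have "norm (inner y x *\<^sub>R y) \<le> norm ((norm y)\<^sup>2 * norm x)" for y :: 'h
    using mult_right_mono[OF Cauchy_Schwarz_ineq2[of y x], of "norm y"]
    by (simp add: power2_eq_square mult_ac)
  then show "AE \<omega> in M. norm (inner (X \<omega>) x *\<^sub>R X \<omega>) \<le> norm ((norm (X \<omega>))\<^sup>2 * norm x)"
    by (intro AE_I2)
qed

lemma cov_op_cong_distr:
  fixes X Z :: "'a \<Rightarrow> 'h::{real_inner, banach, second_countable_topology}"
  assumes X: "in_Lp M 2 X" and Z: "in_Lp M 2 Z" and eq: "distr M borel X = distr M borel Z"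
  shows "cov_op M X = cov_op M Z"
proof (rule blinfun_eqI)
  fix x
  have [measurable]: "X \<in> borel_measurable M" "Z \<in> borel_measurable M"
    using X Z by (auto simp: in_Lp_def)
  have "(\<integral>\<omega>. inner (X \<omega>) x *\<^sub>R X \<omega> \<partial>M) = (\<integral>\<omega>. inner (Z \<omega>) x *\<^sub>R Z \<omega> \<partial>M)"
    using arg_cong[OF eq, of "\<lambda>N. integral\<^sup>L N (\<lambda>y. inner y x *\<^sub>R y)"]
    by (simp add: integral_distr)
  then show "blinfun_apply (cov_op M X) x = blinfun_apply (cov_op M Z) x"
    by (simp add: cov_op_apply X Z)
qed

text \<open>Symmetrization: the centred sum is the average over \<open>\<omega>'\<close> of the same sum with the
  expectations replaced by the values at an independent point \<open>\<omega>'\<close>, which has finite rank. The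
  square root in the Hilbert-Schmidt norm is avoided by \<open>x \<le> (x\<^sup>2 / \<eta> + \<eta>) / 2\<close>.\<close>

lemma centred_tensor_sum_majorant:
  fixes Y :: "'i \<Rightarrow> 'a \<Rightarrow> 'h::{real_inner, banach, second_countable_topology}"
  assumes Y: "\<And>t. in_Lp M 4 (Y t)" and I: "finite I" and \<eta>: "0 < \<eta>"
  obtains Z where "integrable M Z"
    "\<And>\<omega>. norm (\<Sum>t\<in>I. w t *\<^sub>R (tensor (Y t \<omega>) (Y t \<omega>) - cov_op M (Y t))) \<le> Z \<omega>"
    "(\<integral>\<omega>. Z \<omega> \<partial>M) \<le> ((\<Sum>s\<in>I. \<Sum>t\<in>I. 2 * (\<bar>w s\<bar> * \<bar>w t\<bar> *
        \<bar>(\<integral>\<omega>. (inner (Y s \<omega>) (Y t \<omega>))\<^sup>2 \<partial>M)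
          - (\<integral>\<omega>. \<integral>\<omega>'. (inner (Y s \<omega>) (Y t \<omega>'))\<^sup>2 \<partial>M \<partial>M)\<bar>)) / \<eta> + \<eta>) / 2"
proof
  define e where "e s t = (\<integral>\<omega>. (inner (Y s \<omega>) (Y t \<omega>))\<^sup>2 \<partial>M)" for s t
  define g where "g s t \<omega> = (\<integral>\<omega>'. (inner (Y s \<omega>) (Y t \<omega>'))\<^sup>2 \<partial>M)" for s t \<omega>
  define \<kappa> where "\<kappa> s t = (\<integral>\<omega>. g s t \<omega> \<partial>M)" for s t
  \<comment> \<open>\<open>Q\<close> is the Hilbert-Schmidt bound for the two-sample sum
    \<open>B\<close>, and \<open>R\<close> its average over \<open>\<omega>'\<close>. Averaging
    \<open>B\<close> vector by vector gives \<open>A\<close>, matching the strong sense in which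
    \<open>cov_op\<close> is defined.\<close>
  define Q where "Q \<omega> \<omega>' = (\<Sum>s\<in>I. \<Sum>t\<in>I. w s * w t * ((inner (Y s \<omega>) (Y t \<omega>))\<^sup>2
      - (inner (Y s \<omega>) (Y t \<omega>'))\<^sup>2 - (inner (Y t \<omega>) (Y s \<omega>'))\<^sup>2 + (inner (Y s \<omega>') (Y t \<omega>'))\<^sup>2))" for \<omega> \<omega>'
  define R where "R \<omega> = (\<Sum>s\<in>I. \<Sum>t\<in>I. w s * w t * ((inner (Y s \<omega>) (Y t \<omega>))\<^sup>2
      - g s t \<omega> - g t s \<omega> + e s t))" for \<omega>
  define B where "B \<omega> \<omega>' = (\<Sum>t\<in>I. w t *\<^sub>R (tensor (Y t \<omega>) (Y t \<omega>) - tensor (Y t \<omega>') (Y t \<omega>')))" for \<omega> \<omega>'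
  define A where "A \<omega> = (\<Sum>t\<in>I. w t *\<^sub>R (tensor (Y t \<omega>) (Y t \<omega>) - cov_op M (Y t)))" for \<omega>
  have ist: "integrable M (\<lambda>\<omega>. (inner (Y s \<omega>) (Y t \<omega>))\<^sup>2)" for s t
    by (intro integrable_inner_square Y)
  have ix: "integrable M (\<lambda>\<omega>'. (inner x (Y t \<omega>'))\<^sup>2)" for x t
    by (intro integrable_inner_square Y in_Lp_const)
  have ig: "integrable M (g s t)" for s t
    unfolding g_def[abs_def] by (intro integrable_integral_inner_square Y)
  have iQ: "integrable M (Q \<omega>)" for \<omega>
    unfolding Q_def[abs_def] using ist ix by simp
  have RQ: "(\<integral>\<omega>'. Q \<omega> \<omega>' \<partial>M) = R \<omega>" for \<omega>
    unfolding Q_def R_def using ist ix by (simp add: g_def e_def prob_space)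
  have iR: "integrable M R"
    unfolding R_def[abs_def] using ist ig by simp
  have BQ: "(norm (B \<omega> \<omega>'))\<^sup>2 \<le> Q \<omega> \<omega>'" for \<omega> \<omega>'
    unfolding B_def Q_def by (rule sum_tensor_diff_norm_le[OF I])
  then have "0 \<le> Q \<omega> \<omega>'" for \<omega> \<omega>'
    by (rule order_trans[OF zero_le_power2])
  then have R0: "0 \<le> R \<omega>" for \<omega>
    by (simp flip: RQ)
  have Bn: "norm (B \<omega> \<omega>') \<le> (Q \<omega> \<omega>' / \<eta> + \<eta>) / 2" for \<omega> \<omega>'
  proof -
    have "2 * norm (B \<omega> \<omega>') * \<eta> \<le> Q \<omega> \<omega>' + \<eta> * \<eta>"
      using sum_squares_bound[of "norm (B \<omega> \<omega>')" \<eta>] BQ[of \<omega> \<omega>'] by (simp add: power2_eq_square)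
    then show ?thesis using \<eta> by (simp add: field_simps)
  qed
  have iy: "integrable M (\<lambda>\<omega>'. inner (Y t \<omega>') x *\<^sub>R Y t \<omega>')" for t x
    by (intro integrable_inner_scaleR in_Lp_4_imp_2 Y)
  have Bx: "blinfun_apply (B \<omega> \<omega>') x
      = (\<Sum>t\<in>I. w t *\<^sub>R (inner (Y t \<omega>) x *\<^sub>R Y t \<omega> - inner (Y t \<omega>') x *\<^sub>R Y t \<omega>'))" for \<omega> \<omega>' x
    by (simp add: B_def blinfun.sum_left blinfun.scaleR_left blinfun.diff_left tensor.rep_eq)
  have iB: "integrable M (\<lambda>\<omega>'. blinfun_apply (B \<omega> \<omega>') x)" for \<omega> x
    unfolding Bx using iy by simp
  have AB: "blinfun_apply (A \<omega>) x = (\<integral>\<omega>'. blinfun_apply (B \<omega> \<omega>') x \<partial>M)" for \<omega> x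
    unfolding Bx using iy
    by (simp add: A_def blinfun.sum_left blinfun.scaleR_left blinfun.diff_left tensor.rep_eq
        cov_op_apply in_Lp_4_imp_2 Y prob_space)
  show "integrable M (\<lambda>\<omega>. (R \<omega> / \<eta> + \<eta>) / 2)"
    using iR by simp
  show "norm (\<Sum>t\<in>I. w t *\<^sub>R (tensor (Y t \<omega>) (Y t \<omega>) - cov_op M (Y t))) \<le> (R \<omega> / \<eta> + \<eta>) / 2" for \<omega>
    unfolding A_def[symmetric]
  proof (rule norm_blinfun_bound)
    show "0 \<le> (R \<omega> / \<eta> + \<eta>) / 2" using R0[of \<omega>] \<eta> by simp
    fix x
    have "norm (blinfun_apply (A \<omega>) x) \<le> (\<integral>\<omega>'. norm (blinfun_apply (B \<omega> \<omega>') x) \<partial>M)"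
      unfolding AB by (rule integral_norm_bound)
    also have "\<dots> \<le> (\<integral>\<omega>'. (Q \<omega> \<omega>' / \<eta> + \<eta>) / 2 * norm x \<partial>M)"
    proof (rule integral_mono)
      show "integrable M (\<lambda>\<omega>'. norm (blinfun_apply (B \<omega> \<omega>') x))" using iB by simp
      show "integrable M (\<lambda>\<omega>'. (Q \<omega> \<omega>' / \<eta> + \<eta>) / 2 * norm x)" using iQ by simp
      fix \<omega>'
      show "norm (blinfun_apply (B \<omega> \<omega>') x) \<le> (Q \<omega> \<omega>' / \<eta> + \<eta>) / 2 * norm x"
        by (rule order_trans[OF norm_blinfun mult_right_mono[OF Bn norm_ge_zero]])
    qed
    also have "\<dots> = (R \<omega> / \<eta> + \<eta>) / 2 * norm x"
      using iQ by (simp add: RQ prob_space)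
    finally show "norm (blinfun_apply (A \<omega>) x) \<le> (R \<omega> / \<eta> + \<eta>) / 2 * norm x" .
  qed
  \<comment> \<open>In the mean the four terms of \<open>R\<close> form two pairs; exchanging the
    summation indices makes the pairs equal, hence the factor 2.\<close>
  have "(\<integral>\<omega>. R \<omega> \<partial>M) = (\<Sum>s\<in>I. \<Sum>t\<in>I. w s * w t * (e s t - \<kappa> s t))
      + (\<Sum>s\<in>I. \<Sum>t\<in>I. w s * w t * (e s t - \<kappa> t s))"
    unfolding R_def using ist ig
    by (simp add: \<kappa>_def e_def prob_space algebra_simps flip: sum.distrib)
  also have "(\<Sum>s\<in>I. \<Sum>t\<in>I. w s * w t * (e s t - \<kappa> t s)) = (\<Sum>s\<in>I. \<Sum>t\<in>I. w s * w t * (e s t - \<kappa> s t))"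
    by (subst sum.swap) (simp add: e_def inner_commute mult_ac)
  also have "(\<Sum>s\<in>I. \<Sum>t\<in>I. w s * w t * (e s t - \<kappa> s t)) + (\<Sum>s\<in>I. \<Sum>t\<in>I. w s * w t * (e s t - \<kappa> s t))
      = (\<Sum>s\<in>I. \<Sum>t\<in>I. 2 * (w s * w t * (e s t - \<kappa> s t)))"
    by (simp add: mult.assoc flip: sum.distrib)
  also have "\<dots> \<le> (\<Sum>s\<in>I. \<Sum>t\<in>I. 2 * (\<bar>w s\<bar> * \<bar>w t\<bar> * \<bar>e s t - \<kappa> s t\<bar>))"
    by (intro sum_mono mult_left_mono) (auto simp flip: abs_mult)
  finally have "(\<integral>\<omega>. R \<omega> \<partial>M) \<le> (\<Sum>s\<in>I. \<Sum>t\<in>I. 2 * (\<bar>w s\<bar> * \<bar>w t\<bar> * \<bar>e s t - \<kappa> s t\<bar>))" .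
  then have "((\<integral>\<omega>. R \<omega> \<partial>M) / \<eta> + \<eta>) / 2
      \<le> ((\<Sum>s\<in>I. \<Sum>t\<in>I. 2 * (\<bar>w s\<bar> * \<bar>w t\<bar> * \<bar>e s t - \<kappa> s t\<bar>)) / \<eta> + \<eta>) / 2"
    using \<eta> by (intro divide_right_mono add_right_mono) auto
  then show "(\<integral>\<omega>. (R \<omega> / \<eta> + \<eta>) / 2 \<partial>M) \<le> ((\<Sum>s\<in>I. \<Sum>t\<in>I. 2 * (\<bar>w s\<bar> * \<bar>w t\<bar> *
        \<bar>(\<integral>\<omega>. (inner (Y s \<omega>) (Y t \<omega>))\<^sup>2 \<partial>M)
          - (\<integral>\<omega>. \<integral>\<omega>'. (inner (Y s \<omega>) (Y t \<omega>'))\<^sup>2 \<partial>M \<partial>M)\<bar>)) / \<eta> + \<eta>) / 2"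
    using iR by (simp add: e_def \<kappa>_def g_def prob_space)
qed

text \<open>The one-point index set \<open>{0}\<close> is taken in
  \<open>strictly_stationary\<close>, followed by projection to its only coordinate.\<close>

lemma strictly_stationary_distr:
  fixes Y :: "int \<Rightarrow> 'a \<Rightarrow> 'h::topological_space"
  assumes "strictly_stationary M Y" and Y[measurable]: "\<And>t. Y t \<in> borel_measurable M"
  shows "distr M borel (Y s) = distr M borel (Y 0)"
proof -
  let ?P = "PiM {0::int} (\<lambda>_. borel :: 'h measure)"
  have m: "(\<lambda>\<omega>. \<lambda>i\<in>{0}. Y (i + s) \<omega>) \<in> M \<rightarrow>\<^sub>M ?P" for s
    by (intro measurable_restrict) simp
  have proj: "(\<lambda>x. x 0) \<in> ?P \<rightarrow>\<^sub>M borel"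
    by (rule measurable_component_singleton) simp
  have law: "distr (distr M ?P (\<lambda>\<omega>. \<lambda>i\<in>{0}. Y (i + s) \<omega>)) borel (\<lambda>x. x 0) = distr M borel (Y s)" for s
    by (subst distr_distr[OF proj m]) (simp add: comp_def)
  have "distr M ?P (\<lambda>\<omega>. \<lambda>i\<in>{0}. Y (i + s) \<omega>) = distr M ?P (\<lambda>\<omega>. \<lambda>i\<in>{0}. Y i \<omega>)"
    using assms(1) unfolding strictly_stationary_def by blast
  then show ?thesis
    using law[of s] law[of 0] by simp
qed

text \<open>Markov's inequality for the majorant: a mean of order \<open>a T\<close> gives
  stochastic order \<open>a T\<close>.\<close>

lemma big_OP_majorantI:
  assumes meas: "\<And>T. Y T \<in> borel_measurable M" and G: "0 \<le> G"
    and maj: "\<forall>\<^sub>F T in sequentially. 0 < a T \<and> (\<exists>Z. integrable M Z \<and> (AE \<omega> in M. \<bar>Y T \<omega>\<bar> \<le> Z \<omega>)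
      \<and> (\<integral>\<omega>. Z \<omega> \<partial>M) \<le> G * a T)"
  shows "big_OP M Y a"
  unfolding big_OP_def
proof (intro conjI allI impI meas)
  fix e :: real assume e: "0 < e"
  \<comment> \<open>Markov's bound is \<open>G / B\<close>; the \<open>+ 1\<close> keeps
    \<open>B\<close> positive when \<open>G = 0\<close>.\<close>
  define B where "B = (G + 1) / e"
  have B: "0 < B" "G / B \<le> e" using G e by (auto simp: B_def field_simps)
  show "\<exists>B>0. \<forall>\<^sub>F T in sequentially. measure M {\<omega> \<in> space M. B * a T < \<bar>Y T \<omega>\<bar>} \<le> e"
  proof (intro exI[of _ B] conjI B(1), rule eventually_mono[OF maj], elim conjE exE)
    fix T Z assume a: "0 < a T" and Z: "integrable M Z" "AE \<omega> in M. \<bar>Y T \<omega>\<bar> \<le> Z \<omega>" "(\<integral>\<omega>. Z \<omega> \<partial>M) \<le> G * a T"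
    have [measurable]: "Z \<in> borel_measurable M" "Y T \<in> borel_measurable M"
      using Z meas by auto
    have "measure M {\<omega> \<in> space M. B * a T < \<bar>Y T \<omega>\<bar>} \<le> measure M {\<omega> \<in> space M. B * a T \<le> Z \<omega>}"
      by (rule finite_measure_mono_AE) (use Z(2) in auto)
    also have "\<dots> \<le> (\<integral>\<omega>. Z \<omega> \<partial>M) / (B * a T)"
      using a B Z(2) by (intro integral_Markov_inequality_measure[OF Z(1)]) auto
    also have "\<dots> \<le> G * a T / (B * a T)"
      using Z(3) a B by (intro divide_right_mono) auto
    also have "\<dots> \<le> e" using a B by simp
    finally show "measure M {\<omega> \<in> space M. B * a T < \<bar>Y T \<omega>\<bar>} \<le> e" .
  qed
qed

end

text \<open>Every lag occurs at most once on either side of \<open>s\<close>.\<close>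

lemma sum_abs_diff_le:
  fixes \<delta> :: "nat \<Rightarrow> real" and A :: "nat set"
  assumes \<delta>: "summable \<delta>" "\<And>n. 0 \<le> \<delta> n" and A: "finite A"
  shows "(\<Sum>t\<in>A. \<delta> (nat \<bar>int s - int t\<bar>)) \<le> 2 * suminf \<delta>"
proof -
  have part: "(\<Sum>t\<in>B. \<delta> (nat \<bar>int s - int t\<bar>)) \<le> suminf \<delta>"
    if "finite B" "inj_on (\<lambda>t. nat \<bar>int s - int t\<bar>) B" for B
  proof -
    have "(\<Sum>t\<in>B. \<delta> (nat \<bar>int s - int t\<bar>)) = sum \<delta> ((\<lambda>t. nat \<bar>int s - int t\<bar>) ` B)"
      using that by (simp add: sum.reindex)
    also have "\<dots> \<le> suminf \<delta>" using that \<delta> by (intro sum_le_suminf) auto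
    finally show ?thesis .
  qed
  have "(\<Sum>t\<in>A. \<delta> (nat \<bar>int s - int t\<bar>))
      = (\<Sum>t\<in>{t\<in>A. t \<le> s}. \<delta> (nat \<bar>int s - int t\<bar>)) + (\<Sum>t\<in>{t\<in>A. s < t}. \<delta> (nat \<bar>int s - int t\<bar>))"
    using A by (subst sum.union_disjoint[symmetric]) (auto intro!: sum.cong)
  also have "\<dots> \<le> suminf \<delta> + suminf \<delta>"
    using A by (intro add_mono part) (auto simp: inj_on_def)
  finally show ?thesis by simp
qed

text \<open>\<open>norm_tensor_diff_le\<close> leads to a term linear and a term quadratic in
  \<open>q * U\<close>. Since \<open>2 \<le> \<rho>\<close>, the square of \<open>U\<close> is at
  most \<open>1 + U powr \<rho>\<close>. The mean is linear in \<open>q\<close> up to a factor that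
  is bounded for bounded \<open>q\<close>.\<close>

lemma (in prob_space) tensor_perturbation_majorant:
  fixes X Y :: "'a \<Rightarrow> 'h::{real_inner, banach, second_countable_topology}"
  assumes Y: "in_Lp M 2 Y"
    and U: "AE \<omega> in M. 0 < U \<omega>" "integrable M (\<lambda>\<omega>. U \<omega> powr \<rho>)" "(\<integral>\<omega>. U \<omega> powr \<rho> \<partial>M) < C"
    and \<rho>: "2 \<le> \<rho>" and q: "0 \<le> q"
    and le: "AE \<omega> in M. norm (X \<omega> - Y \<omega>) \<le> q * U \<omega>"
  obtains V where "integrable M V"
    "AE \<omega> in M. norm (tensor (X \<omega>) (X \<omega>) - tensor (Y \<omega>) (Y \<omega>)) \<le> V \<omega>"
    "(\<integral>\<omega>. V \<omega> \<partial>M) \<le> q * ((1 + q) * (1 + C) + (\<integral>\<omega>. (norm (Y \<omega>))\<^sup>2 \<partial>M))"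
proof
  let ?V = "\<lambda>\<omega>. q * ((1 + q) * (1 + U \<omega> powr \<rho>) + (norm (Y \<omega>))\<^sup>2)"
  have iY: "integrable M (\<lambda>\<omega>. (norm (Y \<omega>))\<^sup>2)" using Y by (simp add: in_Lp_def)
  show "integrable M ?V" using U(2) iY by simp
  show "AE \<omega> in M. norm (tensor (X \<omega>) (X \<omega>) - tensor (Y \<omega>) (Y \<omega>)) \<le> ?V \<omega>"
    using le U(1)
  proof eventually_elim
    fix \<omega> assume d: "norm (X \<omega> - Y \<omega>) \<le> q * U \<omega>" and u: "0 < U \<omega>"
    have U2: "(U \<omega>)\<^sup>2 \<le> 1 + U \<omega> powr \<rho>"
    proof (cases "U \<omega> \<le> 1")
      case True
      then have "(U \<omega>)\<^sup>2 \<le> 1" using u by (simp add: power_le_one)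
      moreover have "0 \<le> U \<omega> powr \<rho>" by simp
      ultimately show ?thesis by linarith
    next
      case False
      then have "U \<omega> powr 2 \<le> U \<omega> powr \<rho>" using \<rho> by (intro powr_mono) auto
      then show ?thesis using u by simp
    qed
    have "norm (X \<omega>) \<le> norm (Y \<omega>) + q * U \<omega>"
      using norm_triangle_ineq2[of "X \<omega>" "Y \<omega>"] d by linarith
    then have "norm (X \<omega> - Y \<omega>) * (norm (X \<omega>) + norm (Y \<omega>))
        \<le> (q * U \<omega>) * (2 * norm (Y \<omega>) + q * U \<omega>)"
      using d q u by (intro mult_mono) auto
    also have "\<dots> = q * (2 * U \<omega> * norm (Y \<omega>) + q * (U \<omega>)\<^sup>2)"
      by (simp add: algebra_simps power2_eq_square)
    also have "\<dots> \<le> q * (((U \<omega>)\<^sup>2 + (norm (Y \<omega>))\<^sup>2) + q * (U \<omega>)\<^sup>2)"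
      by (intro mult_left_mono add_right_mono sum_squares_bound q)
    also have "\<dots> = q * ((1 + q) * (U \<omega>)\<^sup>2 + (norm (Y \<omega>))\<^sup>2)"
      by (simp add: algebra_simps)
    also have "\<dots> \<le> ?V \<omega>"
      using q U2 by (intro mult_left_mono add_right_mono) auto
    finally show "norm (tensor (X \<omega>) (X \<omega>) - tensor (Y \<omega>) (Y \<omega>)) \<le> ?V \<omega>"
      using norm_tensor_diff_le[of "X \<omega>" "Y \<omega>"] by linarith
  qed
  have "(\<integral>\<omega>. ?V \<omega> \<partial>M) = q * ((1 + q) * (1 + (\<integral>\<omega>. U \<omega> powr \<rho> \<partial>M)) + (\<integral>\<omega>. (norm (Y \<omega>))\<^sup>2 \<partial>M))"
    using U(2) iY by (simp add: prob_space)
  also have "\<dots> \<le> q * ((1 + q) * (1 + C) + (\<integral>\<omega>. (norm (Y \<omega>))\<^sup>2 \<partial>M))"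
    using q U(3) by (intro mult_left_mono add_right_mono) auto
  finally show "(\<integral>\<omega>. ?V \<omega> \<partial>M) \<le> q * ((1 + q) * (1 + C) + (\<integral>\<omega>. (norm (Y \<omega>))\<^sup>2 \<partial>M))" .
qed

text \<open>Here \<open>a\<close> is the target rate and \<open>n\<close> bounds the number of
  indices in the kernel window. The last three bounds serve the Riemann error, the replacement of
  \<open>X\<close> and the fluctuation. As \<open>h \<le> 1\<close>, both
  \<open>1 / (real T * h)\<close> and \<open>1 / real T\<close> are at most the last term of
  \<open>a\<close>, while the square root accounts for
  \<open>1 / (real T * h) \<le> a\<^sup>2\<close>.\<close>

lemma rate_bounds:
  fixes h :: real and T :: nat and c :: real
  assumes h: "0 < h" "h \<le> 1" and T: "1 \<le> T" and c: "0 \<le> c"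
  defines "a \<equiv> h + sqrt (1 / (real T * h)) + 1 / (real T * h\<^sup>2)"
  defines "n \<equiv> 2 * c * h * real T + 1"
  shows "0 < a" "1 / (real T * h\<^sup>2) \<le> a"
    "n / (real T * h) * (c * h + 1 / real T) \<le> (2 * c\<^sup>2 + 3 * c + 1) * a"
    "n / (real T * h)\<^sup>2 \<le> (2 * c + 1) * a\<^sup>2"
proof -
  define \<tau> where "\<tau> = 1 / (real T * h\<^sup>2)"
  have T0: "0 < real T" using T by simp
  have \<tau>0: "0 \<le> \<tau>" by (simp add: \<tau>_def)
  have Th: "1 / (real T * h) \<le> \<tau>"
    unfolding \<tau>_def using h T0 by (intro divide_left_mono) (auto simp: power2_eq_square)
  have T1: "1 / real T \<le> \<tau>"
    unfolding \<tau>_def using h T0 by (intro divide_left_mono) (auto simp: power_le_one)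
  have a: "a = h + sqrt (1 / (real T * h)) + \<tau>" by (simp add: a_def \<tau>_def)
  show a0: "0 < a" using h \<tau>0 by (simp add: a add_pos_nonneg)
  have \<tau>a: "\<tau> \<le> a" and ha: "h \<le> a" and sa: "sqrt (1 / (real T * h)) \<le> a"
    using h \<tau>0 T0 by (auto simp: a)
  then show "1 / (real T * h\<^sup>2) \<le> a" by (simp add: \<tau>_def)
  have n: "n / (real T * h) = 2 * c + 1 / (real T * h)"
    using h T0 by (simp add: n_def field_simps)
  have "n / (real T * h) * (c * h + 1 / real T)
      = 2 * c\<^sup>2 * h + 3 * c * (1 / real T) + 1 / (real T * h) * (1 / real T)"
    unfolding n using h T0 by (simp add: field_simps power2_eq_square)
  also have "\<dots> \<le> 2 * c\<^sup>2 * a + 3 * c * a + a"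
  proof (intro add_mono mult_left_mono)
    have "1 / (real T * h) * (1 / real T) \<le> 1 / (real T * h) * 1"
      using h T by (intro mult_left_mono) auto
    then show "1 / (real T * h) * (1 / real T) \<le> a" using Th \<tau>a by simp
  qed (use c ha T1 \<tau>a in auto)
  finally show "n / (real T * h) * (c * h + 1 / real T) \<le> (2 * c\<^sup>2 + 3 * c + 1) * a"
    by (simp add: algebra_simps)
  have Th2: "1 / (real T * h) \<le> a\<^sup>2"
    using power_mono[OF sa, of 2] h T0 by simp
  have "(1 / (real T * h))\<^sup>2 \<le> a\<^sup>2"
    using Th \<tau>a h T0 by (intro power_mono) auto
  then have "2 * c * (1 / (real T * h)) + (1 / (real T * h))\<^sup>2 \<le> 2 * c * a\<^sup>2 + a\<^sup>2"
    using Th2 c by (intro add_mono mult_left_mono) auto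
  moreover have "n / (real T * h)\<^sup>2 = 2 * c * (1 / (real T * h)) + (1 / (real T * h))\<^sup>2"
    using h T0 by (simp add: n_def field_simps power2_eq_square)
  ultimately show "n / (real T * h)\<^sup>2 \<le> (2 * c + 1) * a\<^sup>2"
    by (simp add: algebra_simps)
qed

section \<open>Combination of the three error bounds\<close>

theorem theorem3p1:
  fixes M :: "'w measure" and S :: "'s measure"
    and X :: "nat \<Rightarrow> nat \<Rightarrow> 'w \<Rightarrow> ('d::finite) l2_cube"
    and Xs :: "real \<Rightarrow> int \<Rightarrow> 'w \<Rightarrow> 'd l2_cube"
    and K :: "real \<Rightarrow> real" and h :: "nat \<Rightarrow> real"
    and \<rho> C1 u :: real and t :: int
  assumes "prob_space M"
    and "\<rho> \<ge> 2"
    and "locally_stationary M 4 \<rho> X Xs"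
    and "\<And>v. v \<in> {0..1} \<Longrightarrow> Lp_m_approximable M S 4 (Xs v)"
    and "\<And>v s. v \<in> {0..1} \<Longrightarrow> (\<integral>\<omega>. Xs v s \<omega> \<partial>M) = 0"
    and "\<And>x. K (- x) = K x"
    and "bounded (range K)"
    and "\<exists>L. L-lipschitz_on UNIV K"
    and "\<And>x. \<bar>x\<bar> > C1 \<Longrightarrow> K x = 0"
    and "(\<integral>z. K z \<partial>lborel) = 1"
    and "\<And>T. T \<ge> 1 \<Longrightarrow> h T > 0"
    and "h \<longlonglongrightarrow> 0"
    and "0 < u" and "u < 1"
  shows "big_OP M
    (\<lambda>T \<omega>. norm (cov_estimator K (h T) X T u \<omega> - cov_op M (Xs u t)))
    (\<lambda>T. h T + sqrt (1 / (real T * h T)) + 1 / (real T * (h T)\<^sup>2))"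
proof -
  interpret prob_space M by fact
  have u: "u \<in> {0..1}" using \<open>0 < u\<close> \<open>u < 1\<close> by simp
  note ls = assms(3)[unfolded locally_stationary_def]
  have X4: "in_Lp M 4 (X s T)" if "T \<ge> 1" "s \<in> {1..T}" for s T
    using conjunct1[OF ls] that by simp
  obtain Cu where at_u: "(\<forall>s. in_Lp M 4 (Xs u s)) \<and> strictly_stationary M (Xs u) \<and>
      (\<exists>U. \<forall>T\<ge>1. \<forall>s\<in>{1..T}.
        U s T \<in> borel_measurable M \<and> (AE \<omega> in M. 0 < U s T \<omega>) \<and>
        integrable M (\<lambda>\<omega>. U s T \<omega> powr \<rho>) \<and> (\<integral>\<omega>. U s T \<omega> powr \<rho> \<partial>M) < Cu \<and>
        (AE \<omega> in M. norm (X s T \<omega> - Xs u (int s) \<omega>) \<le>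
          (\<bar>real s / real T - u\<bar> + 1 / real T) * U s T \<omega>))"
    using conjunct2[OF ls] by (elim exE) (drule bspec[OF _ u], erule that)
  have Y4: "\<And>s. in_Lp M 4 (Xs u s)" and stat: "strictly_stationary M (Xs u)"
    using at_u by simp_all
  obtain U where U_all: "\<forall>T\<ge>1. \<forall>s\<in>{1..T}.
        U s T \<in> borel_measurable M \<and> (AE \<omega> in M. 0 < U s T \<omega>) \<and>
        integrable M (\<lambda>\<omega>. U s T \<omega> powr \<rho>) \<and> (\<integral>\<omega>. U s T \<omega> powr \<rho> \<partial>M) < Cu \<and>
        (AE \<omega> in M. norm (X s T \<omega> - Xs u (int s) \<omega>) \<le>
          (\<bar>real s / real T - u\<bar> + 1 / real T) * U s T \<omega>)"
    using conjunct2[OF conjunct2[OF at_u]] by (elim exE) (erule that)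
  note U = conjunct2[OF U_all[rule_format]]
  define Y where "Y s = Xs u (int s)" for s :: nat
  note Y4' = Y4[of "int s" for s, folded Y_def]
  have Cu: "0 \<le> Cu"
  proof -
    have "(\<integral>\<omega>. U 1 1 \<omega> powr \<rho> \<partial>M) < Cu" using U[of 1 1] by simp
    moreover have "0 \<le> (\<integral>\<omega>. U 1 1 \<omega> powr \<rho> \<partial>M)" by simp
    ultimately show ?thesis by linarith
  qed
  have Ym[measurable]: "Xs u s \<in> borel_measurable M" for s
    using Y4 by (simp add: in_Lp_def)
  have Xm: "X s T \<in> borel_measurable M" if "s \<in> {1..T}" for s T
    using X4[of T s] that by (auto simp: in_Lp_def)
  \<comment> \<open>By stationarity the covariance at the arbitrary time \<open>t\<close> of the
    conclusion is that of every \<open>Y s\<close>.\<close>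
  have law: "distr M borel (Xs u s) = distr M borel (Xs u t)" for s
    using strictly_stationary_distr[OF stat Ym, of s] strictly_stationary_distr[OF stat Ym, of t] by simp
  define C where "C = cov_op M (Xs u t)"
  have covY: "cov_op M (Y s) = C" for s
    unfolding C_def Y_def by (intro cov_op_cong_distr in_Lp_4_imp_2 Y4 law)
  define m2 where "m2 = (\<integral>\<omega>. (norm (Xs u t \<omega>))\<^sup>2 \<partial>M)"
  have m2: "(\<integral>\<omega>. (norm (Y s \<omega>))\<^sup>2 \<partial>M) = m2" for s
    using arg_cong[OF law[of "int s"], of "\<lambda>N. integral\<^sup>L N (\<lambda>x. (norm x)\<^sup>2)"]
    by (simp add: integral_distr m2_def Y_def)
  have m2_nonneg: "0 \<le> m2" by (simp add: m2_def)
  obtain \<delta> where \<delta>: "summable \<delta>" "\<And>n. 0 \<le> \<delta> n"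
    and dep: "\<And>s r. \<bar>(\<integral>\<omega>. (inner (Xs u s \<omega>) (Xs u r \<omega>))\<^sup>2 \<partial>M)
        - (\<integral>\<omega>. \<integral>\<omega>'. (inner (Xs u s \<omega>) (Xs u r \<omega>'))\<^sup>2 \<partial>M \<partial>M)\<bar> \<le> \<delta> (nat \<bar>s - r\<bar>)"
    by (rule Lp_m_approximable_covariance_decay[OF assms(4)[OF u]]) (rule that)
  define \<Delta> where "\<Delta> = suminf \<delta>"
  have \<Delta>: "0 \<le> \<Delta>" unfolding \<Delta>_def by (intro suminf_nonneg \<delta>)
  obtain L where L: "L-lipschitz_on UNIV K" using assms(8) by blast
  have L0: "0 \<le> L" using lipschitz_on_nonneg[OF L] .
  obtain Bk where Bk: "\<And>x. \<bar>K x\<bar> \<le> Bk"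
    using assms(7) by (auto simp: bounded_iff)
  have Bk0: "0 \<le> Bk" using order_trans[OF abs_ge_zero Bk[of 0]] .
  \<comment> \<open>\<open>C1\<close> carries no sign assumption, while the radius
    \<open>c * h T\<close> of the kernel window has to be non-negative.\<close>
  define c where "c = max C1 0"
  have c: "0 \<le> c" and supp: "\<And>x. \<bar>x\<bar> > c \<Longrightarrow> K x = 0"
    using assms(9) by (auto simp: c_def)
  define W where "W T s = K ((u - real s / real T) / h T) / (real T * h T)" for T s :: nat
  define a where "a T = h T + sqrt (1 / (real T * h T)) + 1 / (real T * (h T)\<^sup>2)" for T
  have est: "cov_estimator K (h T) X T u \<omega> = (\<Sum>s = 1..T. W T s *\<^sub>R tensor (X s T \<omega>) (X s T \<omega>))" for T \<omega>
    by (simp add: cov_estimator_def W_def scaleR_sum_right)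
  \<comment> \<open>\<open>2 + c\<close> will bound \<open>1 + q\<close>, where
    \<open>q \<le> c + 1\<close> once \<open>h T \<le> 1\<close>.\<close>
  define c1 where "c1 = (2 + c) * (1 + Cu) + m2"
  have c1: "0 \<le> c1" using c Cu m2_nonneg by (simp add: c1_def)
  \<comment> \<open>The summands belong to the replacement of \<open>X\<close> by \<open>Y\<close>,
    to the fluctuation and to the kernel weights, in this order.\<close>
  define G where "G = Bk * c1 * (2 * c\<^sup>2 + 3 * c + 1) + (4 * Bk\<^sup>2 * \<Delta> * (2 * c + 1) + 1) / 2 + L * norm C"
  have G: "0 \<le> G"
    using Bk0 c1 c \<Delta> L0 by (simp add: G_def)
  \<comment> \<open>\<open>big_OP\<close> asks for measurability at every \<open>T\<close>,
    including \<open>T = 0\<close>, where the sum is empty.\<close>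
  have meas: "(\<lambda>\<omega>. norm (cov_estimator K (h T) X T u \<omega> - C)) \<in> borel_measurable M" for T
  proof (rule borel_measurable_norm_blinfun)
    fix x
    have [measurable]: "(\<lambda>\<omega>. \<Sum>s = 1..T. W T s *\<^sub>R (inner (X s T \<omega>) x *\<^sub>R X s T \<omega>)) \<in> borel_measurable M"
    proof (rule borel_measurable_sum)
      fix s assume "s \<in> {1..T}"
      note [measurable] = Xm[OF this]
      show "(\<lambda>\<omega>. W T s *\<^sub>R (inner (X s T \<omega>) x *\<^sub>R X s T \<omega>)) \<in> borel_measurable M"
        by measurable
    qed
    have "(\<lambda>\<omega>. norm ((\<Sum>s = 1..T. W T s *\<^sub>R (inner (X s T \<omega>) x *\<^sub>R X s T \<omega>)) - blinfun_apply C x))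
        \<in> borel_measurable M"
      by measurable
    then show "(\<lambda>\<omega>. norm (blinfun_apply (cov_estimator K (h T) X T u \<omega> - C) x)) \<in> borel_measurable M"
      by (simp add: est blinfun.diff_left blinfun.sum_left blinfun.scaleR_left tensor.rep_eq)
  qed
  have maj: "\<exists>Z. integrable M Z \<and> (AE \<omega> in M. norm (cov_estimator K (h T) X T u \<omega> - C) \<le> Z \<omega>)
      \<and> (\<integral>\<omega>. Z \<omega> \<partial>M) \<le> G * a T"
    if T: "1 \<le> T" and h: "0 < h T" "h T \<le> 1" "c * h T \<le> u" "c * h T \<le> 1 - u" for T
  proof -
    define q where "q = c * h T + 1 / real T"
    define n where "n = 2 * c * h T * real T + 1"
    define b where "b = Bk / (real T * h T)"
    \<comment> \<open>The kernel window: outside it the weights vanish, inside it the factor from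
      local stationarity is at most \<open>q\<close>.\<close>
    define I where "I = {s\<in>{1..T}. \<bar>u - real s / real T\<bar> \<le> c * h T}"
    note rate = rate_bounds[OF h(1,2) T c, folded a_def n_def q_def]
    have T0: "0 < real T" using T by simp
    have I: "finite I" "I \<subseteq> {1..T}" by (auto simp: I_def)
    have card: "real (card I) \<le> n"
      using card_lattice_interval_le[of "c * h T" "real T" T u] c h T0 by (simp add: I_def n_def)
    have n0: "0 \<le> n" using card by linarith
    have b0: "0 \<le> b" using Bk0 h T0 by (simp add: b_def)
    have W: "\<bar>W T s\<bar> \<le> b" for s
      using h T0 Bk by (simp add: W_def b_def abs_divide abs_mult divide_right_mono)
    have W0: "W T s = 0" if "s \<in> {1..T} - I" for s
    proof -
      have "c * h T < \<bar>u - real s / real T\<bar>" using that by (auto simp: I_def)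
      then have "c < \<bar>(u - real s / real T) / h T\<bar>" using h by (simp add: less_divide_eq abs_divide)
      then show ?thesis by (simp add: W_def supp)
    qed
    have q: "0 \<le> q" "q \<le> c + 1"
      using c h T mult_left_mono[OF h(2) c] by (auto simp: q_def intro!: add_mono)
    have "\<forall>s\<in>I. \<exists>V. integrable M V \<and>
        (AE \<omega> in M. norm (tensor (X s T \<omega>) (X s T \<omega>) - tensor (Y s \<omega>) (Y s \<omega>)) \<le> V \<omega>) \<and>
        (\<integral>\<omega>. V \<omega> \<partial>M) \<le> q * c1"
    proof
      fix s assume s: "s \<in> I"
      have sT: "s \<in> {1..T}" using s I by blast
      note Us = U[OF T sT, folded Y_def]
      have le: "AE \<omega> in M. norm (X s T \<omega> - Y s \<omega>) \<le> q * U s T \<omega>"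
        using conjunct1[OF Us] Us[THEN conjunct2, THEN conjunct2, THEN conjunct2]
      proof eventually_elim
        fix \<omega> assume "0 < U s T \<omega>"
          and d: "norm (X s T \<omega> - Y s \<omega>) \<le> (\<bar>real s / real T - u\<bar> + 1 / real T) * U s T \<omega>"
        moreover have "\<bar>real s / real T - u\<bar> + 1 / real T \<le> q"
          using s by (simp add: I_def q_def abs_minus_commute)
        ultimately show "norm (X s T \<omega> - Y s \<omega>) \<le> q * U s T \<omega>"
          by (intro order_trans[OF d mult_right_mono]) auto
      qed
      obtain V where V: "integrable M V"
        "AE \<omega> in M. norm (tensor (X s T \<omega>) (X s T \<omega>) - tensor (Y s \<omega>) (Y s \<omega>)) \<le> V \<omega>"
        "(\<integral>\<omega>. V \<omega> \<partial>M) \<le> q * ((1 + q) * (1 + Cu) + (\<integral>\<omega>. (norm (Y s \<omega>))\<^sup>2 \<partial>M))"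
        using Us by (elim conjE)
          (rule tensor_perturbation_majorant[OF in_Lp_4_imp_2[OF Y4'] _ _ _ \<open>\<rho> \<ge> 2\<close> q(1) le])
      have "(1 + q) * (1 + Cu) \<le> (2 + c) * (1 + Cu)"
        using q(2) Cu by (intro mult_right_mono) auto
      then have "q * ((1 + q) * (1 + Cu) + m2) \<le> q * c1"
        using q(1) by (intro mult_left_mono) (auto simp: c1_def)
      then have "(\<integral>\<omega>. V \<omega> \<partial>M) \<le> q * c1" using V(3) by (simp add: m2)
      with V(1,2) show "\<exists>V. integrable M V \<and>
        (AE \<omega> in M. norm (tensor (X s T \<omega>) (X s T \<omega>) - tensor (Y s \<omega>) (Y s \<omega>)) \<le> V \<omega>) \<and>
        (\<integral>\<omega>. V \<omega> \<partial>M) \<le> q * c1" by (intro exI conjI)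
    qed
    from bchoice[OF this] obtain V where V_all: "\<forall>s\<in>I. integrable M (V s) \<and>
        (AE \<omega> in M. norm (tensor (X s T \<omega>) (X s T \<omega>) - tensor (Y s \<omega>) (Y s \<omega>)) \<le> V s \<omega>) \<and>
        (\<integral>\<omega>. V s \<omega> \<partial>M) \<le> q * c1"
      by (elim exE) (rule that)
    have V: "integrable M (V s)"
      "AE \<omega> in M. norm (tensor (X s T \<omega>) (X s T \<omega>) - tensor (Y s \<omega>) (Y s \<omega>)) \<le> V s \<omega>"
      "(\<integral>\<omega>. V s \<omega> \<partial>M) \<le> q * c1" if "s \<in> I" for s
      using bspec[OF V_all that] by simp_all
    \<comment> \<open>With \<open>\<eta> = a T\<close>, a mean square of order
      \<open>(a T)\<^sup>2\<close> becomes a mean of order \<open>a T\<close>.\<close>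
    obtain Z where Z: "integrable M Z"
      "\<And>\<omega>. norm (\<Sum>s\<in>I. W T s *\<^sub>R (tensor (Y s \<omega>) (Y s \<omega>) - cov_op M (Y s))) \<le> Z \<omega>"
      "(\<integral>\<omega>. Z \<omega> \<partial>M) \<le> ((\<Sum>s\<in>I. \<Sum>r\<in>I. 2 * (\<bar>W T s\<bar> * \<bar>W T r\<bar> *
        \<bar>(\<integral>\<omega>. (inner (Y s \<omega>) (Y r \<omega>))\<^sup>2 \<partial>M)
          - (\<integral>\<omega>. \<integral>\<omega>'. (inner (Y s \<omega>) (Y r \<omega>'))\<^sup>2 \<partial>M \<partial>M)\<bar>)) / a T + a T) / 2"
      by (rule centred_tensor_sum_majorant[where Y = Y and w = "W T", OF Y4' I(1) rate(1)])
        (rule that)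
    \<comment> \<open>The deterministic part, present because the weights need not sum to 1.\<close>
    define J where "J = ((\<Sum>s\<in>I. W T s) - 1) *\<^sub>R C"
    have J: "norm J \<le> L * norm C * a T"
    proof -
      have "(\<Sum>s\<in>I. W T s) = (\<Sum>s = 1..T. W T s)"
        using I W0 by (intro sum.mono_neutral_left) auto
      then have "\<bar>(\<Sum>s\<in>I. W T s) - 1\<bar> \<le> L / (real T * (h T)\<^sup>2)"
        using kernel_weights_sum[OF L supp assms(10) h(1,3,4) T] by (simp add: W_def)
      also have "\<dots> \<le> L * a T"
        using mult_left_mono[OF rate(2) L0] by simp
      finally have "\<bar>(\<Sum>s\<in>I. W T s) - 1\<bar> * norm C \<le> L * a T * norm C"
        by (rule mult_right_mono) simp
      then show ?thesis by (simp add: J_def mult_ac)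
    qed
    let ?Z = "\<lambda>\<omega>. (\<Sum>s\<in>I. b * V s \<omega>) + Z \<omega> + norm J"
    have "AE \<omega> in M. \<forall>s\<in>I. norm (tensor (X s T \<omega>) (X s T \<omega>) - tensor (Y s \<omega>) (Y s \<omega>)) \<le> V s \<omega>"
      using V(2) I by (intro AE_finite_allI) auto
    then have "AE \<omega> in M. norm (cov_estimator K (h T) X T u \<omega> - C) \<le> ?Z \<omega>"
    proof eventually_elim
      fix \<omega> assume le: "\<forall>s\<in>I. norm (tensor (X s T \<omega>) (X s T \<omega>) - tensor (Y s \<omega>) (Y s \<omega>)) \<le> V s \<omega>"
      let ?D = "\<Sum>s\<in>I. W T s *\<^sub>R (tensor (X s T \<omega>) (X s T \<omega>) - tensor (Y s \<omega>) (Y s \<omega>))"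
      let ?E = "\<Sum>s\<in>I. W T s *\<^sub>R (tensor (Y s \<omega>) (Y s \<omega>) - cov_op M (Y s))"
      have "norm ?D \<le> (\<Sum>s\<in>I. norm (W T s *\<^sub>R (tensor (X s T \<omega>) (X s T \<omega>) - tensor (Y s \<omega>) (Y s \<omega>))))"
        by (rule norm_sum)
      also have "\<dots> \<le> (\<Sum>s\<in>I. b * V s \<omega>)"
        unfolding norm_scaleR using W le b0 by (intro sum_mono mult_mono) auto
      finally have D: "norm ?D \<le> (\<Sum>s\<in>I. b * V s \<omega>)" .
      have "cov_estimator K (h T) X T u \<omega> = (\<Sum>s\<in>I. W T s *\<^sub>R tensor (X s T \<omega>) (X s T \<omega>))"
        unfolding est using I W0 by (intro sum.mono_neutral_right) auto
      then have eq: "cov_estimator K (h T) X T u \<omega> - C = ?D + ?E + J"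
        by (simp add: covY J_def scaleR_diff_right scaleR_diff_left sum_subtractf scaleR_sum_left)
      have "norm (cov_estimator K (h T) X T u \<omega> - C) \<le> norm ?D + norm ?E + norm J"
        unfolding eq by (rule norm_triangle_le[OF add_right_mono[OF norm_triangle_ineq]])
      also have "\<dots> \<le> ?Z \<omega>"
        by (rule add_mono[OF add_mono[OF D Z(2)] order_refl])
      finally show "norm (cov_estimator K (h T) X T u \<omega> - C) \<le> ?Z \<omega>" .
    qed
    moreover have iZ: "integrable M ?Z" using V(1) Z(1) by simp
    moreover have "(\<integral>\<omega>. ?Z \<omega> \<partial>M) \<le> G * a T"
    proof -
      have "(\<integral>\<omega>. ?Z \<omega> \<partial>M) = (\<Sum>s\<in>I. b * (\<integral>\<omega>. V s \<omega> \<partial>M)) + (\<integral>\<omega>. Z \<omega> \<partial>M) + norm J"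
        using V(1) Z(1) by (simp add: prob_space)
      moreover have "(\<Sum>s\<in>I. b * (\<integral>\<omega>. V s \<omega> \<partial>M)) \<le> Bk * c1 * (2 * c\<^sup>2 + 3 * c + 1) * a T"
      proof -
        have "(\<Sum>s\<in>I. b * (\<integral>\<omega>. V s \<omega> \<partial>M)) \<le> (\<Sum>s\<in>I. b * (q * c1))"
          using V(3) b0 by (intro sum_mono mult_left_mono) auto
        also have "\<dots> = real (card I) * (b * (q * c1))" by simp
        also have "\<dots> \<le> n * (b * (q * c1))"
          using b0 q c1 by (intro mult_right_mono card) auto
        also have "\<dots> = Bk * c1 * (n / (real T * h T) * q)" by (simp add: b_def)
        also have "\<dots> \<le> Bk * c1 * ((2 * c\<^sup>2 + 3 * c + 1) * a T)"
          using Bk0 c1 by (intro mult_left_mono rate(3)) auto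
        finally show ?thesis by (simp add: mult_ac)
      qed
      moreover have "(\<integral>\<omega>. Z \<omega> \<partial>M) \<le> (4 * Bk\<^sup>2 * \<Delta> * (2 * c + 1) + 1) / 2 * a T"
      proof -
        have "(\<Sum>s\<in>I. \<Sum>r\<in>I. 2 * (\<bar>W T s\<bar> * \<bar>W T r\<bar> *
            \<bar>(\<integral>\<omega>. (inner (Y s \<omega>) (Y r \<omega>))\<^sup>2 \<partial>M)
              - (\<integral>\<omega>. \<integral>\<omega>'. (inner (Y s \<omega>) (Y r \<omega>'))\<^sup>2 \<partial>M \<partial>M)\<bar>))
            \<le> (\<Sum>s\<in>I. \<Sum>r\<in>I. 2 * (b * b * \<delta> (nat \<bar>int s - int r\<bar>)))"
          using W b0 dep unfolding Y_def by (intro sum_mono mult_left_mono mult_mono) auto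
        also have "\<dots> = (\<Sum>s\<in>I. 2 * b\<^sup>2 * (\<Sum>r\<in>I. \<delta> (nat \<bar>int s - int r\<bar>)))"
          by (simp add: sum_distrib_left power2_eq_square mult_ac)
        \<comment> \<open>Summability over the lags bounds the inner sum uniformly in
          \<open>s\<close>, so the double sum grows only like the number of indices.\<close>
        also have "\<dots> \<le> (\<Sum>s\<in>I. 2 * b\<^sup>2 * (2 * \<Delta>))"
          unfolding \<Delta>_def by (intro sum_mono mult_left_mono sum_abs_diff_le \<delta> I) simp
        also have "\<dots> = real (card I) * (4 * b\<^sup>2 * \<Delta>)" by simp
        also have "\<dots> \<le> n * (4 * b\<^sup>2 * \<Delta>)"
          using \<Delta> by (intro mult_right_mono card) auto
        also have "\<dots> = 4 * Bk\<^sup>2 * \<Delta> * (n / (real T * h T)\<^sup>2)"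
          by (simp add: b_def power_divide)
        also have "\<dots> \<le> 4 * Bk\<^sup>2 * \<Delta> * ((2 * c + 1) * (a T)\<^sup>2)"
          using \<Delta> by (intro mult_left_mono rate(4)) auto
        finally have S: "(\<Sum>s\<in>I. \<Sum>r\<in>I. 2 * (\<bar>W T s\<bar> * \<bar>W T r\<bar> *
            \<bar>(\<integral>\<omega>. (inner (Y s \<omega>) (Y r \<omega>))\<^sup>2 \<partial>M)
              - (\<integral>\<omega>. \<integral>\<omega>'. (inner (Y s \<omega>) (Y r \<omega>'))\<^sup>2 \<partial>M \<partial>M)\<bar>))
            \<le> 4 * Bk\<^sup>2 * \<Delta> * ((2 * c + 1) * (a T)\<^sup>2)" .
        have "(\<integral>\<omega>. Z \<omega> \<partial>M) \<le> (4 * Bk\<^sup>2 * \<Delta> * ((2 * c + 1) * (a T)\<^sup>2) / a T + a T) / 2"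
          using rate(1) by (intro order_trans[OF Z(3)] divide_right_mono add_right_mono S) auto
        also have "\<dots> = (4 * Bk\<^sup>2 * \<Delta> * (2 * c + 1) + 1) / 2 * a T"
          using rate(1) by (simp add: power2_eq_square field_simps)
        finally show ?thesis .
      qed
      ultimately show ?thesis
        using J unfolding G_def distrib_right by linarith
    qed
    ultimately show ?thesis by (intro exI[of _ ?Z]) blast
  qed
  have "\<forall>\<^sub>F T in sequentially. h T < \<epsilon>" if "0 < \<epsilon>" for \<epsilon>
    using order_tendstoD(2)[OF \<open>h \<longlonglongrightarrow> 0\<close> that] .
  note small = this
  \<comment> \<open>Below this threshold \<open>u\<close> lies in
    \<open>[c * h T, 1 - c * h T]\<close>; the denominator \<open>c + 1\<close> is positive even for
    \<open>c = 0\<close>.\<close>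
  have "0 < min u (1 - u) / (c + 1)" using c \<open>0 < u\<close> \<open>u < 1\<close> by simp
  from small[OF this] small[OF zero_less_one] eventually_ge_at_top[of 1]
  have "\<forall>\<^sub>F T in sequentially. 0 < a T \<and> (\<exists>Z. integrable M Z \<and>
      (AE \<omega> in M. \<bar>norm (cov_estimator K (h T) X T u \<omega> - C)\<bar> \<le> Z \<omega>) \<and> (\<integral>\<omega>. Z \<omega> \<partial>M) \<le> G * a T)"
  proof eventually_elim
    fix T assume hT: "h T < min u (1 - u) / (c + 1)" "h T < 1" and T: "1 \<le> T"
    have h0: "0 < h T" by (rule assms(11)[OF T])
    have "(c + 1) * h T < min u (1 - u)" using hT(1) c by (simp add: less_divide_eq mult.commute)
    then have ch: "c * h T \<le> u" "c * h T \<le> 1 - u"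
      using h0 by (auto simp: algebra_simps)
    have "0 < a T" unfolding a_def using rate_bounds(1)[OF h0 less_imp_le[OF hT(2)] T c] .
    then show "0 < a T \<and> (\<exists>Z. integrable M Z \<and>
        (AE \<omega> in M. \<bar>norm (cov_estimator K (h T) X T u \<omega> - C)\<bar> \<le> Z \<omega>) \<and> (\<integral>\<omega>. Z \<omega> \<partial>M) \<le> G * a T)"
      using maj[OF T h0 less_imp_le[OF hT(2)] ch] by simp
  qed
  from big_OP_majorantI[OF meas G this] show ?thesis
    unfolding a_def C_def .
qed

end
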